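(* Assume that $\operatorname{rank} \Phi'(\bar{p}) = n-1$ and $$\tau\big(\Phi(X)(\bar{p}), (\nabla^{E'}_{X}\Phi'(X))(\bar{p})\big)\neq 0$$ for any non-zero vector field $X$ on $L$ near $\bar{p}$ which spans $\ker \Phi'(\bar{p})$. Then $\pi^m$ has a singularity of type cuspidal edge at $\bar{p}$, that is, we may retake affine flat coordinates $\mathbf{p}=(p_1,\dots,p_n)$ of $\mathbb{R}^n_{\mathbf{p}}$ and its dual $\mathbf{x}=(x_1,\dots,x_n)$ of $\mathbb{R}^n_{\mathbf{x}}$ such that there exist neighborhoods $\bar{p}\in V\subset L$, $0\in\mathcal{U}_1\subset\mathbb{R}$, $(\bar{p}_2,\dots,\bar{p}_n)\in\mathcal{U}_2\subset\mathbb{R}^{n-1}$ and functions $\varphi\in C^\infty(\mathcal{U}_1\times\mathcal{U}_2)$, $k_1,k_2\in C^\infty(\mathcal{U}_2)$ satisfying that the bi-valued dual potential for the $m$-wavefront $\pi^m(V)$ is given by $$z'=z'_\pm(\mathbf{p})=k_2(p_2,\dots,p_n)+(p_1-k_1)\,\varphi\big(\pm\sqrt{p_1-k_1}, p_2,\dots,p_n\big)$$ with $p_1\geq k_1(p_2,\dots,p_n)$, and the derivative of $\varphi$ with respect to the first coordinate is non-zero.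
   Context: Let $\mathbb{R}^{2n+1}=T^*\mathbb{R}^n\times\mathbb{R}$ have coordinates $(\mathbf{x},\mathbf{p},z)$ and contact form $\theta=dz-\sum_i p_i\,dx_i$. Let $L\subset\mathbb{R}^{2n+1}$ be a Legendre submanifold ($\dim L=n$, $TL\subset\ker\theta$), and fix $\bar{p}=(\bar{\mathbf{x}},\bar{\mathbf{p}},\bar{z})\in L$ with $\bar{\mathbf{p}}=(\bar{p}_1,\dots,\bar{p}_n)$. The $e$-Legendre map is $\pi^e:L\to\mathbb{R}^n_{\mathbf{x}}\times\mathbb{R}_z$, $(\mathbf{x},\mathbf{p},z)\mapsto(\mathbf{x},z)$, and the $m$-Legendre map is $\pi^m:L\to\mathbb{R}^n_{\mathbf{p}}\times\mathbb{R}_{z'}$, $(\mathbf{x},\mathbf{p},z)\mapsto(\mathbf{p},z')$ with $z'=\mathbf{p}^T\mathbf{x}-z$; the image $\pi^m(L)$ is the $m$-wavefront. The vector bundle $E=\{(q,w)\in L\times(\mathbb{R}^n_{\mathbf{x}}\times\mathbb{R}_z): dz(w)-\mathbf{p}(q)^Td\mathbf{x}(w)=0\}$ carries $\Phi:TL\to E$, $v\mapsto d\pi^e(v)$, and the flat connection $\nabla^E$ obtained by projecting (along the $z$-axis) the trivial connection; its flat frame is $s_i=\partial/\partial x_i+p_i\,\partial/\partial z$. Analogously $E'\subset L\times(\mathbb{R}^n_{\mathbf{p}}\times\mathbb{R}_{z'})$ with $\Phi'=d\pi^m:TL\to E'$ and flat connection $\nabla^{E'}$ with flat frame $s_i^*=\partial/\partial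 p_i+x_i\,\partial/\partial z'$. Here $\tau=\sum_i dx_i\,dp_i$ (symmetrized), so $\tau(s_i,s_j^* )=\tfrac12\delta_{ij}$ and $\tau(\eta,\zeta')$ for $\eta\in E$, $\zeta'\in E'$ means $\tau(\eta\oplus0,0\oplus\zeta')$. Affine flat coordinates are changed by affine Legendre equivalences $(\mathbf{x},\mathbf{p},z)\mapsto(A\mathbf{x}+\mathbf{b},(A^T)^{-1}\mathbf{p}+\mathbf{b}',z+\mathbf{c}^T\mathbf{x}+d)$ with $\mathbf{b}'=(A^T)^{-1}\mathbf{c}$. A map-germ $(\mathbb{R}^n,0)\to(\mathbb{R}^{n+1},0)$ is of type cuspidal edge if it is right-left equivalent (via diffeomorphism germs of source and target) to $(x_1,\dots,x_n)\mapsto(x_1^3,x_1^2,x_2,\dots,x_n)$. *)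

theory Defs
  imports "HOL-Analysis.Analysis"
begin

(* Points of R^{2n+1} = T^*R^n x R, written (x, p, z). *)
type_synonym 'n pt = "(real^'n) \<times> (real^'n) \<times> real"

(* C^infinity on an open set: differentiable, and all directional derivatives are again C^infinity
   (greatest fixed point = derivatives of all orders exist). *)
coinductive smooth_on :: "'a::real_normed_vector set \<Rightarrow> ('a \<Rightarrow> 'b::real_normed_vector) \<Rightarrow> bool" where
  "open S \<Longrightarrow> f differentiable_on S \<Longrightarrow> (\<forall>v. smooth_on S (\<lambda>x. frechet_derivative f (at x) v))
    \<Longrightarrow> smooth_on S f"

definition diffeo_on :: "'a::real_normed_vector set \<Rightarrow> ('a \<Rightarrow> 'b::real_normed_vector) \<Rightarrow> bool" where
  "diffeo_on S h \<longleftrightarrow> open S \<and> open (h ` S) \<and> inj_on h S \<and> smooth_on S h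
      \<and> smooth_on (h ` S) (inv_into S h)"

definition contact_form :: "'n::finite pt \<Rightarrow> 'n pt \<Rightarrow> real" where
  "contact_form q w = snd (snd w) - fst (snd q) \<bullet> fst w"

definition sub_chart :: "'n::finite pt set \<Rightarrow> (real^'n) set \<Rightarrow> (real^'n \<Rightarrow> 'n pt) \<Rightarrow> bool" where
  "sub_chart L W f \<longleftrightarrow> open W \<and> smooth_on W f \<and> inj_on f W
      \<and> (\<exists>Ob. open Ob \<and> f ` W = L \<inter> Ob)
      \<and> continuous_on (f ` W) (inv_into W f)
      \<and> (\<forall>u\<in>W. inj (frechet_derivative f (at u)))"

definition legendre_submanifold :: "'n::finite pt set \<Rightarrow> bool" where
  "legendre_submanifold L \<longleftrightarrow>
     (\<forall>q\<in>L. \<exists>W f. sub_chart L W f \<and> q \<in> f ` W)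
   \<and> (\<forall>W f. sub_chart L W f \<longrightarrow>
        (\<forall>u\<in>W. \<forall>v. contact_form (f u) (frechet_derivative f (at u) v) = 0))"

definition tangent_space :: "'n::finite pt set \<Rightarrow> 'n pt \<Rightarrow> 'n pt set" where
  "tangent_space L q = {frechet_derivative f (at u) v | W f u v. sub_chart L W f \<and> u \<in> W \<and> f u = q}"

definition pi_e :: "'n::finite pt \<Rightarrow> (real^'n) \<times> real" where
  "pi_e q = (fst q, snd (snd q))"

definition pi_m :: "'n::finite pt \<Rightarrow> (real^'n) \<times> real" where
  "pi_m q = (fst (snd q), fst (snd q) \<bullet> fst q - snd (snd q))"

(* projection along the z'-axis of R^n_p x R_z' onto the fibre E'_q = {dz' - x(q)^T dp = 0} *)
definition proj_E' :: "'n::finite pt \<Rightarrow> (real^'n) \<times> real \<Rightarrow> (real^'n) \<times> real" where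
  "proj_E' q w = (fst w, fst q \<bullet> fst w)"

definition tau :: "(real^'n::finite) \<times> (real^'n) \<Rightarrow> (real^'n) \<times> (real^'n) \<Rightarrow> real" where
  "tau u w = (1/2) * (\<Sum>i\<in>UNIV. (fst u $ i) * (snd w $ i) + (snd u $ i) * (fst w $ i))"

(* tau(eta, zeta') := tau(eta + 0, 0 + zeta') for eta in E (x,z-part), zeta' in E' (p,z'-part) *)
definition tau_EE' :: "(real^'n::finite) \<times> real \<Rightarrow> (real^'n) \<times> real \<Rightarrow> real" where
  "tau_EE' \<eta> \<zeta> = tau (fst \<eta>, 0) (0, fst \<zeta>)"

definition affine_legendre ::
  "real^'n^'n \<Rightarrow> real^'n \<Rightarrow> real^'n \<Rightarrow> real \<Rightarrow> 'n::finite pt \<Rightarrow> 'n pt" where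
  "affine_legendre A b c d q =
     (A *v fst q + b,
      matrix_inv (transpose A) *v fst (snd q) + matrix_inv (transpose A) *v c,
      snd (snd q) + c \<bullet> fst q + d)"

(* cuspidal edge model (x_1^3, x_1^2, x_2, ..., x_n), with x_1 := the coordinate i *)
definition cusp_edge_model :: "'n::finite \<Rightarrow> real^'n \<Rightarrow> (real^'n) \<times> real" where
  "cusp_edge_model i x = ((\<chi> j. if j = i then (x $ i) ^ 3 else x $ j), (x $ i) ^ 2)"

definition cuspidal_edge_germ :: "(real^'n::finite \<Rightarrow> (real^'n) \<times> real) \<Rightarrow> real^'n \<Rightarrow> bool" where
  "cuspidal_edge_germ g u0 \<longleftrightarrow>
     (\<exists>(i::'n) S (h::real^'n \<Rightarrow> real^'n) T (k::(real^'n) \<times> real \<Rightarrow> (real^'n) \<times> real). u0 \<in> S \<and> diffeo_on S h \<and> h u0 = 0 \<and>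
        g u0 \<in> T \<and> g ` S \<subseteq> T \<and> diffeo_on T k \<and> k (g u0) = 0 \<and>
        (\<forall>u\<in>S. k (g u) = cusp_edge_model i (h u)))"

(* R^{n-1} = the coordinates other than i; encoded as functions/sets on R^n invariant in coordinate i *)
definition drop_coord :: "'n::finite \<Rightarrow> real^'n \<Rightarrow> real^'n" where
  "drop_coord i v = (\<chi> j. if j = i then 0 else v $ j)"

end

(*
  Near a fold point the chart of L can be chosen so that p_j = w_j for j <> i; the image of dp has
  codimension one, so i can be any coordinate axis outside of it.  The hypothesis on tau then says exactly
  that d(x_i)/dw_i and the second w_i-derivative of p_i do not vanish.  After replacing (x, p) by (-x, -p)
  if necessary, the parametric Morse lemma turns p_i into k1(w) + w_i^2.  The contact condition gives
  dz' = x . dp, hence the w_i-derivative of z' is 2 w_i x_i, so z' = k2(w) + w_i^2 phi(w_i, w), where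
  d(phi)/dw_i is nonzero because d(x_i)/dw_i is.  Substituting w_i = +-sqrt(p_i - k1) gives the potential.

  For the cuspidal edge split phi into even and odd parts in w_i.  By Whitney's theorem,
  phi = E(w_i^2, w) + w_i A(w_i^2, w) with E and A smooth also for negative first argument, so
  y = p_i - k1 and (z' - k2 - y E(y, p)) / A(y, p) are smooth target coordinates in which the map is
  (w_i^2, w_i^3).  The extension to negative arguments is Seeley's reflection by an infinite series.
*)
theory Submission
  imports Defs
begin

subsection \<open>Calculus of smooth functions\<close>

text \<open>Near a fold p_i >= k1 on the image, so the potential depends on sqrt (p_i - k1), which
  is not smooth at the edge. A right-left equivalence, however, needs target coordinates on a full
  neighbourhood, also where no point of the front lies. This obstacle forces Whitney's theorem: an
  even smooth function of s has to become a smooth function of s^2 on both sides of 0. Seeley's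
  reflection continues e(y) to y < 0 by sum a_k e(-4^k y). Matching all derivatives at 0 means sum
  a_k (-(4^k))^n = 1 for every n, which no finite sum achieves.

  The link between x and phi is one equation. If z' = k2 + s^2 phi(s) and p_i = k1 + s^2, then dz' =
  x . dp gives 2 phi + s phi_s = 2 x_i, hence 3 phi_s = 2 dx_i/ds at s = 0.

  No type of dimension n - 1 is formed: functions on R^(n-1) are functions on R^n that ignore
  coordinate i. The changes of chart in the Morse step replace only that coordinate, which keeps p_j
  = w_j for j <> i.\<close>

primrec ck_on :: "nat \<Rightarrow> 'a::real_normed_vector set \<Rightarrow> ('a \<Rightarrow> 'b::real_normed_vector) \<Rightarrow> bool" where
  "ck_on 0 S f \<longleftrightarrow> continuous_on S f"
| "ck_on (Suc k) S f \<longleftrightarrow> (\<forall>x\<in>S. f differentiable (at x)) \<and>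
      (\<forall>v. ck_on k S (\<lambda>x. frechet_derivative f (at x) v))"

lemma smooth_on_open: "smooth_on S f \<Longrightarrow> open S"
  by (auto elim: smooth_on.cases)

lemma smooth_on_differentiable: "smooth_on S f \<Longrightarrow> x \<in> S \<Longrightarrow> f differentiable (at x)"
  by (metis at_within_open differentiable_on_def smooth_on.cases)

lemma smooth_on_has_derivative:
  "smooth_on S f \<Longrightarrow> x \<in> S \<Longrightarrow> (f has_derivative frechet_derivative f (at x)) (at x)"
  using smooth_on_differentiable frechet_derivative_works by blast

lemma smooth_on_deriv: "smooth_on S f \<Longrightarrow> smooth_on S (\<lambda>x. frechet_derivative f (at x) v)"
  by (auto elim: smooth_on.cases)

lemma smooth_on_continuous: "smooth_on S f \<Longrightarrow> continuous_on S f"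
  by (auto elim: smooth_on.cases intro: differentiable_imp_continuous_on)

text \<open>Closure rules by coinduction would need an invariant that admits sums and products of
  derivatives. Finite orders are handled by plain induction instead; the one coinduction has the
  invariant that \<open>ck_on k S f\<close> holds for all k, which directional derivatives
  inherit.\<close>

lemma smooth_on_iff_ck: "smooth_on S f \<longleftrightarrow> open S \<and> (\<forall>k. ck_on k S f)"
proof
  assume f: "smooth_on S f"
  have "ck_on k S f" for k
    using f
  proof (induction k arbitrary: f)
    case 0
    then show ?case by (simp add: smooth_on_continuous)
  next
    case (Suc k)
    show ?case
      using smooth_on_differentiable[OF Suc.prems] Suc.IH[OF smooth_on_deriv[OF Suc.prems]] by simp
  qed
  then show "open S \<and> (\<forall>k. ck_on k S f)" using f smooth_on_open by auto
next
  assume "open S \<and> (\<forall>k. ck_on k S f)"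
  then show "smooth_on S f"
  proof (coinduction arbitrary: f)
    case smooth_on
    have "ck_on (Suc k) S f" for k using smooth_on by blast
    then have *: "\<forall>x\<in>S. f differentiable (at x)" "\<And>k v. ck_on k S (\<lambda>x. frechet_derivative f (at x) v)"
      by auto
    then have "f differentiable_on S"
      using smooth_on by (simp add: differentiable_on_eq_differentiable_at)
    with * smooth_on show ?case by blast
  qed
qed

lemma frechet_derivative_cong_open:
  assumes "open S" "x \<in> S" "\<And>y. y \<in> S \<Longrightarrow> f y = g y"
  shows "frechet_derivative f (at x) = frechet_derivative g (at x)"
proof -
  have "(f has_derivative F) (at x) \<longleftrightarrow> (g has_derivative F) (at x)" for F
    using assms has_derivative_transform_within_open[of f F x UNIV S g]
      has_derivative_transform_within_open[of g F x UNIV S f] by auto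
  then show ?thesis by (simp add: frechet_derivative_def)
qed

lemma ck_on_cong:
  assumes "open S" "\<And>x. x \<in> S \<Longrightarrow> f x = g x"
  shows "ck_on k S f \<longleftrightarrow> ck_on k S g"
proof -
  have "ck_on k S g" if "ck_on k S f" "\<And>x. x \<in> S \<Longrightarrow> f x = g x" for f g :: "'a \<Rightarrow> 'b"
    using that
  proof (induction k arbitrary: f g)
    case 0
    then show ?case by (simp cong: continuous_on_cong)
  next
    case (Suc k)
    have "g differentiable (at x)" if "x \<in> S" for x
    proof -
      have "f differentiable (at x)" using Suc.prems that by simp
      then obtain f' where "(f has_derivative f') (at x)" by (auto simp: differentiable_def)
      from has_derivative_transform_within_open[OF this assms(1) that] Suc.prems(2)
      show ?thesis by (auto simp: differentiable_def)
    qed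
    moreover have "ck_on k S (\<lambda>x. frechet_derivative g (at x) v)" for v
    proof (rule Suc.IH)
      show "ck_on k S (\<lambda>x. frechet_derivative f (at x) v)" using Suc.prems by simp
      show "frechet_derivative f (at x) v = frechet_derivative g (at x) v" if "x \<in> S" for x
        using frechet_derivative_cong_open[OF assms(1) that Suc.prems(2)] by simp
    qed
    ultimately show ?case by simp
  qed
  from this[of f g] this[of g f] show ?thesis using assms(2) by auto
qed

text \<open>Uniqueness of derivatives lets an explicit formula stand in for the choice operator
  behind \<open>frechet_derivative\<close>. The closure rules below are inductions in which that
  formula is built from terms of order k.\<close>

lemma ck_on_SucI:
  assumes "open S" "\<And>x. x \<in> S \<Longrightarrow> (f has_derivative f' x) (at x)" "\<And>v. ck_on k S (\<lambda>x. f' x v)"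
  shows "ck_on (Suc k) S f"
proof -
  have "frechet_derivative f (at x) = f' x" if "x \<in> S" for x
    using assms(2)[OF that] by (rule frechet_derivative_at[symmetric])
  then have "ck_on k S (\<lambda>x. frechet_derivative f (at x) v)" for v
    using assms(3)[of v] ck_on_cong[OF assms(1), of "\<lambda>x. frechet_derivative f (at x) v" "\<lambda>x. f' x v" k]
    by simp
  moreover have "f differentiable (at x)" if "x \<in> S" for x
    using assms(2)[OF that] by (auto simp: differentiable_def)
  ultimately show ?thesis by simp
qed

lemma ck_on_Suc_has_derivative:
  "ck_on (Suc k) S f \<Longrightarrow> x \<in> S \<Longrightarrow> (f has_derivative frechet_derivative f (at x)) (at x)"
  using frechet_derivative_works by auto

lemma ck_on_Suc_imp: "ck_on (Suc k) S f \<Longrightarrow> ck_on k S f"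
proof (induction k arbitrary: f)
  case 0
  then show ?case
    by (auto intro!: continuous_at_imp_continuous_on differentiable_imp_continuous_within)
next
  case (Suc k)
  have "ck_on k S (\<lambda>x. frechet_derivative f (at x) v)" for v
    by (rule Suc.IH) (use Suc.prems in simp)
  then show ?case using Suc.prems by simp
qed

lemma ck_on_imp_continuous: "ck_on k S f \<Longrightarrow> continuous_on S f"
proof (induction k)
  case (Suc k)
  from Suc.IH[OF ck_on_Suc_imp[OF Suc.prems]] show ?case .
qed simp

lemma ck_on_subset: "ck_on k S f \<Longrightarrow> T \<subseteq> S \<Longrightarrow> ck_on k T f"
proof (induction k arbitrary: f)
  case 0
  then show ?case by (auto intro: continuous_on_subset)
qed auto

lemma ck_on_const: "ck_on k S (\<lambda>x. c)"
  by (induction k arbitrary: c) auto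

lemma ck_on_bounded_linear_comp:
  assumes "open S" "bounded_linear h" "ck_on k S f"
  shows "ck_on k S (\<lambda>x. h (f x))"
  using assms(3)
proof (induction k arbitrary: f)
  case 0
  then show ?case using assms by (auto intro: bounded_linear.continuous_on)
next
  case (Suc k)
  show ?case
  proof (rule ck_on_SucI[OF assms(1)])
    show "((\<lambda>x. h (f x)) has_derivative (\<lambda>v. h (frechet_derivative f (at x) v))) (at x)" if "x \<in> S" for x
      using bounded_linear.has_derivative[OF assms(2)] ck_on_Suc_has_derivative[OF Suc.prems that] .
    show "ck_on k S (\<lambda>x. h (frechet_derivative f (at x) v))" for v
      using Suc by auto
  qed
qed

lemma ck_on_id: "open S \<Longrightarrow> ck_on k S (\<lambda>x. x)"
proof (cases k)
  case (Suc m)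
  assume S: "open S"
  show ?thesis unfolding Suc
    by (rule ck_on_SucI[OF S, where f' = "\<lambda>x v. v"]) (auto intro: ck_on_const has_derivative_ident)
qed auto

lemma ck_on_add:
  assumes "open S" "ck_on k S f" "ck_on k S g"
  shows "ck_on k S (\<lambda>x. f x + g x)"
  using assms(2,3)
proof (induction k arbitrary: f g)
  case 0
  then show ?case by (auto intro: continuous_intros)
next
  case (Suc k)
  show ?case
  proof (rule ck_on_SucI[OF assms(1)])
    show "((\<lambda>x. f x + g x) has_derivative
        (\<lambda>v. frechet_derivative f (at x) v + frechet_derivative g (at x) v)) (at x)" if "x \<in> S" for x
      using Suc.prems that by (intro has_derivative_add ck_on_Suc_has_derivative)
  qed (use Suc in auto)
qed

lemma ck_on_sum:
  assumes "open S" "\<And>i. i \<in> I \<Longrightarrow> ck_on k S (f i)"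
  shows "ck_on k S (\<lambda>x. \<Sum>i\<in>I. f i x)"
  using assms(2) by (induction I rule: infinite_finite_induct) (auto intro: ck_on_const ck_on_add assms(1))

text \<open>Both terms of the product rule are again values of \<open>B\<close> at functions of
  order k, so generalising over f and g closes the induction. Products, scalar multiples and inner
  products are all instances.\<close>

lemma ck_on_bilinear:
  assumes "open S" "bounded_bilinear B" "ck_on k S f" "ck_on k S g"
  shows "ck_on k S (\<lambda>x. B (f x) (g x))"
  using assms(3,4)
proof (induction k arbitrary: f g)
  case 0
  then show ?case using assms(2) by (auto intro: bounded_bilinear.continuous_on)
next
  case (Suc k)
  show ?case
  proof (rule ck_on_SucI[OF assms(1)])
    show "((\<lambda>x. B (f x) (g x)) has_derivative (\<lambda>h. B (f x) (frechet_derivative g (at x) h) +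
        B (frechet_derivative f (at x) h) (g x))) (at x)" if "x \<in> S" for x
      using Suc.prems that by (intro bounded_bilinear.FDERIV[OF assms(2)] ck_on_Suc_has_derivative)
    show "ck_on k S (\<lambda>x. B (f x) (frechet_derivative g (at x) v) +
        B (frechet_derivative f (at x) v) (g x))" for v
      using Suc.prems Suc.prems[THEN ck_on_Suc_imp] by (intro ck_on_add assms(1) Suc.IH) auto
  qed
qed

text \<open>In the chain rule the direction in which f is differentiated varies with x, whereas
  \<open>ck_on\<close> speaks of fixed directions. Expanding the direction in the basis of the
  middle space leaves coefficients of order k times fixed directional derivatives of f; this is why
  that space is Euclidean.\<close>

lemma ck_on_compose:
  fixes g :: "'a::real_normed_vector \<Rightarrow> 'b::euclidean_space"
  assumes "open S" "open T" "ck_on k S g" "g ` S \<subseteq> T" "ck_on k T f"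
  shows "ck_on k S (\<lambda>x. f (g x))"
  using assms(3,5)
proof (induction k arbitrary: f)
  case 0
  then show ?case using assms(4) by (auto intro: continuous_on_compose2)
next
  case (Suc k)
  show ?case
  proof (rule ck_on_SucI[OF assms(1)])
    show "((\<lambda>x. f (g x)) has_derivative
        (\<lambda>v. \<Sum>b\<in>Basis. (frechet_derivative g (at x) v \<bullet> b) *\<^sub>R frechet_derivative f (at (g x)) b)) (at x)"
      if "x \<in> S" for x
    proof -
      have gx: "g x \<in> T" using that assms(4) by auto
      have f: "(f has_derivative frechet_derivative f (at (g x))) (at (g x))"
        by (rule ck_on_Suc_has_derivative[OF Suc.prems(2) gx])
      interpret L: linear "frechet_derivative f (at (g x))"
        using f by (rule has_derivative_linear)
      have "frechet_derivative f (at (g x)) w = (\<Sum>b\<in>Basis. (w \<bullet> b) *\<^sub>R frechet_derivative f (at (g x)) b)" for w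
        using arg_cong[OF euclidean_representation[of w], of "frechet_derivative f (at (g x))"]
        by (simp only: L.sum L.scaleR)
      then have eq: "(\<lambda>v. frechet_derivative f (at (g x)) (frechet_derivative g (at x) v)) =
          (\<lambda>v. \<Sum>b\<in>Basis. (frechet_derivative g (at x) v \<bullet> b) *\<^sub>R frechet_derivative f (at (g x)) b)"
        by (intro ext)
      show ?thesis
        using has_derivative_compose[OF ck_on_Suc_has_derivative[OF Suc.prems(1) that] f] unfolding eq .
    qed
    show "ck_on k S (\<lambda>x. \<Sum>b\<in>Basis. (frechet_derivative g (at x) v \<bullet> b) *\<^sub>R frechet_derivative f (at (g x)) b)" for v
    proof (intro ck_on_sum assms(1) ck_on_bilinear[OF _ bounded_bilinear_scaleR])
      fix b :: 'b
      show "ck_on k S (\<lambda>x. frechet_derivative g (at x) v \<bullet> b)"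
        using Suc.prems(1)
        by (intro ck_on_bounded_linear_comp[OF assms(1) bounded_linear_inner_left]) simp
      show "ck_on k S (\<lambda>x. frechet_derivative f (at (g x)) b)"
        using Suc.prems(2) by (intro Suc.IH ck_on_Suc_imp[OF Suc.prems(1)]) simp
    qed
  qed
qed

lemma ck_on_Pair:
  assumes "open S" "ck_on k S f" "ck_on k S g"
  shows "ck_on k S (\<lambda>x. (f x, g x))"
proof -
  have "ck_on k S (\<lambda>x. (f x, 0) + (0, g x))"
    using assms by (intro ck_on_add ck_on_bounded_linear_comp[of S "\<lambda>x. (x, 0)"]
        ck_on_bounded_linear_comp[of S "\<lambda>x. (0, x)"])
      (auto intro!: bounded_linear_Pair bounded_linear_ident bounded_linear_zero)
  then show ?thesis by simp
qed

lemma ck_on_local: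
  assumes "\<And>x. x \<in> S \<Longrightarrow> \<exists>T. open T \<and> x \<in> T \<and> ck_on k T f"
  shows "ck_on k S f"
  using assms
proof (induction k arbitrary: f)
  case 0
  then show ?case
    by (force intro!: continuous_at_imp_continuous_on simp: continuous_on_eq_continuous_at)
next
  case (Suc k)
  have "f differentiable (at x)" if "x \<in> S" for x
    using Suc.prems[OF that] by auto
  moreover have "ck_on k S (\<lambda>x. frechet_derivative f (at x) v)" for v
  proof (rule Suc.IH)
    fix x assume "x \<in> S"
    from Suc.prems[OF this] show "\<exists>T. open T \<and> x \<in> T \<and> ck_on k T (\<lambda>x. frechet_derivative f (at x) v)"
      by auto
  qed
  ultimately show ?case by simp
qed

section \<open>Closure properties of smooth functions, carried over from finite order\<close>

lemma smooth_on_cong: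
  assumes "smooth_on S f" "\<And>x. x \<in> S \<Longrightarrow> f x = g x"
  shows "smooth_on S g"
  using assms ck_on_cong[of S f g] by (simp add: smooth_on_iff_ck)

lemma smooth_on_subset: "smooth_on S f \<Longrightarrow> open T \<Longrightarrow> T \<subseteq> S \<Longrightarrow> smooth_on T f"
  using ck_on_subset unfolding smooth_on_iff_ck by blast

lemma smooth_on_local:
  assumes "\<And>x. x \<in> S \<Longrightarrow> \<exists>T. x \<in> T \<and> T \<subseteq> S \<and> smooth_on T f"
  shows "smooth_on S f"
  unfolding smooth_on_iff_ck
proof (intro conjI allI)
  show "open S" using assms smooth_on_open by (subst open_subopen) blast
  show "ck_on k S f" for k
    using assms unfolding smooth_on_iff_ck by (intro ck_on_local) blast
qed

lemma smooth_on_const: "open S \<Longrightarrow> smooth_on S (\<lambda>x. c)"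
  by (simp add: smooth_on_iff_ck ck_on_const)

lemma smooth_on_id: "open S \<Longrightarrow> smooth_on S (\<lambda>x. x)"
  by (simp add: smooth_on_iff_ck ck_on_id)

lemma smooth_on_bounded_linear_comp:
  "bounded_linear h \<Longrightarrow> smooth_on S f \<Longrightarrow> smooth_on S (\<lambda>x. h (f x))"
  by (simp add: smooth_on_iff_ck ck_on_bounded_linear_comp)

lemma smooth_on_bounded_linear: "bounded_linear h \<Longrightarrow> open S \<Longrightarrow> smooth_on S h"
  using smooth_on_bounded_linear_comp[OF _ smooth_on_id] by blast

lemma smooth_on_add: "smooth_on S f \<Longrightarrow> smooth_on S g \<Longrightarrow> smooth_on S (\<lambda>x. f x + g x)"
  by (simp add: smooth_on_iff_ck ck_on_add)

lemma smooth_on_minus: "smooth_on S f \<Longrightarrow> smooth_on S (\<lambda>x. - f x)"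
  by (rule smooth_on_bounded_linear_comp[OF bounded_linear_minus[OF bounded_linear_ident]])

lemma smooth_on_diff: "smooth_on S f \<Longrightarrow> smooth_on S g \<Longrightarrow> smooth_on S (\<lambda>x. f x - g x)"
  using smooth_on_add[OF _ smooth_on_minus, of S f g] by simp

lemma smooth_on_bilinear:
  "bounded_bilinear B \<Longrightarrow> smooth_on S f \<Longrightarrow> smooth_on S g \<Longrightarrow> smooth_on S (\<lambda>x. B (f x) (g x))"
  by (simp add: smooth_on_iff_ck ck_on_bilinear)

lemmas smooth_on_mult = smooth_on_bilinear[OF bounded_bilinear_mult]
  and smooth_on_scaleR = smooth_on_bilinear[OF bounded_bilinear_scaleR]
  and smooth_on_inner = smooth_on_bilinear[OF bounded_bilinear_inner]
  and smooth_on_fst = smooth_on_bounded_linear_comp[OF bounded_linear_fst]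
  and smooth_on_snd = smooth_on_bounded_linear_comp[OF bounded_linear_snd]
  and smooth_on_nth = smooth_on_bounded_linear_comp[OF bounded_linear_vec_nth]

lemma smooth_on_Pair: "smooth_on S f \<Longrightarrow> smooth_on S g \<Longrightarrow> smooth_on S (\<lambda>x. (f x, g x))"
  by (simp add: smooth_on_iff_ck ck_on_Pair)

lemma smooth_on_sum:
  "open S \<Longrightarrow> (\<And>i. i \<in> I \<Longrightarrow> smooth_on S (f i)) \<Longrightarrow> smooth_on S (\<lambda>x. \<Sum>i\<in>I. f i x)"
  by (simp add: smooth_on_iff_ck ck_on_sum)

lemma smooth_on_power:
  fixes f :: "_ \<Rightarrow> real"
  shows "smooth_on S f \<Longrightarrow> smooth_on S (\<lambda>x. f x ^ n)"
  by (induction n) (auto intro: smooth_on_const smooth_on_open smooth_on_mult)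

lemma smooth_on_prod:
  fixes f :: "_ \<Rightarrow> _ \<Rightarrow> real"
  shows "open S \<Longrightarrow> (\<And>i. i \<in> I \<Longrightarrow> smooth_on S (f i)) \<Longrightarrow> smooth_on S (\<lambda>x. \<Prod>i\<in>I. f i x)"
  by (induction I rule: infinite_finite_induct) (auto intro: smooth_on_const smooth_on_mult)

lemma smooth_on_compose:
  fixes g :: "'a::real_normed_vector \<Rightarrow> 'b::euclidean_space"
  shows "smooth_on S g \<Longrightarrow> smooth_on T f \<Longrightarrow> g ` S \<subseteq> T \<Longrightarrow> smooth_on S (\<lambda>x. f (g x))"
  using ck_on_compose[of S T] unfolding smooth_on_iff_ck by blast

lemma smooth_on_vec_lambda:
  fixes f :: "'n::finite \<Rightarrow> 'a::real_normed_vector \<Rightarrow> real"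
  assumes "open S" "\<And>j. smooth_on S (f j)"
  shows "smooth_on S (\<lambda>x. \<chi> j. f j x)"
proof -
  have "smooth_on S (\<lambda>x. \<Sum>j\<in>UNIV. f j x *\<^sub>R axis j (1::real))"
    using assms by (intro smooth_on_sum smooth_on_scaleR smooth_on_const)
  then show ?thesis
    by (rule smooth_on_cong) (simp add: vec_eq_iff axis_def if_distrib cong: if_cong)
qed

text \<open>The derivative is a polynomial in \<open>inverse x\<close> itself, so order k of the
  function yields order k + 1.\<close>

lemma ck_on_inverse: "ck_on k (- {0}) (inverse :: real \<Rightarrow> real)"
proof (induction k)
  case 0
  then show ?case by (auto intro!: continuous_intros)
next
  case (Suc k)
  have op: "open (- {0::real})" by auto
  show ?case
  proof (rule ck_on_SucI[OF op, where f' = "\<lambda>x v. - (inverse x * v * inverse x)"])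
    show "ck_on k (- {0}) (\<lambda>x::real. - (inverse x * v * inverse x))" for v
      using Suc by (intro ck_on_bounded_linear_comp[OF op bounded_linear_minus[OF bounded_linear_ident]]
          ck_on_bilinear[OF op bounded_bilinear_mult] ck_on_const)
  qed (auto intro: has_derivative_inverse')
qed

lemma smooth_on_inverse:
  fixes f :: "_ \<Rightarrow> real"
  assumes "smooth_on S f" "\<And>x. x \<in> S \<Longrightarrow> f x \<noteq> 0"
  shows "smooth_on S (\<lambda>x. inverse (f x))"
  by (rule smooth_on_compose[OF assms(1), of "- {0}"])
    (use assms(2) ck_on_inverse in \<open>auto simp: smooth_on_iff_ck\<close>)

lemma smooth_on_divide:
  fixes f g :: "_ \<Rightarrow> real"
  assumes "smooth_on S f" "smooth_on S g" "\<And>x. x \<in> S \<Longrightarrow> g x \<noteq> 0"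
  shows "smooth_on S (\<lambda>x. f x / g x)"
  using smooth_on_mult[OF assms(1) smooth_on_inverse[OF assms(2,3)]] by (simp add: divide_inverse)

text \<open>The derivative is expressed through the function itself, as half the reciprocal of
  \<open>sqrt\<close>, so the induction closes with the rule for \<open>inverse\<close>.\<close>

lemma ck_on_sqrt: "ck_on k {0<..} sqrt"
proof (induction k)
  case 0
  then show ?case by (auto intro!: continuous_intros)
next
  case (Suc k)
  have op: "open {0::real<..}" by auto
  show ?case
  proof (rule ck_on_SucI[OF op, where f' = "\<lambda>x v. inverse (sqrt x) * v / 2"])
    have "ck_on k {0<..} (\<lambda>x. inverse (sqrt x))"
      by (rule ck_on_compose[OF op _ Suc _ ck_on_inverse]) auto
    then show "ck_on k {0<..} (\<lambda>x. inverse (sqrt x) * v / 2)" for v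
      unfolding divide_inverse
      by (intro ck_on_bilinear[OF op bounded_bilinear_mult] ck_on_const)
    show "(sqrt has_derivative (\<lambda>v. inverse (sqrt x) * v / 2)) (at x)" if "x \<in> {0<..}" for x
    proof -
      have "(sqrt has_derivative (*) (inverse (sqrt x) / 2)) (at x)"
        using DERIV_real_sqrt[of x] that by (simp add: has_field_derivative_def)
      then show ?thesis by (rule has_derivative_eq_rhs) auto
    qed
  qed
qed

lemma smooth_on_sqrt:
  assumes "smooth_on S f" "\<And>x. x \<in> S \<Longrightarrow> f x > 0"
  shows "smooth_on S (\<lambda>x. sqrt (f x))"
  by (rule smooth_on_compose[OF assms(1), of "{0<..}"])
    (use assms(2) ck_on_sqrt in \<open>auto simp: smooth_on_iff_ck\<close>)

subsection \<open>Parameter integrals, division and the inverse function theorem\<close>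

text \<open>Differentiation under the integral sign turns a directional derivative into another
  parameter integral, with an integrand one order lower. The open set \<open>T\<close> surrounds the
  closed strip, so that \<open>F\<close> is differentiable at r = 0 and r = 1 too.\<close>

lemma ck_on_integral_param:
  fixes F :: "'a::euclidean_space \<times> real \<Rightarrow> real"
  assumes "open S" "open T" "S \<times> {0..1} \<subseteq> T" "ck_on k T F"
  shows "ck_on k S (\<lambda>x. integral {0..1} (\<lambda>r. F (x, r)))"
  using assms(4)
proof (induction k arbitrary: F)
  case 0
  then have "continuous_on (S \<times> cbox 0 1) (\<lambda>(x, r). F (x, r))"
    using assms(3) by (auto intro: continuous_on_subset)
  from integral_continuous_on_param[OF this] show ?case by simp
next
  case (Suc k)
  define D where "D x r v = frechet_derivative F (at (x, r)) (v, 0)" for x r v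
  have F: "(F has_derivative frechet_derivative F (at (x, r))) (at (x, r))"
    if "x \<in> S" "r \<in> {0..1}" for x r
    by (rule ck_on_Suc_has_derivative[OF Suc.prems]) (use that assms(3) in auto)
  have D: "((\<lambda>x. F (x, r)) has_derivative D x r) (at x)" if "x \<in> S" "r \<in> {0..1}" for x r
    unfolding D_def
    by (rule has_derivative_compose[OF has_derivative_Pair[OF has_derivative_ident has_derivative_const] F[OF that]])
  have bl: "bounded_linear (D x r)" if "x \<in> S" "r \<in> {0..1}" for x r
    using D[OF that] by (rule has_derivative_bounded_linear)
  have ckD: "ck_on k T (\<lambda>(x, r). D x r v)" for v
    using Suc.prems by (auto simp: D_def case_prod_unfold)
  \<comment> \<open>\<open>leibniz_rule\<close> expects the derivative as a continuous map into the
    bounded linear functions; in finite dimension this continuity can be checked on each basis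
    direction.\<close>
  define B where "B x r = Blinfun (D x r)" for x r
  have B: "blinfun_apply (B x r) = D x r" if "x \<in> S" "r \<in> {0..1}" for x r
    unfolding B_def by (rule bounded_linear_Blinfun_apply[OF bl[OF that]])
  have contB: "continuous_on (S \<times> cbox 0 1) (\<lambda>(x, r). B x r)"
  proof (rule continuous_on_blinfun_componentwise)
    fix b :: 'a
    have "continuous_on (S \<times> cbox 0 1) (\<lambda>(x, r). D x r b)"
      using ck_on_imp_continuous[OF ckD] assms(3) by (auto intro: continuous_on_subset)
    then show "continuous_on (S \<times> cbox 0 1) (\<lambda>z. blinfun_apply (case z of (x, r) \<Rightarrow> B x r) b)"
      by (rule continuous_on_eq) (auto simp: B)
  qed
  have contF: "continuous_on (cbox 0 1) (\<lambda>r. F (x, r))" if "x \<in> S" for x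
    by (rule continuous_on_compose2[OF ck_on_imp_continuous[OF Suc.prems]])
      (use that assms(3) in \<open>auto intro!: continuous_intros\<close>)
  show ?case
  proof (rule ck_on_SucI[OF assms(1)])
    fix x assume x: "x \<in> S"
    then obtain e where e: "e > 0" "ball x e \<subseteq> S"
      using assms(1) open_contains_ball by blast
    have "((\<lambda>x. integral (cbox 0 1) (\<lambda>r. F (x, r))) has_derivative integral (cbox 0 1) (B x)) (at x within ball x e)"
    proof (rule leibniz_rule)
      show "((\<lambda>x. F (x, r)) has_derivative blinfun_apply (B y r)) (at y within ball x e)"
        if "y \<in> ball x e" "r \<in> cbox 0 1" for y r
      proof -
        have "y \<in> S" "r \<in> {0..1}" using that e by auto
        from D[OF this] B[OF this] show ?thesis by (simp add: has_derivative_at_withinI)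
      qed
      show "(\<lambda>r. F (y, r)) integrable_on cbox 0 1" if "y \<in> ball x e" for y
        using that e contF by (intro integrable_continuous) auto
      show "continuous_on (ball x e \<times> cbox 0 1) (\<lambda>(x, r). B x r)"
        using e by (intro continuous_on_subset[OF contB]) auto
    qed (use e in auto)
    then have "((\<lambda>x. integral {0..1} (\<lambda>r. F (x, r))) has_derivative integral {0..1} (B x)) (at x)"
      using e by (simp add: at_within_open[of x "ball x e"])
    moreover have "blinfun_apply (integral {0..1} (B x)) = (\<lambda>v. integral {0..1} (\<lambda>r. D x r v))"
    proof
      fix v
      have "continuous_on {0..1} (B x)"
        using continuous_on_compose2[OF contB continuous_on_Pair[OF continuous_on_const continuous_on_id],
            of x "{0..1}"] x by auto
      then have "B x integrable_on {0..1}"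
        by (rule integrable_continuous_real)
      from integral_linear[OF this blinfun.bounded_linear_left, of v]
      have "integral {0..1} (\<lambda>r. blinfun_apply (B x r) v) = blinfun_apply (integral {0..1} (B x)) v"
        by (simp add: o_def)
      moreover have "integral {0..1} (\<lambda>r. blinfun_apply (B x r) v) = integral {0..1} (\<lambda>r. D x r v)"
        by (rule integral_cong) (simp add: B x)
      ultimately show "blinfun_apply (integral {0..1} (B x)) v = integral {0..1} (\<lambda>r. D x r v)"
        by simp
    qed
    ultimately show "((\<lambda>x. integral {0..1} (\<lambda>r. F (x, r))) has_derivative
        (\<lambda>v. integral {0..1} (\<lambda>r. D x r v))) (at x)" by simp
  next
    show "ck_on k S (\<lambda>x. integral {0..1} (\<lambda>r. D x r v))" for v
      using Suc.IH[OF ckD[of v]] by simp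
  qed
qed

lemma smooth_on_integral_param:
  fixes F :: "'a::euclidean_space \<times> real \<Rightarrow> real"
  assumes "open S" "S \<times> {0..1} \<subseteq> T" "smooth_on T F"
  shows "smooth_on S (\<lambda>x. integral {0..1} (\<lambda>r. F (x, r)))"
  using assms ck_on_integral_param[of S T] by (auto simp: smooth_on_iff_ck)

lemma smooth_on_DERIV_fst:
  fixes h :: "real \<times> 'a::real_normed_vector \<Rightarrow> real"
  assumes "smooth_on S h" "(s, v) \<in> S"
  shows "((\<lambda>t. h (t, v)) has_real_derivative frechet_derivative h (at (s, v)) (1, 0)) (at s)"
proof -
  let ?D = "frechet_derivative h (at (s, v))"
  have h: "(h has_derivative ?D) (at (s, v))"
    by (rule smooth_on_has_derivative[OF assms])
  have "((\<lambda>t. h (t, v)) has_derivative (\<lambda>x. ?D (x, 0))) (at s)"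
    by (rule has_derivative_compose[OF has_derivative_Pair[OF has_derivative_ident has_derivative_const] h])
  moreover have "?D (x, 0) = ?D (1, 0) * x" for x
    using linear_cmul[OF has_derivative_linear[OF h], of x "(1, 0)"] by simp
  then have "(\<lambda>x. ?D (x, 0)) = (*) (?D (1, 0))" by (intro ext)
  ultimately show ?thesis by (simp only: has_field_derivative_def)
qed

text \<open>Hadamard's lemma: the quotient is the integral of the s-derivative of h at (r s, v) over
  r in [0, 1], by the fundamental theorem of calculus along the segment from 0 to s. The assumption
  \<open>star\<close> keeps this segment inside I.\<close>

lemma smooth_on_divide_fst:
  fixes h :: "real \<times> 'a::euclidean_space \<Rightarrow> real"
  assumes h: "smooth_on (I \<times> U) h" and "open I" "open U"
    and star: "\<And>s r. s \<in> I \<Longrightarrow> r \<in> {0..1} \<Longrightarrow> r * s \<in> I"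
    and zero: "\<And>v. v \<in> U \<Longrightarrow> h (0, v) = 0"
  obtains k where "smooth_on (I \<times> U) k" "\<And>s v. s \<in> I \<Longrightarrow> v \<in> U \<Longrightarrow> h (s, v) = s * k (s, v)"
proof
  define hs where "hs z = frechet_derivative h (at z) (1, 0)" for z
  have hs: "smooth_on (I \<times> U) hs"
    unfolding hs_def by (rule smooth_on_deriv[OF h])
  define m where "m = (\<lambda>z ::(real \<times> 'a) \<times> real. (snd z * fst (fst z), snd (fst z)))"
  let ?T = "m -` (I \<times> U)"
  have "continuous_on UNIV m" unfolding m_def by (intro continuous_intros)
  then have T: "open ?T"
    by (intro open_vimage open_Times assms)
  have "smooth_on ?T (\<lambda>z. (snd z * fst (fst z), snd (fst z)))"
    by (intro smooth_on_Pair smooth_on_mult smooth_on_fst smooth_on_snd smooth_on_id T)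
  then have "smooth_on ?T m" by (simp only: m_def[symmetric])
  then have smF: "smooth_on ?T (\<lambda>z. hs (m z))"
    by (rule smooth_on_compose[OF _ hs]) auto
  let ?k = "\<lambda>z. integral {0..1} (\<lambda>r. hs (m (z, r)))"
  show "smooth_on (I \<times> U) ?k"
  proof (rule smooth_on_integral_param[OF _ _ smF])
    show "open (I \<times> U)" by (intro open_Times assms)
    show "(I \<times> U) \<times> {0..1} \<subseteq> ?T" using star by (auto simp: m_def)
  qed
  fix s v assume sv: "s \<in> I" "v \<in> U"
  have "((\<lambda>r. s * hs (r * s, v)) has_integral h (1 * s, v) - h (0 * s, v)) {0..1}"
  proof (rule fundamental_theorem_of_calculus)
    fix r :: real assume r: "r \<in> {0..1}"
    have "((\<lambda>t. h (t, v)) has_real_derivative hs (r * s, v)) (at (r * s))"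
      unfolding hs_def by (rule smooth_on_DERIV_fst[OF h]) (use sv star[OF sv(1) r] in auto)
    then have "((\<lambda>r. h (r * s, v)) has_real_derivative hs (r * s, v) * s) (at r)"
      by (rule DERIV_chain2[where f = "\<lambda>t. h (t, v)" and g = "\<lambda>r. r * s"])
        (auto intro!: derivative_eq_intros)
    then have "((\<lambda>r. h (r * s, v)) has_real_derivative s * hs (r * s, v)) (at r within {0..1})"
      by (simp only: has_field_derivative_at_within mult.commute[of s])
    then show "((\<lambda>r. h (r * s, v)) has_vector_derivative s * hs (r * s, v)) (at r within {0..1})"
      by (simp only: has_real_derivative_iff_has_vector_derivative)
  qed simp
  from integral_unique[OF this] zero[OF sv(2)]
  have "integral {0..1} (\<lambda>r. s * hs (r * s, v)) = h (s, v)" by simp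
  then show "h (s, v) = s * ?k (s, v)" by (simp add: m_def)
qed

section \<open>The inverse function theorem for smooth maps\<close>

lemma smooth_on_det:
  fixes A :: "'a::real_normed_vector \<Rightarrow> real^'n^'n"
  assumes "open S" "\<And>a b. smooth_on S (\<lambda>x. A x $ a $ b)"
  shows "smooth_on S (\<lambda>x. det (A x))"
  unfolding det_def using assms
  by (intro smooth_on_sum smooth_on_mult smooth_on_prod smooth_on_const)

text \<open>\<open>inverse_function_theorem\<close> supplies a differentiable inverse g. Its
  derivative at y is a smooth function of g y, so if g has order k then so has the derivative, and g
  has order k + 1.\<close>

lemma smooth_inverse_function:
  fixes h :: "real^'n::finite \<Rightarrow> real^'n"
  assumes h: "smooth_on S h" and x0: "x0 \<in> S"
    and inj: "\<And>v. frechet_derivative h (at x0) v = 0 \<Longrightarrow> v = 0"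
  obtains U V g where "open U" "x0 \<in> U" "U \<subseteq> S" "open V" "h ` U = V" "smooth_on V g" "g ` V = U"
    "\<And>x. x \<in> U \<Longrightarrow> g (h x) = x" "\<And>y. y \<in> V \<Longrightarrow> h (g y) = y"
proof -
  define f' where "f' x = Blinfun (frechet_derivative h (at x))" for x
  have bl: "bounded_linear (frechet_derivative h (at x))" if "x \<in> S" for x
    using smooth_on_has_derivative[OF h that] by (rule has_derivative_bounded_linear)
  have f': "blinfun_apply (f' x) = frechet_derivative h (at x)" if "x \<in> S" for x
    unfolding f'_def by (rule bounded_linear_Blinfun_apply[OF bl[OF that]])
  have der: "(h has_derivative blinfun_apply (f' x)) (at x)" if "x \<in> S" for x
    using smooth_on_has_derivative[OF h that] f'[OF that] by simp
  have cont: "continuous_on S f'"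
  proof (rule continuous_on_blinfun_componentwise)
    fix b :: "real^'n"
    have "continuous_on S (\<lambda>x. frechet_derivative h (at x) b)"
      by (rule smooth_on_continuous[OF smooth_on_deriv[OF h]])
    then show "continuous_on S (\<lambda>x. blinfun_apply (f' x) b)"
      by (rule continuous_on_eq) (simp add: f')
  qed
  have "linear (frechet_derivative h (at x0))"
    using bl[OF x0] bounded_linear.linear by blast
  moreover from this have "inj (frechet_derivative h (at x0))"
    using inj linear_injective_0 by blast
  ultimately obtain k where k: "linear k" "k \<circ> frechet_derivative h (at x0) = id"
    using linear_injective_left_inverse by blast
  have "blinfun_apply (Blinfun k) = k"
    using k(1) by (simp add: bounded_linear_Blinfun_apply linear_conv_bounded_linear)
  then have "Blinfun k o\<^sub>L f' x0 = id_blinfun"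
    using k(2) by (intro blinfun_eqI) (simp add: f'[OF x0] fun_eq_iff)
  note ift = inverse_function_theorem[OF smooth_on_open[OF h] der cont x0 this]
  obtain U V g g' where UV: "open U" "U \<subseteq> S" "x0 \<in> U" "open V" "h x0 \<in> V" "homeomorphism U V h g"
    and g: "\<And>y. y \<in> V \<Longrightarrow> (g has_derivative (g' y)) (at y)"
    and g': "\<And>y. y \<in> V \<Longrightarrow> g' y = inv (blinfun_apply (f'(g y)))"
    and bij: "\<And>y. y \<in> V \<Longrightarrow> bij (blinfun_apply (f'(g y)))"
    by (rule ift[OF _ that]) simp
  have gU: "g ` V = U" "h ` U = V" "\<And>x. x \<in> U \<Longrightarrow> g (h x) = x" "\<And>y. y \<in> V \<Longrightarrow> h (g y) = y"
    using UV(6) by (auto simp: homeomorphism_def)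
  define M where "M x = matrix (frechet_derivative h (at x))" for x
  have M: "M x *v w = frechet_derivative h (at x) w" if "x \<in> S" for x w
    unfolding M_def using bl[OF that]
    by (simp add: matrix_works linear_matrix_vector_mul_eq bounded_linear.linear)
  have det: "det (M x) \<noteq> 0" if "x \<in> U" for x
  proof -
    have "x = g (h x)" "h x \<in> V" "x \<in> S" using gU that UV(2) by auto
    then have "inj (frechet_derivative h (at x))"
      using bij[of "h x"] f'[of x] by (auto simp: bij_def)
    moreover have "linear (frechet_derivative h (at x))"
      using bl[OF \<open>x \<in> S\<close>] bounded_linear.linear by blast
    ultimately show ?thesis unfolding M_def by (simp add: det_nz_iff_inj)
  qed
  \<comment> \<open>Cramer's rule for the inverse Jacobian applied to v: a quotient of determinants
    whose entries are smooth, with non-zero denominator on U.\<close>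
  define W where "W v x = (\<chi> m. det (\<chi> a b. if b = m then v $ a else M x $ a $ b) / det (M x))" for v x
  have smM: "smooth_on U (\<lambda>x. M x $ a $ b)" for a b
    unfolding M_def matrix_def
    using smooth_on_nth[OF smooth_on_deriv[OF smooth_on_subset[OF h UV(1,2)]]] by simp
  have smW: "smooth_on U (W v)" for v
    unfolding W_def
  proof (intro smooth_on_vec_lambda smooth_on_divide smooth_on_det UV(1) smM det)
    show "smooth_on U (\<lambda>x. (\<chi> a b. if b = j then v $ a else M x $ a $ b) $ a $ b)" for j a b
      using smM smooth_on_const[OF UV(1)] by (cases "b = j") simp_all
  qed
  have g'W: "g' y v = W v (g y)" if "y \<in> V" for y v
  proof -
    have gy: "g y \<in> U" "g y \<in> S" using gU that UV by auto
    have "frechet_derivative h (at (g y)) (g' y v) = v"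
      using g'[OF that] bij[OF that] f'[OF gy(2)] by (simp add: bij_def surj_f_inv_f)
    then have "M (g y) *v g' y v = v" by (simp add: M gy)
    then show ?thesis unfolding W_def using cramer[OF det[OF gy(1)]] by simp
  qed
  have "ck_on k V g" for k
  proof (induction k)
    case 0
    then show ?case using UV(6) by (simp add: homeomorphism_def)
  next
    case (Suc k)
    show ?case
    proof (rule ck_on_SucI[OF UV(4) g])
      have "ck_on k V (\<lambda>y. W v (g y))" for v
        using smW by (intro ck_on_compose[OF UV(4) UV(1) Suc]) (auto simp: gU smooth_on_iff_ck)
      then show "ck_on k V (\<lambda>y. g' y v)" for v
        using ck_on_cong[OF UV(4), of "\<lambda>y. g' y v" "\<lambda>y. W v (g y)"] g'W by simp
    qed
  qed
  then have "smooth_on V g" using UV(4) by (simp add: smooth_on_iff_ck)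
  with UV gU that show ?thesis by blast
qed

subsection \<open>Bump functions and Seeley's sequence\<close>

text \<open>The powers of \<open>1 / x\<close> make the family closed under differentiation.\<close>

definition flat :: "nat \<Rightarrow> real \<Rightarrow> real" where
  "flat n x = (if x > 0 then inverse x ^ n * exp (- inverse x) else 0)"

text \<open>In the variable t = 1 / x this is the decay of t^n / exp t at infinity; to the left of 0
  the function vanishes.\<close>

lemma flat_tendsto_0: "(flat n \<longlongrightarrow> 0) (at 0)"
proof (rule filterlim_split_at)
  have "((\<lambda>x. inverse x ^ n / exp (inverse x)) \<longlongrightarrow> (0::real)) (at_right 0)"
    by (rule filterlim_compose[OF tendsto_power_div_exp_0 filterlim_inverse_at_top_right])
  moreover have "\<forall>\<^sub>F x in at_right 0. inverse x ^ n / exp (inverse x) = flat n x"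
    using eventually_at_right_less[of 0]
    by eventually_elim (simp add: flat_def exp_minus divide_inverse)
  ultimately show "(flat n \<longlongrightarrow> 0) (at_right 0)"
    by (rule Lim_transform_eventually)
  have "\<forall>\<^sub>F x in at_left 0. 0 = flat n x"
    unfolding eventually_at_filter by (auto simp: flat_def)
  then show "(flat n \<longlongrightarrow> 0) (at_left 0)"
    by (rule Lim_transform_eventually[OF tendsto_const])
qed

lemma flat_DERIV: "(flat n has_real_derivative flat (n + 2) x - n * flat (n + 1) x) (at x)"
proof (cases x "0::real" rule: linorder_cases)
  case less
  have "((\<lambda>x. 0) has_real_derivative 0) (at x)" by simp
  then have "(flat n has_real_derivative 0) (at x)"
    by (rule has_field_derivative_transform_within_open[of _ _ _ "{..<0}"])
      (use less in \<open>auto simp: flat_def\<close>)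
  then show ?thesis using less by (simp add: flat_def)
next
  case equal
  \<comment> \<open>The difference quotient at 0 is the next member of the family, whose limit is
    already known.\<close>
  have "\<forall>\<^sub>F y in at (0::real). flat (n + 1) y = (flat n y - flat n 0) / (y - 0)"
    unfolding eventually_at_filter by (auto simp: flat_def field_simps)
  from Lim_transform_eventually[OF flat_tendsto_0 this]
  have "(flat n has_real_derivative 0) (at 0)"
    by (simp add: has_field_derivative_iff)
  then show ?thesis using equal by (simp add: flat_def)
next
  case greater
  have eq: "n * inverse x ^ (n - 1) * inverse (x * x) = n * (inverse x * inverse x ^ n)"
    using greater by (cases n) (auto simp: field_simps)
  have "((\<lambda>x. inverse x ^ n * exp (- inverse x)) has_real_derivative
      inverse x ^ n * (exp (- inverse x) * inverse (x * x))
      - n * inverse x ^ (n - 1) * inverse (x * x) * exp (- inverse x)) (at x)"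
    by (rule derivative_eq_intros refl | use greater in \<open>simp add: algebra_simps\<close>)+
  then have "((\<lambda>x. inverse x ^ n * exp (- inverse x)) has_real_derivative
      flat (n + 2) x - n * flat (n + 1) x) (at x)"
    unfolding eq using greater by (simp add: flat_def algebra_simps)
  then show ?thesis
    by (rule has_field_derivative_transform_within_open[of _ _ _ "{0<..}"])
      (use greater in \<open>auto simp: flat_def\<close>)
qed

lemma smooth_on_flat: "smooth_on UNIV (flat n)"
proof -
  have "ck_on k UNIV (flat n)" for k
  proof (induction k arbitrary: n)
    case 0
    show ?case
      using DERIV_isCont[OF flat_DERIV] by (auto intro: continuous_at_imp_continuous_on)
  next
    case (Suc k)
    show ?case
    proof (rule ck_on_SucI[OF open_UNIV])
      show "(flat n has_derivative (\<lambda>v. (flat (n + 2) x - n * flat (n + 1) x) * v)) (at x)" for x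
        using flat_DERIV unfolding has_field_derivative_def .
      show "ck_on k UNIV (\<lambda>x. (flat (n + 2) x - n * flat (n + 1) x) * v)" for v
        unfolding diff_conv_add_uminus
        by (intro ck_on_bilinear[OF open_UNIV bounded_bilinear_mult] ck_on_add ck_on_const open_UNIV Suc
            ck_on_bounded_linear_comp[OF open_UNIV bounded_linear_minus[OF bounded_linear_ident]])
    qed
  qed
  then show ?thesis by (simp add: smooth_on_iff_ck)
qed

text \<open>The usual quotient of flat functions, written in s^2 so that it is even. Because a^2 <
  b^2, the arguments b^2 - s^2 and s^2 - a^2 are never both non-positive, and the denominator stays
  positive.\<close>

lemma bump_exists:
  assumes "0 < a" "a < b"
  obtains bmp :: "real \<Rightarrow> real" where "smooth_on UNIV bmp" "\<And>s. bmp (- s) = bmp s"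
    "\<And>s. \<bar>s\<bar> \<le> a \<Longrightarrow> bmp s = 1" "\<And>s. \<bar>s\<bar> \<ge> b \<Longrightarrow> bmp s = 0"
proof
  define bmp where "bmp = (\<lambda>s. flat 0 (b\<^sup>2 - s\<^sup>2) / (flat 0 (b\<^sup>2 - s\<^sup>2) + flat 0 (s\<^sup>2 - a\<^sup>2)))"
  have pos: "flat 0 (b\<^sup>2 - s\<^sup>2) + flat 0 (s\<^sup>2 - a\<^sup>2) > 0" for s
  proof -
    have "a\<^sup>2 < b\<^sup>2" using assms by (simp add: power_strict_mono)
    then have "b\<^sup>2 - s\<^sup>2 > 0 \<or> s\<^sup>2 - a\<^sup>2 > 0" by linarith
    then show ?thesis by (auto simp: flat_def add_pos_nonneg add_nonneg_pos)
  qed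
  have fl: "smooth_on UNIV (\<lambda>s. flat 0 (p s))" if "smooth_on UNIV p" for p :: "real \<Rightarrow> real"
    by (rule smooth_on_compose[OF that smooth_on_flat]) auto
  show "smooth_on UNIV bmp"
    unfolding bmp_def
    using pos by (intro smooth_on_divide smooth_on_add fl smooth_on_diff smooth_on_power smooth_on_id
        smooth_on_const open_UNIV) (auto simp: less_imp_neq[symmetric])
  show "bmp (- s) = bmp s" for s by (simp add: bmp_def)
  show "bmp s = 1" if "\<bar>s\<bar> \<le> a" for s
  proof -
    have "s\<^sup>2 \<le> a\<^sup>2" using that assms by (simp add: abs_le_square_iff[symmetric])
    then show ?thesis using pos[of s] by (simp add: bmp_def flat_def)
  qed
  show "bmp s = 0" if "\<bar>s\<bar> \<ge> b" for s
  proof -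
    have "b\<^sup>2 \<le> s\<^sup>2" using that assms by (simp add: abs_le_square_iff[symmetric])
    then show ?thesis by (simp add: bmp_def flat_def)
  qed
qed

section \<open>Coefficients for Seeley's reflection\<close>

text \<open>The coefficients of Euler's product of the factors \<open>1 - x / 4 ^ j\<close>, which vanishes at all powers of 4.\<close>

primrec seeley_aux :: "nat \<Rightarrow> real" where
  "seeley_aux 0 = 1"
| "seeley_aux (Suc k) = - 4 / (4 ^ Suc k - 1) * seeley_aux k"

lemma four_pow_gt: "(4::real) ^ Suc k > 1"
  by (rule one_less_power) auto

text \<open>The ratio of consecutive terms is 4 c / (4^(k+1) - 1), which tends to 0; so the power
  series converges for every c. The bound 8 c + 1 < 4^N is what makes this ratio at most 1/2 from N
  on.\<close>

lemma seeley_aux_summable: "summable (\<lambda>k. \<bar>seeley_aux k\<bar> * c ^ k)" if "c \<ge> 0"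
proof -
  obtain N where N: "8 * c + 1 < 4 ^ N" using real_arch_pow[of 4 "8 * c + 1"] by auto
  show ?thesis
  proof (rule summable_ratio_test[of "1/2" N])
    fix k assume k: "k \<ge> N"
    have "(4::real) ^ N \<le> 4 ^ Suc k" using k by (intro power_increasing) auto
    then have le: "8 * c \<le> 4 ^ Suc k - 1" using N by linarith
    have "4 / (4 ^ Suc k - 1) * c \<le> 1 / 2"
      using le four_pow_gt[of k] by (simp add: field_simps)
    then have "(4 / (4 ^ Suc k - 1) * c) * (\<bar>seeley_aux k\<bar> * c ^ k) \<le> 1 / 2 * (\<bar>seeley_aux k\<bar> * c ^ k)"
      using that by (intro mult_right_mono) auto
    then show "norm (\<bar>seeley_aux (Suc k)\<bar> * c ^ Suc k) \<le> 1 / 2 * norm (\<bar>seeley_aux k\<bar> * c ^ k)"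
      using that four_pow_gt[of k] by (simp add: abs_mult abs_divide mult_ac)
  qed simp
qed

lemma seeley_aux_summable': "summable (\<lambda>k. seeley_aux k * c ^ k)" if "c \<ge> 0"
  using seeley_aux_summable[OF that] that
  by (intro summable_norm_cancel[of "\<lambda>k. seeley_aux k * c ^ k"]) (simp add: abs_mult power_abs)

text \<open>The product over j of (1 - x / 4^j) splits off its factor j = 0, and the remaining
  factors form the same product at x / 4. On coefficients this is exactly the recursion of
  \<open>seeley_aux\<close>, so no infinite product has to be handled.\<close>

lemma seeley_aux_functional:
  assumes "x \<ge> 0"
  shows "(\<Sum>k. seeley_aux k * x ^ k) = (1 - x) * (\<Sum>k. seeley_aux k * (x / 4) ^ k)"
proof -
  have s: "summable (\<lambda>k. seeley_aux k * x ^ k)" "summable (\<lambda>k. seeley_aux k * (x / 4) ^ k)"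
    using assms by (auto intro!: seeley_aux_summable')
  have step: "seeley_aux (Suc k) * x ^ Suc k =
      seeley_aux (Suc k) * (x / 4) ^ Suc k - x * (seeley_aux k * (x / 4) ^ k)" for k
    using four_pow_gt[of k] by (simp add: field_simps power_divide)
  have "(\<Sum>k. seeley_aux k * x ^ k) = 1 + (\<Sum>k. seeley_aux (Suc k) * x ^ Suc k)"
    using suminf_split_head[OF s(1)] by simp
  also have "\<dots> = 1 + ((\<Sum>k. seeley_aux (Suc k) * (x / 4) ^ Suc k) - (\<Sum>k. x * (seeley_aux k * (x / 4) ^ k)))"
    unfolding step using s(2)
    by (subst suminf_diff) (auto simp only: summable_Suc_iff[of "\<lambda>k. seeley_aux k * (x / 4) ^ k"] intro!: summable_mult)
  also have "\<dots> = (\<Sum>k. seeley_aux k * (x / 4) ^ k) - x * (\<Sum>k. seeley_aux k * (x / 4) ^ k)"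
    using suminf_split_head[OF s(2)] suminf_mult[OF s(2), of x] by simp
  finally show ?thesis by (simp add: algebra_simps)
qed

text \<open>The factor 1 - x gives the zero at x = 1, and the functional equation carries a zero
  from 4^n to 4^(n+1).\<close>

lemma seeley_aux_zero: "(\<Sum>k. seeley_aux k * (4 ^ n) ^ k) = 0"
proof (induction n)
  case 0
  then show ?case using seeley_aux_functional[of 1] by simp
next
  case (Suc n)
  then show ?case using seeley_aux_functional[of "4 ^ Suc n"] by simp
qed

text \<open>A crude geometric tail estimate, enough to show that the normalising constant of
  \<open>seeley_sequence\<close> is positive.\<close>

lemma seeley_aux_bound: "\<bar>seeley_aux (k + 2)\<bar> \<le> (1/2) ^ Suc k"
proof (induction k)
  case 0
  show ?case by (simp add: numeral_2_eq_2)
next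
  case (Suc k)
  have "(4::real) ^ 2 \<le> 4 ^ Suc (k + 2)" by (intro power_increasing) auto
  then have "4 / (4 ^ Suc (k + 2) - 1) \<le> (1/2::real)" by (simp add: field_simps)
  then have "4 / (4 ^ Suc (k + 2) - 1) * \<bar>seeley_aux (k + 2)\<bar> \<le> 1/2 * (1/2) ^ Suc k"
    using Suc by (intro mult_mono) auto
  moreover have "\<bar>seeley_aux (Suc k + 2)\<bar> = 4 / (4 ^ Suc (k + 2) - 1) * \<bar>seeley_aux (k + 2)\<bar>"
    using four_pow_gt[of "k + 2"] by (simp add: abs_mult abs_divide)
  ultimately show ?case by simp
qed

text \<open>Dividing by \<open>1 + 4 ^ k\<close> turns the vanishing moments of \<open>seeley_aux\<close> into alternating ones.\<close>

lemma seeley_sequence: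
  obtains a :: "nat \<Rightarrow> real" where "\<And>n. summable (\<lambda>k. \<bar>a k\<bar> * (4 ^ k) ^ n)"
    "\<And>n. (\<Sum>k. a k * (- (4 ^ k)) ^ n) = 1"
proof -
  define t where "t k = seeley_aux k / (1 + 4 ^ k)" for k
  have abs_t: "\<bar>t k\<bar> \<le> \<bar>seeley_aux k\<bar>" for k
  proof -
    have "\<bar>seeley_aux k\<bar> * 1 \<le> \<bar>seeley_aux k\<bar> * (1 + 4 ^ k)" by (intro mult_left_mono) auto
    then show ?thesis by (simp add: t_def abs_divide divide_le_eq add_pos_pos)
  qed
  have summ: "summable (\<lambda>k. \<bar>t k\<bar> * (4 ^ k) ^ n)" for n
  proof (rule summable_comparison_test'[OF seeley_aux_summable[of "4 ^ n"]])
    show "norm (\<bar>t k\<bar> * (4 ^ k) ^ n) \<le> \<bar>seeley_aux k\<bar> * (4 ^ n) ^ k" for k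
      using mult_right_mono[OF abs_t[of k], of "(4 ^ k) ^ n"]
      by (simp add: power_mult[symmetric] mult.commute)
  qed simp
  have summ': "summable (\<lambda>k. t k * (4 ^ k) ^ n)" for n
    using summ[of n] by (intro summable_norm_cancel[of "\<lambda>k. t k * (4 ^ k) ^ n"]) (simp add: abs_mult)
  define M where "M n = (\<Sum>k. t k * (4 ^ k) ^ n)" for n
  \<comment> \<open>Two neighbouring moments combine to the factor 4^k + 1, which cancels the
    denominator of \<open>t\<close>.\<close>
  have "M (Suc n) + M n = 0" for n
  proof -
    have "M (Suc n) + M n = (\<Sum>k. t k * (4 ^ k) ^ Suc n + t k * (4 ^ k) ^ n)"
      unfolding M_def by (rule suminf_add[OF summ' summ'])
    also have "\<dots> = (\<Sum>k. seeley_aux k * (4 ^ n) ^ k)"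
    proof (rule suminf_cong)
      fix k
      have "(1::real) + 4 ^ k \<noteq> 0" by (metis add_pos_pos less_numeral_extra(3) zero_less_numeral zero_less_one zero_less_power)
      then have "t k * (4 ^ k + 1) = seeley_aux k" by (simp add: t_def add.commute)
      then have "t k * (4 ^ k + 1) * (4 ^ k) ^ n = seeley_aux k * (4 ^ k) ^ n" by simp
      then show "t k * (4 ^ k) ^ Suc n + t k * (4 ^ k) ^ n = seeley_aux k * (4 ^ n) ^ k"
        by (simp add: algebra_simps power_mult[symmetric])
    qed
    finally show ?thesis using seeley_aux_zero by simp
  qed
  then have "M (Suc n) = - M n" for n by (simp add: eq_neg_iff_add_eq_0)
  then have M: "M n = (- 1) ^ n * M 0" for n by (induction n) auto
  \<comment> \<open>Division by \<open>M 0\<close> follows, so it must not vanish. The first two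
    terms are 1/2 - 4/15 = 7/30; the tail is at most 1/17, since 1 + 4^k >= 17 for k >= 2 and the
    bounds on \<open>seeley_aux\<close> form a geometric series with sum 1.\<close>
  have "M 0 > 0"
  proof -
    have s: "summable t" "summable (\<lambda>k. \<bar>t k\<bar>)" using summ'[of 0] summ[of 0] by simp_all
    have "\<bar>\<Sum>k. t (k + 2)\<bar> \<le> (\<Sum>k. \<bar>t (k + 2)\<bar>)"
      by (rule summable_rabs) (rule summable_ignore_initial_segment[OF s(2)])
    also have "\<dots> \<le> (\<Sum>k. 1/17 * (1/2) ^ Suc k)"
    proof (rule suminf_le)
      show "\<bar>t (k + 2)\<bar> \<le> 1/17 * (1/2) ^ Suc k" for k
      proof -
        have "(4::real) ^ 2 \<le> 4 ^ (k + 2)" by (intro power_increasing) auto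
        then have "17 \<le> 1 + (4::real) ^ (k + 2)" by simp
        then have "\<bar>seeley_aux (k + 2)\<bar> / (1 + 4 ^ (k + 2)) \<le> (1/2) ^ Suc k / 17"
          by (intro frac_le seeley_aux_bound) auto
        then show ?thesis by (simp add: t_def abs_divide del: seeley_aux.simps)
      qed
      show "summable (\<lambda>k. \<bar>t (k + 2)\<bar>)" using summable_ignore_initial_segment[OF s(2)] .
      show "summable (\<lambda>k. 1/17 * (1/2::real) ^ Suc k)"
        using summable_geometric[of "1/2::real"] by (intro summable_mult) (simp add: summable_mult)
    qed
    also have "\<dots> = 1/17"
      using sums_unique[OF sums_mult[OF power_half_series, of "1/17"]] by simp
    finally have "\<bar>\<Sum>k. t (k + 2)\<bar> \<le> 1/17" .
    moreover have "M 0 = (\<Sum>k. t (k + 2)) + (\<Sum>k<2. t k)"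
      using suminf_split_initial_segment[OF s(1), of 2] by (simp add: M_def)
    moreover have "(\<Sum>k<2. t k) = 1/2 - 4/15"
      by (simp add: numeral_2_eq_2 t_def)
    ultimately show ?thesis by simp
  qed
  show ?thesis
  proof
    show "summable (\<lambda>k. \<bar>t k / M 0\<bar> * (4 ^ k) ^ n)" for n
      using summable_divide[OF summ[of n], of "\<bar>M 0\<bar>"] by (simp add: abs_divide)
    show "(\<Sum>k. t k / M 0 * (- (4 ^ k)) ^ n) = 1" for n
    proof -
      have "(\<Sum>k. t k / M 0 * (- (4 ^ k)) ^ n) = (\<Sum>k. (- 1) ^ n / M 0 * (t k * (4 ^ k) ^ n))"
      proof (rule suminf_cong)
        show "t k / M 0 * (- (4 ^ k)) ^ n = (- 1) ^ n / M 0 * (t k * (4 ^ k) ^ n)" for k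
          by (subst (1) power_minus) simp
      qed
      also have "\<dots> = (- 1) ^ n / M 0 * M n"
        unfolding M_def by (rule suminf_mult[OF summ'])
      also have "\<dots> = ((- 1) * (- 1)) ^ n"
        using \<open>M 0 > 0\<close> by (subst M) (simp add: power_mult_distrib[symmetric])
      finally show ?thesis by simp
    qed
  qed
qed

subsection \<open>Whitney's theorem on even functions\<close>

text \<open>Support in \<bar>s\<bar> \<le> 1, uniform in v, has two effects on the reflected series:
  over a compact set of v all values of f obey one bound, and at a fixed y < 0 only finitely many
  terms survive.\<close>

definition even_supported :: "'a::euclidean_space set \<Rightarrow> (real \<times> 'a \<Rightarrow> real) \<Rightarrow> bool" where
  "even_supported U f \<longleftrightarrow> open U \<and> smooth_on (UNIV \<times> U) f \<and> (\<forall>s. \<forall>v\<in>U. f (- s, v) = f (s, v))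
     \<and> (\<forall>s. \<forall>v\<in>U. \<bar>s\<bar> > 1 \<longrightarrow> f (s, v) = 0)"

text \<open>With \<open>e y = f (sqrt y, v)\<close>, the half-derivative \<open>g = f\<^sub>s / (2 s)\<close> satisfies \<open>e' y = g (sqrt y, v)\<close>.\<close>

lemma even_supported_half_derivative:
  assumes f: "even_supported U f"
  obtains g where "even_supported U g"
    "\<And>s v. v \<in> U \<Longrightarrow> ((\<lambda>s. f (s, v)) has_real_derivative 2 * s * g (s, v)) (at s)"
proof -
  have U: "open U" and sm: "smooth_on (UNIV \<times> U) f" and ev: "\<And>s v. v \<in> U \<Longrightarrow> f (- s, v) = f (s, v)"
    and supp: "\<And>s v. v \<in> U \<Longrightarrow> \<bar>s\<bar> > 1 \<Longrightarrow> f (s, v) = 0"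
    using f by (auto simp: even_supported_def)
  define fs where "fs z = frechet_derivative f (at z) (1, 0)" for z
  have fs: "((\<lambda>s. f (s, v)) has_real_derivative fs (s, v)) (at s)" if "v \<in> U" for s v
    unfolding fs_def by (rule smooth_on_DERIV_fst[OF sm]) (use that in auto)
  have odd: "fs (- s, v) = - fs (s, v)" if v: "v \<in> U" for s v
  proof -
    have "((\<lambda>s. f (- s, v)) has_real_derivative fs (- s, v) * - 1) (at s)"
      by (rule DERIV_chain2[where f = "\<lambda>s. f (s, v)" and g = uminus, OF fs[OF v]])
        (auto intro!: derivative_eq_intros)
    then have "((\<lambda>s. f (s, v)) has_real_derivative fs (- s, v) * - 1) (at s)"
      using ev[OF v] by simp
    from DERIV_unique[OF this fs[OF v]] show ?thesis by simp
  qed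
  have supp': "fs (s, v) = 0" if v: "v \<in> U" and s: "\<bar>s\<bar> > 1" for s v
  proof -
    have "((\<lambda>s. f (s, v)) has_real_derivative 0) (at s)"
    proof (rule has_field_derivative_transform_within_open[OF DERIV_const])
      show "open {s::real. \<bar>s\<bar> > 1}" by (intro open_Collect_less continuous_intros)
    qed (use s supp v in auto)
    from DERIV_unique[OF fs[OF v] this] show ?thesis .
  qed
  have "smooth_on (UNIV \<times> U) (\<lambda>z. 1/2 * fs z)"
    unfolding fs_def
    by (intro smooth_on_mult smooth_on_deriv sm smooth_on_const smooth_on_open[OF sm])
  \<comment> \<open>The s-derivative of an even function is odd, hence zero at s = 0, so Hadamard's
    lemma applies.\<close>
  then obtain g where g: "smooth_on (UNIV \<times> U) g" "\<And>s v. v \<in> U \<Longrightarrow> 1/2 * fs (s, v) = s * g (s, v)"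
    by (rule smooth_on_divide_fst) (use U odd[of _ 0] in auto)
  have fsg: "fs (s, v) = 2 * s * g (s, v)" if "v \<in> U" for s v
    using g(2)[OF that, of s] by simp
  show ?thesis
  proof
    show "((\<lambda>s. f (s, v)) has_real_derivative 2 * s * g (s, v)) (at s)" if "v \<in> U" for s v
      using fs[OF that] fsg[OF that] by simp
    have "g (- s, v) = g (s, v)" if "v \<in> U" for s v
      using odd[OF that, of s] fsg[OF that] by (cases "s = 0") auto
    moreover have "g (s, v) = 0" if "v \<in> U" "\<bar>s\<bar> > 1" for s v
      using supp'[OF that] fsg[OF that(1), of s] that by auto
    ultimately show "even_supported U g" using g U by (auto simp: even_supported_def)
  qed
qed

lemma even_supported_snd_derivative:
  assumes f: "even_supported U f" and v: "v \<in> U"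
  shows "((\<lambda>v. f (s, v)) has_derivative (\<lambda>w. frechet_derivative f (at (s, v)) (0, w))) (at v)"
proof -
  have "(f has_derivative frechet_derivative f (at (s, v))) (at (s, v))"
    using f v by (intro smooth_on_has_derivative[of "UNIV \<times> U"]) (auto simp: even_supported_def)
  from has_derivative_compose[OF has_derivative_Pair[OF has_derivative_const has_derivative_ident] this]
  show ?thesis .
qed

text \<open>Together with the half-derivative this makes the class closed under both kinds of
  differentiation met in the induction of \<open>smooth_on_seeley\<close>.\<close>

lemma even_supported_snd:
  assumes f: "even_supported U f"
  shows "even_supported U (\<lambda>z. frechet_derivative f (at z) (0, w))"
proof -
  have U: "open U" and sm: "smooth_on (UNIV \<times> U) f" and ev: "\<And>s v. v \<in> U \<Longrightarrow> f (- s, v) = f (s, v)"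
    and supp: "\<And>s v. v \<in> U \<Longrightarrow> \<bar>s\<bar> > 1 \<Longrightarrow> f (s, v) = 0"
    using f by (auto simp: even_supported_def)
  note D = even_supported_snd_derivative[OF f]
  have "frechet_derivative f (at (- s, v)) (0, w) = frechet_derivative f (at (s, v)) (0, w)"
    if v: "v \<in> U" for s v
  proof -
    have "((\<lambda>v. f (s, v)) has_derivative (\<lambda>w. frechet_derivative f (at (- s, v)) (0, w))) (at v)"
      by (rule has_derivative_transform_within_open[OF D[OF v] U v]) (simp add: ev)
    from has_derivative_unique[OF this D[OF v]] show ?thesis by (simp add: fun_eq_iff)
  qed
  moreover have "frechet_derivative f (at (s, v)) (0, w) = 0" if v: "v \<in> U" and s: "\<bar>s\<bar> > 1" for s v
  proof -
    have "((\<lambda>v. f (s, v)) has_derivative (\<lambda>w. 0)) (at v)"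
      by (rule has_derivative_transform_within_open[OF has_derivative_const U v]) (simp add: supp s)
    from has_derivative_unique[OF this D[OF v]] show ?thesis by (simp add: fun_eq_iff)
  qed
  ultimately show ?thesis using U smooth_on_deriv[OF sm] by (auto simp: even_supported_def)
qed

text \<open>Only s in [-1, 1] matters, so compactness of [-1, 1] times K bounds f for all real
  s.\<close>

lemma even_supported_bounded:
  assumes f: "even_supported U f" and "compact K" "K \<subseteq> U"
  obtains M where "\<And>s v. v \<in> K \<Longrightarrow> \<bar>f (s, v)\<bar> \<le> M"
proof -
  have "continuous_on ({-1..1} \<times> K) f"
    using f assms smooth_on_continuous[of "UNIV \<times> U" f]
    by (auto simp: even_supported_def intro: continuous_on_subset)
  then have "compact (f ` ({-1..1} \<times> K))"
    using assms by (intro compact_continuous_image compact_Times) auto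
  then obtain M where M: "\<And>x. x \<in> f ` ({-1..1} \<times> K) \<Longrightarrow> norm x \<le> M"
    using compact_imp_bounded bounded_iff by metis
  have "\<bar>f (s, v)\<bar> \<le> max M 0" if "v \<in> K" for s v
  proof (cases "\<bar>s\<bar> \<le> 1")
    case True
    then have "f (s, v) \<in> f ` ({-1..1} \<times> K)" using that by (intro imageI) auto
    from M[OF this] show ?thesis by auto
  next
    case False
    then show ?thesis using f that assms by (auto simp: even_supported_def)
  qed
  then show ?thesis by (rule that)
qed

section \<open>Seeley's extension operator in the first variable\<close>

context
  fixes a :: "nat \<Rightarrow> real"
  assumes a_summable: "\<And>n. summable (\<lambda>k. \<bar>a k\<bar> * (4 ^ k) ^ n)"
    and a_moments: "\<And>n. (\<Sum>k. a k * (- (4 ^ k)) ^ n) = 1"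
begin

text \<open>The index \<open>n\<close> counts derivatives in \<open>y\<close>: each one brings out a factor \<open>- (4 ^ k)\<close>.\<close>

definition seeley_coeff :: "nat \<Rightarrow> nat \<Rightarrow> real" where
  "seeley_coeff n k = a k * (- (4 ^ k)) ^ n"

text \<open>On the negative side stand the reflections of f(sqrt y, v) about y = 0, dilated by the
  factors 4^k. The value n = 0 gives the extension itself; for larger n the coefficients are those
  of a termwise differentiated series.\<close>

definition seeley :: "nat \<Rightarrow> (real \<times> 'a \<Rightarrow> real) \<Rightarrow> real \<times> 'a \<Rightarrow> real" where
  "seeley n f = (\<lambda>(y, v). if y \<ge> 0 then f (sqrt y, v)
     else (\<Sum>k. seeley_coeff n k * f (sqrt (4 ^ k * (- y)), v)))"

lemma seeley_coeff_summable: "summable (\<lambda>k. \<bar>seeley_coeff n k\<bar>)"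
  using a_summable[of n] by (simp add: seeley_coeff_def abs_mult power_abs)

lemma seeley_coeff_sum: "(\<Sum>k. seeley_coeff n k) = 1"
  using a_moments[of n] by (simp add: seeley_coeff_def)

lemma seeley_coeff_Suc: "seeley_coeff (Suc n) k = - (4 ^ k * seeley_coeff n k)"
  by (simp add: seeley_coeff_def)

text \<open>At y = 0 every term of the series contains f(0, v), and the coefficients sum to 1. This
  is where the moment condition makes the two branches meet, for each n.\<close>

lemma seeley_nonpos:
  "y \<le> 0 \<Longrightarrow> seeley n f (y, v) = (\<Sum>k. seeley_coeff n k * f (sqrt (4 ^ k * (- y)), v))"
proof (cases "y = 0")
  case True
  have "summable (seeley_coeff n)"
    using seeley_coeff_summable by (rule summable_rabs_cancel)
  from suminf_mult2[OF this, of "f (0, v)"] show ?thesis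
    using True by (simp add: seeley_def seeley_coeff_sum)
qed (simp add: seeley_def)

text \<open>The bound of f over a closed ball of v holds for all s, so the absolutely summable
  coefficients dominate the series and it converges uniformly up to y = 0. The two closed halves are
  then glued along y = 0, where the branches agree.\<close>

lemma seeley_continuous:
  assumes f: "even_supported U f"
  shows "continuous_on (UNIV \<times> U) (seeley n f)"
proof -
  have U: "open U" using f by (simp add: even_supported_def)
  have cf: "continuous_on (UNIV \<times> U) f"
    using f smooth_on_continuous by (auto simp: even_supported_def)
  have "isCont (seeley n f) (y, v)" if v: "v \<in> U" for y v
  proof -
    obtain r where r: "r > 0" "cball v r \<subseteq> U" using U v open_contains_cball by blast
    let ?K = "cball v r"
    obtain M where M: "\<And>s v'. v' \<in> ?K \<Longrightarrow> \<bar>f (s, v')\<bar> \<le> M"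
      using even_supported_bounded[OF f, of ?K] r by auto
    let ?P = "\<lambda>z :: real \<times> 'a. fst z \<ge> 0"
    let ?f = "\<lambda>z. f (sqrt (fst z), snd z)"
    let ?t = "\<lambda>k z. seeley_coeff n k * f (sqrt (4 ^ k * (- fst z)), snd z)"
    let ?g = "\<lambda>z. \<Sum>k. ?t k z"
    have cont: "continuous_on (({0..} \<times> ?K) \<union> ({..0} \<times> ?K)) (\<lambda>z. if ?P z then ?f z else ?g z)"
    proof (rule continuous_on_cases)
      show "closed ({0::real..} \<times> ?K)" "closed ({..0::real} \<times> ?K)"
        by (intro closed_Times; simp)+
      have "continuous_on ({0..} \<times> ?K) (\<lambda>z. f (sqrt (fst z), snd z))"
        by (rule continuous_on_compose2[OF cf]) (use r in \<open>auto intro!: continuous_intros\<close>)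
      then show "continuous_on ({0..} \<times> ?K) ?f" .
      have "uniform_limit ({..0} \<times> ?K) (\<lambda>m z. \<Sum>k<m. ?t k z) ?g sequentially"
      proof (rule Weierstrass_m_test)
        show "norm (?t k z) \<le> \<bar>seeley_coeff n k\<bar> * M" if "z \<in> {..0} \<times> ?K" for k z
          using M[of "snd z"] that by (auto simp: abs_mult intro!: mult_left_mono)
        show "summable (\<lambda>k. \<bar>seeley_coeff n k\<bar> * M)"
          by (rule summable_mult2[OF seeley_coeff_summable])
      qed
      then show "continuous_on ({..0} \<times> ?K) ?g"
      proof (rule uniform_limit_theorem[rotated])
        have "continuous_on ({..0} \<times> ?K) (\<lambda>z. f (sqrt (4 ^ k * (- fst z)), snd z))" for k
          by (rule continuous_on_compose2[OF cf]) (use r in \<open>auto intro!: continuous_intros\<close>)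
        then show "\<forall>\<^sub>F m in sequentially. continuous_on ({..0} \<times> ?K) (\<lambda>z. \<Sum>k<m. ?t k z)"
          by (intro always_eventually allI continuous_intros)
      qed simp
      show "\<forall>z. z \<in> {0..} \<times> ?K \<and> \<not> ?P z \<or> z \<in> {..0} \<times> ?K \<and> ?P z \<longrightarrow> ?f z = ?g z"
      proof (intro allI impI)
        fix z assume "z \<in> {0..} \<times> ?K \<and> \<not> ?P z \<or> z \<in> {..0} \<times> ?K \<and> ?P z"
        then have "fst z = 0" by auto
        then show "?f z = ?g z" using seeley_nonpos[of 0 n f "snd z"] by (simp add: seeley_def)
      qed
    qed
    have eq: "({0::real..} \<times> ?K) \<union> ({..0} \<times> ?K) = UNIV \<times> ?K"
      "(\<lambda>z. if ?P z then ?f z else ?g z) = seeley n f"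
      by (auto simp: seeley_def fun_eq_iff)
    have "continuous_on (UNIV \<times> ?K) (seeley n f)"
      using cont unfolding eq .
    then have "continuous_on (UNIV \<times> ball v r) (seeley n f)"
      by (rule continuous_on_subset) auto
    then show ?thesis
      using r by (intro continuous_on_interior[of "UNIV \<times> ball v r"])
        (auto simp: interior_open open_Times)
  qed
  then show ?thesis by (auto intro!: continuous_at_imp_continuous_on)
qed

text \<open>The chain rule fails at y = 0, where \<open>sqrt\<close> has no derivative. For y > 0
  the factor 2 s cancels the derivative of \<open>sqrt\<close> and leaves g(sqrt y), which is
  continuous at 0; the mean value theorem then gives the one-sided derivative there.\<close>

lemma sqrt_comp_DERIV:
  assumes f: "\<And>s. (f has_real_derivative 2 * s * g s) (at s)" and g: "continuous_on UNIV g" and y: "y \<ge> 0"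
  shows "((\<lambda>y. f (sqrt y)) has_real_derivative g (sqrt y)) (at y within {0..})"
proof (cases "y = 0")
  case False
  then have y: "y > 0" using y by simp
  have "((\<lambda>y. f (sqrt y)) has_real_derivative 2 * sqrt y * g (sqrt y) * (inverse (sqrt y) / 2)) (at y)"
    by (rule DERIV_chain2[OF f DERIV_real_sqrt[OF y]])
  moreover have "2 * sqrt y * g (sqrt y) * (inverse (sqrt y) / 2) = g (sqrt y)"
    using y by (simp add: field_simps)
  ultimately show ?thesis by (simp only: has_field_derivative_at_within)
next
  case True
  have der: "((\<lambda>y. f (sqrt y)) has_real_derivative g (sqrt y)) (at y)" if "y > 0" for y
  proof -
    have "2 * sqrt y * g (sqrt y) * (inverse (sqrt y) / 2) = g (sqrt y)"
      using that by (simp add: field_simps)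
    with DERIV_chain2[OF f DERIV_real_sqrt[OF that]] show ?thesis by (simp only:)
  qed
  have cont: "continuous_on {0..} (\<lambda>y. f (sqrt y))"
    by (rule continuous_on_compose2[of UNIV f])
      (use f DERIV_isCont in \<open>auto intro!: continuous_intros continuous_at_imp_continuous_on\<close>)
  have contg: "continuous_on {0..} (\<lambda>y. g (sqrt y))"
    by (rule continuous_on_compose2[OF g]) (auto intro!: continuous_intros)
  have "((\<lambda>y. (f (sqrt y) - f (sqrt 0)) / (y - 0)) \<longlongrightarrow> g (sqrt 0)) (at 0 within {0..})"
  proof (rule tendstoI)
    fix e :: real assume e: "e > 0"
    from contg have "((\<lambda>y. g (sqrt y)) \<longlongrightarrow> g (sqrt 0)) (at 0 within {0..})"
      unfolding continuous_on_def by (rule bspec) simp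
    from tendstoD[OF this e] obtain d where d: "d > 0"
      "\<And>y. y \<ge> 0 \<Longrightarrow> y \<noteq> 0 \<Longrightarrow> y < d \<Longrightarrow> dist (g (sqrt y)) (g (sqrt 0)) < e"
      unfolding eventually_at by (auto simp: dist_real_def)
    have "dist ((f (sqrt y) - f (sqrt 0)) / (y - 0)) (g (sqrt 0)) < e" if y: "0 < y" "y < d" for y
    proof -
      have "\<exists>l z. 0 < z \<and> z < y \<and> ((\<lambda>y. f (sqrt y)) has_real_derivative l) (at z)
          \<and> f (sqrt y) - f (sqrt 0) = (y - 0) * l"
        using y(1) der by (intro MVT) (auto intro: continuous_on_subset[OF cont] simp: real_differentiable_def)
      then obtain l z where z: "0 < z" "z < y" "((\<lambda>y. f (sqrt y)) has_real_derivative l) (at z)"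
        "f (sqrt y) - f (sqrt 0) = (y - 0) * l" by blast
      have "l = g (sqrt z)" using DERIV_unique[OF z(3) der[OF z(1)]] .
      then show ?thesis using z y d(2)[of z] by simp
    qed
    then show "\<forall>\<^sub>F y in at 0 within {0..}. dist ((f (sqrt y) - f (sqrt 0)) / (y - 0)) (g (sqrt 0)) < e"
      unfolding eventually_at using d(1) by (intro exI[of _ d]) (auto simp: dist_real_def)
  qed
  then show ?thesis using True by (simp add: has_field_derivative_iff)
qed

text \<open>On the negative side the series is differentiated term by term. Each inner derivative
  -(4^k) is absorbed by passing from \<open>seeley_coeff n\<close> to
  \<open>seeley_coeff (Suc n)\<close>, whose absolute summability gives uniform convergence of the
  derivatives.\<close>

lemma seeley_DERIV_fst:
  assumes f: "even_supported U f" and g: "even_supported U g"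
    and fg: "\<And>s v. v \<in> U \<Longrightarrow> ((\<lambda>s. f (s, v)) has_real_derivative 2 * s * g (s, v)) (at s)"
    and v: "v \<in> U"
  shows "((\<lambda>y. seeley n f (y, v)) has_real_derivative seeley (Suc n) g (y, v)) (at y)"
proof -
  have cg: "continuous_on UNIV (\<lambda>s. g (s, v))"
    by (rule continuous_on_compose2[of "UNIV \<times> U" g])
      (use g v smooth_on_continuous in \<open>auto simp: even_supported_def intro!: continuous_intros\<close>)
  note e = sqrt_comp_DERIV[OF fg[OF v] cg]
  have pos: "((\<lambda>y. seeley n f (y, v)) has_real_derivative seeley (Suc n) g (y, v)) (at y within {0..})"
    if "y \<ge> 0" for y
  proof -
    have "((\<lambda>y. seeley n f (y, v)) has_real_derivative g (sqrt y, v)) (at y within {0..})"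
      by (rule has_field_derivative_transform_within[OF e[OF that] zero_less_one])
        (use that in \<open>auto simp: seeley_def\<close>)
    then show ?thesis using that by (simp add: seeley_def)
  qed
  have neg: "((\<lambda>y. seeley n f (y, v)) has_real_derivative seeley (Suc n) g (y, v)) (at y within {..0})"
    if y: "y \<le> 0" for y
  proof -
    obtain M where M: "\<And>s. \<bar>g (s, v)\<bar> \<le> M"
      using even_supported_bounded[OF g, of "{v}"] v by auto
    obtain Mf where Mf: "\<And>s. \<bar>f (s, v)\<bar> \<le> Mf"
      using even_supported_bounded[OF f, of "{v}"] v by auto
    let ?t = "\<lambda>k y. seeley_coeff n k * f (sqrt (4 ^ k * (- y)), v)"
    let ?t' = "\<lambda>k y. seeley_coeff (Suc n) k * g (sqrt (4 ^ k * (- y)), v)"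
    have "\<exists>G. \<forall>y\<in>{..0}. (\<lambda>k. ?t k y) sums G y \<and> (G has_real_derivative (\<Sum>k. ?t' k y)) (at y within {..0})"
    proof (rule has_field_derivative_series)
      show "(?t k has_real_derivative ?t' k y) (at y within {..0})" if "y \<in> {..0}" for k y
      proof -
        have "((\<lambda>y. f (sqrt y, v)) has_real_derivative g (sqrt (4 ^ k * (- y)), v))
            (at (4 ^ k * (- y)) within ((\<lambda>y. 4 ^ k * (- y)) ` {..0}))"
          by (rule has_field_derivative_subset[OF e]) (use that in \<open>auto simp: mult_nonneg_nonneg mult_le_0_iff\<close>)
        moreover have "((\<lambda>y. 4 ^ k * (- y)) has_real_derivative - (4 ^ k)) (at y within {..0})"
          by (auto intro!: derivative_eq_intros)
        ultimately have "((\<lambda>y. f (sqrt y, v)) \<circ> (\<lambda>y. 4 ^ k * (- y)) has_real_derivative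
            g (sqrt (4 ^ k * (- y)), v) * - (4 ^ k)) (at y within {..0})"
          by (rule DERIV_image_chain)
        from DERIV_cmult[OF this, of "seeley_coeff n k"] show ?thesis
          by (simp add: o_def seeley_coeff_Suc mult_ac)
      qed
      show "uniform_limit {..0} (\<lambda>m y. \<Sum>k<m. ?t' k y) (\<lambda>y. \<Sum>k. ?t' k y) sequentially"
      proof (rule Weierstrass_m_test)
        show "norm (?t' k y) \<le> \<bar>seeley_coeff (Suc n) k\<bar> * M" for k y
          using M by (auto simp: abs_mult intro!: mult_left_mono)
        show "summable (\<lambda>k. \<bar>seeley_coeff (Suc n) k\<bar> * M)"
          by (rule summable_mult2[OF seeley_coeff_summable])
      qed
      have "summable (\<lambda>k. \<bar>seeley_coeff n k\<bar> * Mf)"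
        by (rule summable_mult2[OF seeley_coeff_summable])
      then show "summable (\<lambda>k. ?t k 0)"
        by (rule summable_comparison_test') (use Mf in \<open>auto simp: abs_mult intro!: mult_left_mono\<close>)
    qed auto
    then obtain G where G: "\<And>y. y \<le> 0 \<Longrightarrow> (\<lambda>k. ?t k y) sums G y"
      "\<And>y. y \<le> 0 \<Longrightarrow> (G has_real_derivative (\<Sum>k. ?t' k y)) (at y within {..0})" by auto
    have eq: "G y = seeley n f (y, v)" if "y \<le> 0" for y
      using sums_unique[OF G(1)[OF that]] seeley_nonpos[OF that, of n f v] by simp
    have "((\<lambda>y. seeley n f (y, v)) has_real_derivative (\<Sum>k. ?t' k y)) (at y within {..0})"
      by (rule has_field_derivative_transform_within[OF G(2)[OF y] zero_less_one]) (use y eq in auto)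
    then show ?thesis using seeley_nonpos[OF y, of "Suc n" g v] by simp
  qed
  show ?thesis
  proof (cases y "0::real" rule: linorder_cases)
    case less
    then have "at y within {..0} = at y" by (intro at_within_interior) simp
    then show ?thesis using neg[of y] less by simp
  next
    case greater
    then have "at y within {0..} = at y" by (intro at_within_interior) simp
    then show ?thesis using pos[of y] greater by simp
  next
    case equal
    \<comment> \<open>The one-sided derivatives at 0 have the same value, so the difference quotient
      converges along the join of the two one-sided filters.\<close>
    have at: "at (0::real) = sup (at 0 within {..0}) (at 0 within {0..})"
      unfolding at_within_union[symmetric] by (rule arg_cong[of _ _ "\<lambda>S. at 0 within S"]) auto
    have "((\<lambda>y. (seeley n f (y, v) - seeley n f (0, v)) / (y - 0)) \<longlongrightarrow> seeley (Suc n) g (0, v))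
        (sup (at 0 within {..0}) (at 0 within {0..}))"
      using pos[of 0] neg[of 0] by (intro filterlim_sup) (simp_all add: has_field_derivative_iff)
    then show ?thesis unfolding equal has_field_derivative_iff at[symmetric] .
  qed
qed

text \<open>For y < 0 every term with 4^k (-y) > 1 falls outside the support of f. The cut-off N
  depends on y but not on v, so the series is a finite sum near v and may be differentiated
  termwise.\<close>

lemma seeley_derivative_snd:
  assumes f: "even_supported U f" and v: "v \<in> U"
  shows "((\<lambda>v. seeley n f (y, v)) has_derivative
     (\<lambda>w. seeley n (\<lambda>z. frechet_derivative f (at z) (0, w)) (y, v))) (at v)"
proof (cases "y \<ge> 0")
  case True
  then show ?thesis using even_supported_snd_derivative[OF f v] by (simp add: seeley_def)
next
  case False
  have U: "open U" using f by (simp add: even_supported_def)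
  obtain N where N: "1 / (- y) < 4 ^ N" using real_arch_pow[of 4 "1 / (- y)"] by auto
  have large: "\<bar>sqrt (4 ^ k * (- y))\<bar> > 1" if "k \<ge> N" for k
  proof -
    have "(4::real) ^ N \<le> 4 ^ k" using that by (intro power_increasing) auto
    then have "1 / (- y) < 4 ^ k" using N by linarith
    then have "1 < 4 ^ k * (- y)" using False by (simp add: field_simps)
    then show ?thesis by (simp add: real_less_rsqrt)
  qed
  have fin: "seeley n h (y, v') = (\<Sum>k<N. seeley_coeff n k * h (sqrt (4 ^ k * (- y)), v'))"
    if "even_supported U h" "v' \<in> U" for h v'
  proof -
    have "h (sqrt (4 ^ k * (- y)), v') = 0" if "k \<ge> N" for k
      using large[OF that] \<open>even_supported U h\<close> \<open>v' \<in> U\<close> by (auto simp: even_supported_def)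
    then show ?thesis
      using False by (simp add: seeley_def, intro suminf_finite) auto
  qed
  have "((\<lambda>v. \<Sum>k<N. seeley_coeff n k * f (sqrt (4 ^ k * (- y)), v)) has_derivative
      (\<lambda>w. \<Sum>k<N. seeley_coeff n k * frechet_derivative f (at (sqrt (4 ^ k * (- y)), v)) (0, w))) (at v)"
    by (intro has_derivative_sum has_derivative_mult_right even_supported_snd_derivative[OF f v])
  then have "((\<lambda>v. seeley n f (y, v)) has_derivative
      (\<lambda>w. \<Sum>k<N. seeley_coeff n k * frechet_derivative f (at (sqrt (4 ^ k * (- y)), v)) (0, w))) (at v)"
    by (rule has_derivative_transform_within_open[OF _ U v]) (simp add: fin f)
  then show ?thesis by (simp add: fin[OF even_supported_snd[OF f] v])
qed

text \<open>The two partial derivatives are again of the form \<open>seeley\<close>, with n raised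
  in the first variable and f replaced in both; hence the induction generalises over n and f. The
  total derivative comes from the partial ones, using continuity of the partial derivative in
  v.\<close>

lemma smooth_on_seeley:
  assumes "even_supported U f"
  shows "smooth_on (UNIV \<times> U) (seeley n f)"
proof -
  have U: "open U" using assms by (simp add: even_supported_def)
  then have op: "open (UNIV \<times> U :: (real \<times> 'a) set)" by (intro open_Times) auto
  have "ck_on m (UNIV \<times> U) (seeley n f)" for m
    using assms
  proof (induction m arbitrary: n f)
    case 0
    then show ?case by (simp add: seeley_continuous)
  next
    case (Suc m)
    note f = Suc.prems
    obtain g where g: "even_supported U g"
      "\<And>s v. v \<in> U \<Longrightarrow> ((\<lambda>s. f (s, v)) has_real_derivative 2 * s * g (s, v)) (at s)"
      using even_supported_half_derivative[OF f] by blast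
    let ?D = "\<lambda>w z. frechet_derivative f (at z) (0, w)"
    show ?case
    proof (rule ck_on_SucI[OF op])
      show "ck_on m (UNIV \<times> U) (\<lambda>z. seeley (Suc n) g z * fst t + seeley n (?D (snd t)) z)" for t
        by (intro ck_on_add op ck_on_bilinear[OF op bounded_bilinear_mult] ck_on_const
            Suc.IH g even_supported_snd f)
      fix z :: "real \<times> 'a" assume "z \<in> UNIV \<times> U"
      then obtain y v where z: "z = (y, v)" "v \<in> U" by auto
      obtain r where r: "r > 0" "ball v r \<subseteq> U" using U z(2) open_contains_ball by blast
      define B where "B y v = Blinfun (\<lambda>w. seeley n (?D w) (y, v))" for y v
      have B: "blinfun_apply (B y v) = (\<lambda>w. seeley n (?D w) (y, v))" if "v \<in> U" for y v
        unfolding B_def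
        by (rule bounded_linear_Blinfun_apply[OF has_derivative_bounded_linear[OF seeley_derivative_snd[OF f that]]])
      have "((\<lambda>(y, v). seeley n f (y, v)) has_derivative
          (\<lambda>(ty, tv). seeley (Suc n) g (y, v) * ty + blinfun_apply (B y v) tv)) (at (y, v) within UNIV \<times> ball v r)"
      proof (rule has_derivative_partialsI)
        show "((\<lambda>y. seeley n f (y, v)) has_derivative (*) (seeley (Suc n) g (y, v))) (at y)"
          using seeley_DERIV_fst[OF f g(1) g(2) z(2)] by (simp add: has_field_derivative_def)
        show "((\<lambda>v. seeley n f (x, v)) has_derivative blinfun_apply (B x v')) (at v' within ball v r)"
          if "v' \<in> ball v r" for x v'
        proof -
          have "v' \<in> U" using r that by auto
          from seeley_derivative_snd[OF f this] show ?thesis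
            by (simp add: B[OF \<open>v' \<in> U\<close>] has_derivative_at_withinI)
        qed
        have "continuous_on (UNIV \<times> ball v r) (\<lambda>z. B (fst z) (snd z))"
        proof (rule continuous_on_blinfun_componentwise)
          fix b :: 'a
          have "continuous_on (UNIV \<times> ball v r) (seeley n (?D b))"
            by (rule continuous_on_subset[OF seeley_continuous[OF even_supported_snd[OF f]]]) (use r in auto)
          then show "continuous_on (UNIV \<times> ball v r) (\<lambda>z. blinfun_apply (B (fst z) (snd z)) b)"
            by (rule continuous_on_eq) (use r in \<open>auto simp: B subset_eq\<close>)
        qed
        then show "continuous (at (y, v) within UNIV \<times> ball v r) (\<lambda>(y, v). B y v)"
          using r by (auto simp: continuous_on_eq_continuous_within case_prod_unfold)
      qed (use r in auto)
      moreover have "at (y, v) within UNIV \<times> ball v r = at (y, v)"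
        using r by (intro at_within_open) (auto intro: open_Times)
      ultimately show "(seeley n f has_derivative
          (\<lambda>t. seeley (Suc n) g z * fst t + seeley n (?D (snd t)) z)) (at z)"
        using z by (simp add: B case_prod_unfold)
    qed
  qed
  then show ?thesis using op by (simp add: smooth_on_iff_ck)
qed

end

text \<open>The function is rescaled to \<bar>s\<bar> < 1, cut off by an even bump and extended by
  Seeley's operator. The cut-off acts on s alone, so U does not shrink, as the parametric use
  requires.\<close>

lemma whitney_even:
  fixes f :: "real \<times> 'a::euclidean_space \<Rightarrow> real"
  assumes f: "smooth_on ({-e<..<e} \<times> U) f" and e: "e > 0" and U: "open U"
    and even: "\<And>s v. \<bar>s\<bar> < e \<Longrightarrow> v \<in> U \<Longrightarrow> f (- s, v) = f (s, v)"
  obtains F d where "d > 0" "d \<le> e" "smooth_on (UNIV \<times> U) F"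
    "\<And>s v. \<bar>s\<bar> < d \<Longrightarrow> v \<in> U \<Longrightarrow> f (s, v) = F (s\<^sup>2, v)"
proof -
  obtain \<rho> :: "real \<Rightarrow> real" where \<rho>: "smooth_on UNIV \<rho>" "\<And>s. \<rho> (- s) = \<rho> s"
    "\<And>s. \<bar>s\<bar> \<le> 1/3 \<Longrightarrow> \<rho> s = 1" "\<And>s. \<bar>s\<bar> \<ge> 2/3 \<Longrightarrow> \<rho> s = 0"
    using bump_exists[of "1/3" "2/3"] by auto
  \<comment> \<open>For \<bar>s\<bar> \<ge> 1 the second factor lies outside the domain where f is
    controlled, but the bump already vanishes from \<bar>s\<bar> = 2/3 on.\<close>
  define h where "h z = \<rho> (fst z) * f (e * fst z, snd z)" for z
  have "smooth_on (UNIV \<times> U) h"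
  proof (rule smooth_on_local)
    fix z :: "real \<times> 'a" assume "z \<in> UNIV \<times> U"
    then obtain s v where z: "z = (s, v)" "v \<in> U" by auto
    show "\<exists>T. z \<in> T \<and> T \<subseteq> UNIV \<times> U \<and> smooth_on T h"
    proof (cases "\<bar>s\<bar> < 1")
      case True
      let ?T = "{-1<..<1::real} \<times> U"
      have op: "open ?T" using U by (intro open_Times) auto
      have "smooth_on ?T (\<lambda>z. \<rho> (fst z))"
        by (rule smooth_on_compose[OF smooth_on_fst[OF smooth_on_id[OF op]] \<rho>(1)]) auto
      moreover have "smooth_on ?T (\<lambda>z. f (e * fst z, snd z))"
        by (rule smooth_on_compose[OF smooth_on_Pair[OF smooth_on_mult[OF smooth_on_const[OF op]
                smooth_on_fst[OF smooth_on_id[OF op]]] smooth_on_snd[OF smooth_on_id[OF op]]] f])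
          (use e mult_strict_left_mono[of _ 1 e] mult_strict_left_mono[of "-1" _ e] in auto)
      ultimately have "smooth_on ?T h" unfolding h_def by (rule smooth_on_mult)
      then show ?thesis using True z by (intro exI[of _ ?T]) auto
    next
      case False
      let ?T = "{s::real. 2/3 < \<bar>s\<bar>} \<times> U"
      have op: "open ?T" using U by (intro open_Times open_Collect_less continuous_intros) auto
      have "smooth_on ?T h"
        by (rule smooth_on_cong[OF smooth_on_const[OF op, of 0]]) (auto simp: h_def \<rho>(4))
      then show ?thesis using False z by (intro exI[of _ ?T]) auto
    qed
  qed
  moreover have "h (- s, v) = h (s, v)" if "v \<in> U" for s v
  proof (cases "\<bar>s\<bar> < 1")
    case True
    then have "\<bar>e * s\<bar> < e" using e by (simp add: abs_mult)
    from even[OF this that] show ?thesis by (simp add: h_def \<rho>)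
  next
    case False
    then show ?thesis by (simp add: h_def \<rho>)
  qed
  moreover have "h (s, v) = 0" if "\<bar>s\<bar> > 1" for s v
    using that by (simp add: h_def \<rho>)
  ultimately have h: "even_supported U h" using U by (simp add: even_supported_def)
  obtain a :: "nat \<Rightarrow> real" where a: "\<And>n. summable (\<lambda>k. \<bar>a k\<bar> * (4 ^ k) ^ n)"
    "\<And>n. (\<Sum>k. a k * (- (4 ^ k)) ^ n) = 1" using seeley_sequence by blast
  have G: "smooth_on (UNIV \<times> U) (seeley a 0 h)" by (rule smooth_on_seeley[OF a h])
  show ?thesis
  proof
    \<comment> \<open>The bump equals 1 for \<bar>s / e\<bar> \<le> 1/3, so f is recovered for
      \<bar>s\<bar> < e/3; the factor 1 / e^2 in the witness undoes the rescaling in the variable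
      s^2.\<close>
    show "e / 3 > 0" "e / 3 \<le> e" using e by auto
    have op: "open (UNIV \<times> U :: (real \<times> 'a) set)" using U by (intro open_Times) auto
    have "smooth_on (UNIV \<times> U) (\<lambda>z. (1 / e\<^sup>2 * fst z, snd z))"
      by (intro smooth_on_Pair smooth_on_mult smooth_on_const smooth_on_fst smooth_on_snd smooth_on_id op)
    then show "smooth_on (UNIV \<times> U) (\<lambda>z. seeley a 0 h (1 / e\<^sup>2 * fst z, snd z))"
      by (rule smooth_on_compose[OF _ G]) auto
    fix s v assume s: "\<bar>s\<bar> < e / 3" and v: "v \<in> U"
    have "seeley a 0 h (1 / e\<^sup>2 * s\<^sup>2, v) = h (\<bar>s / e\<bar>, v)"
      by (simp add: seeley_def[OF a] power_divide[symmetric])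
    also have "\<dots> = h (s / e, v)"
    proof -
      have "h (- (s / e), v) = h (s / e, v)" using h v by (simp only: even_supported_def)
      then show ?thesis by (cases "s / e \<ge> 0") (simp_all only: abs_of_nonneg abs_of_neg not_le)
    qed
    also have "\<dots> = f (s, v)"
      using s e by (simp add: h_def \<rho>(3) abs_divide)
    finally show "f (s, v) = seeley a 0 h (1 / e\<^sup>2 * fst (s\<^sup>2, v), snd (s\<^sup>2, v))" by simp
  qed
qed

subsection \<open>Changing one coordinate\<close>

lemma smooth_on_fd_chain:
  assumes "smooth_on S g" "x \<in> S" "smooth_on T f" "g x \<in> T"
  shows "frechet_derivative (\<lambda>x. f (g x)) (at x) = (\<lambda>v. frechet_derivative f (at (g x)) (frechet_derivative g (at x) v))"
  using has_derivative_compose[OF smooth_on_has_derivative[OF assms(1,2)] smooth_on_has_derivative[OF assms(3,4)]]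
  by (rule frechet_derivative_at[symmetric])

lemma smooth_on_fd_linear:
  assumes "bounded_linear h" "smooth_on S f" "x \<in> S"
  shows "frechet_derivative (\<lambda>x. h (f x)) (at x) = (\<lambda>v. h (frechet_derivative f (at x) v))"
  using bounded_linear.has_derivative[OF assms(1) smooth_on_has_derivative[OF assms(2,3)]]
  by (rule frechet_derivative_at[symmetric])

lemma smooth_on_fd_scale:
  assumes "smooth_on S f" "x \<in> S"
  shows "frechet_derivative f (at x) (c *\<^sub>R v) = c *\<^sub>R frechet_derivative f (at x) v"
  by (rule linear_cmul[OF has_derivative_linear[OF smooth_on_has_derivative[OF assms]]])

lemma smooth_left_inverse_fd:
  assumes "smooth_on S h" "x \<in> S" "smooth_on T g" "h x \<in> T" "\<And>y. y \<in> S \<Longrightarrow> g (h y) = y"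
  shows "frechet_derivative g (at (h x)) (frechet_derivative h (at x) v) = v"
proof -
  have "((\<lambda>y. g (h y)) has_derivative (\<lambda>v. frechet_derivative g (at (h x)) (frechet_derivative h (at x) v))) (at x)"
    by (rule has_derivative_compose[OF smooth_on_has_derivative[OF assms(1,2)] smooth_on_has_derivative[OF assms(3,4)]])
  moreover have "((\<lambda>y. g (h y)) has_derivative (\<lambda>v. v)) (at x)"
    by (rule has_derivative_transform_within_open[OF has_derivative_ident smooth_on_open[OF assms(1)] assms(2)])
      (simp add: assms(5))
  ultimately show ?thesis by (metis has_derivative_unique)
qed

lemma diffeo_onI:
  assumes "smooth_on S h" "smooth_on T g" "h ` S \<subseteq> T" "g ` T \<subseteq> S"
    "\<And>x. x \<in> S \<Longrightarrow> g (h x) = x" "\<And>y. y \<in> T \<Longrightarrow> h (g y) = y"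
  shows "diffeo_on S h"
proof -
  have im: "h ` S = T" using assms by force
  have inj: "inj_on h S" by (metis assms(5) inj_onI)
  have "inv_into S h y = g y" if "y \<in> T" for y
    using inv_into_f_f[OF inj, of "g y"] assms(4,6) that by force
  then have "smooth_on T (inv_into S h)"
    using smooth_on_cong[OF assms(2)] by metis
  then show ?thesis
    using assms(1) im inj smooth_on_open[OF assms(1)] smooth_on_open[OF assms(2)] by (simp add: diffeo_on_def)
qed

lemma diffeo_onE:
  assumes "diffeo_on S h"
  obtains T g where "smooth_on S h" "smooth_on T g" "h ` S = T" "g ` T = S"
    "\<And>x. x \<in> S \<Longrightarrow> g (h x) = x" "\<And>y. y \<in> T \<Longrightarrow> h (g y) = y"
proof
  show "smooth_on S h" "smooth_on (h ` S) (inv_into S h)" "h ` S = h ` S"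
    using assms by (auto simp: diffeo_on_def)
  have inj: "inj_on h S" using assms by (simp add: diffeo_on_def)
  then show "inv_into S h (h x) = x" if "x \<in> S" for x using that by simp
  then show "inv_into S h ` h ` S = S" by force
  show "h (inv_into S h y) = y" if "y \<in> h ` S" for y using that by (rule f_inv_into_f)
qed

text \<open>A substitute for splitting R^n as R times R^(n-1): the second factor is represented by
  everything that is invariant under all \<open>upd i s\<close>.\<close>

definition upd :: "'n::finite \<Rightarrow> real \<Rightarrow> real^'n \<Rightarrow> real^'n" where
  "upd i s v = (\<chi> j. if j = i then s else v $ j)"

lemma upd_nth: "upd i s v $ j = (if j = i then s else v $ j)"
  by (simp add: upd_def)

lemma upd_same [simp]: "upd i s v $ i = s"
  and upd_other: "j \<noteq> i \<Longrightarrow> upd i s v $ j = v $ j"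
  and upd_upd [simp]: "upd i s (upd i t v) = upd i s v"
  and upd_triv [simp]: "upd i (v $ i) v = v"
  by (simp_all add: upd_def vec_eq_iff)

lemma drop_coord_eq_upd: "drop_coord i v = upd i 0 v"
  by (simp add: drop_coord_def upd_def)

lemma upd_eqI: "w $ i = s \<Longrightarrow> (\<And>j. j \<noteq> i \<Longrightarrow> w $ j = v $ j) \<Longrightarrow> w = upd i s v"
  by (simp add: upd_def vec_eq_iff)

lemma upd_affine: "upd i s v = upd i 0 v + s *\<^sub>R axis i 1"
  by (simp add: upd_def vec_eq_iff axis_def)

lemma upd_eq_0: "upd i s v = 0 \<longleftrightarrow> s = 0 \<and> v = (v $ i) *\<^sub>R axis i 1"
  by (auto simp: upd_def vec_eq_iff axis_def)

lemma smooth_on_upd: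
  assumes "smooth_on S q" "smooth_on S f"
  shows "smooth_on S (\<lambda>x. upd i (q x) (f x))"
  unfolding upd_def
proof (intro smooth_on_vec_lambda smooth_on_open[OF assms(1)])
  show "smooth_on S (\<lambda>x. if j = i then q x else f x $ j)" for j
    using assms smooth_on_nth[OF assms(2)] by (cases "j = i") simp_all
qed

lemma has_derivative_upd:
  fixes f :: "_ \<Rightarrow> real^'n::finite"
  assumes "(q has_derivative q') (at x)" "(f has_derivative f') (at x)"
  shows "((\<lambda>x. upd i (q x) (f x)) has_derivative (\<lambda>v. upd i (q' v) (f' v))) (at x)"
proof (rule has_derivative_componentwise_within[THEN iffD2], rule ballI)
  fix b :: "real^'n" assume "b \<in> Basis"
  then obtain j where b: "b = axis j 1" by (auto simp: Basis_vec_def)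
  have "((\<lambda>x. f x $ j) has_derivative (\<lambda>v. f' v $ j)) (at x)"
    by (rule bounded_linear.has_derivative[OF bounded_linear_vec_nth assms(2)])
  then show "((\<lambda>x. upd i (q x) (f x) \<bullet> b) has_derivative (\<lambda>v. upd i (q' v) (f' v) \<bullet> b)) (at x)"
    using assms(1) by (cases "j = i") (simp_all add: b inner_axis upd_nth)
qed

lemma DERIV_along_axis:
  fixes P :: "real^'n::finite \<Rightarrow> real"
  assumes "smooth_on S P" "upd i t v \<in> S"
  shows "((\<lambda>t. P (upd i t v)) has_real_derivative frechet_derivative P (at (upd i t v)) (axis i 1)) (at t)"
proof -
  have "((\<lambda>t. upd i 0 v + t *\<^sub>R axis i 1) has_derivative (\<lambda>h. h *\<^sub>R axis i 1)) (at t)"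
    by (auto intro!: derivative_eq_intros)
  then have "((\<lambda>t. upd i t v) has_derivative (\<lambda>h. h *\<^sub>R axis i 1)) (at t)"
    by (simp only: upd_affine[symmetric])
  from has_derivative_compose[OF this smooth_on_has_derivative[OF assms]]
  show ?thesis
    by (simp add: smooth_on_fd_scale[OF assms] has_field_derivative_def mult.commute[of _ "frechet_derivative P (at (upd i t v)) (axis i 1)"])
qed

text \<open>Balls of the maximum norm are used because they are products: for w_i = 0 a cube is an
  interval in coordinate i times a cylinder.\<close>

definition cube :: "real^'n::finite \<Rightarrow> real \<Rightarrow> (real^'n) set" where
  "cube w e = {v. \<forall>j. \<bar>v $ j - w $ j\<bar> < e}"

text \<open>An open box of R^(n-1) in the invariant encoding; coordinate i is left free.\<close>

definition cyl :: "'n \<Rightarrow> real^'n::finite \<Rightarrow> real \<Rightarrow> (real^'n) set" where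
  "cyl i w e = {v. \<forall>j. j \<noteq> i \<longrightarrow> \<bar>v $ j - w $ j\<bar> < e}"

lemma open_cube: "open (cube w e)"
proof -
  have "cube w e = (\<Inter>j. {v. \<bar>v $ j - w $ j\<bar> < e})" by (auto simp: cube_def)
  then show ?thesis by (auto intro!: open_INT open_Collect_less continuous_intros)
qed

lemma open_cyl: "open (cyl i w e)"
proof -
  have "cyl i w e = (\<Inter>j\<in>-{i}. {v. \<bar>v $ j - w $ j\<bar> < e})" by (auto simp: cyl_def)
  then show ?thesis by (auto intro!: open_INT open_Collect_less continuous_intros)
qed

lemma upd_in_cyl [simp]: "upd i s v \<in> cyl i w e \<longleftrightarrow> v \<in> cyl i w e"
  by (simp add: cyl_def upd_nth)

lemma cube_iff_cyl:
  assumes "w $ i = 0"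
  shows "v \<in> cube w e \<longleftrightarrow> \<bar>v $ i\<bar> < e \<and> v \<in> cyl i w e"
proof -
  have "v \<in> cube w e \<longleftrightarrow> \<bar>v $ i - w $ i\<bar> < e \<and> v \<in> cyl i w e"
    unfolding cube_def cyl_def mem_Collect_eq by metis
  then show ?thesis using assms by simp
qed

lemma upd_in_cube: "w $ i = 0 \<Longrightarrow> upd i s v \<in> cube w e \<longleftrightarrow> \<bar>s\<bar> < e \<and> v \<in> cyl i w e"
  by (simp add: cube_iff_cyl)

lemma cube_center: "e > 0 \<Longrightarrow> w \<in> cube w e" and cyl_center: "e > 0 \<Longrightarrow> w \<in> cyl i w e"
  by (auto simp: cube_def cyl_def)

lemma cube_mono: "d \<le> e \<Longrightarrow> cube w d \<subseteq> cube w e" and cyl_mono: "d \<le> e \<Longrightarrow> cyl i w d \<subseteq> cyl i w e"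
  unfolding cube_def cyl_def by (auto intro: less_le_trans)

lemma open_contains_cube:
  assumes "open S" "w \<in> S"
  obtains e where "e > 0" "cube w e \<subseteq> S"
proof -
  obtain r where r: "r > 0" "ball w r \<subseteq> S" using assms open_contains_ball by blast
  define e where "e = r / real CARD('a)"
  have "v \<in> ball w r" if "v \<in> cube w e" for v
  proof -
    have "norm (w - v) \<le> (\<Sum>j\<in>UNIV. \<bar>(w - v) $ j\<bar>)" by (rule norm_le_l1_cart)
    also have "\<dots> < (\<Sum>j\<in>(UNIV::'a set). e)"
      using that by (intro sum_strict_mono) (auto simp: cube_def abs_minus_commute)
    also have "\<dots> = r" by (simp add: e_def)
    finally show ?thesis by (simp add: dist_norm)
  qed
  moreover have "e > 0" using r by (simp add: e_def)
  ultimately show ?thesis using r that by blast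
qed

text \<open>A cylinder is unbounded in direction i, so openness at (0, w) alone gives no such
  neighbourhood. The last assumption moves every point to the slice where coordinate i is 0, and
  there a small cube suffices.\<close>

lemma product_cyl_nbhd:
  assumes "open S" "(0, w) \<in> S" "w $ i = 0" "\<And>s v. (s, upd i 0 v) \<in> S \<Longrightarrow> (s, v) \<in> S"
  obtains d where "d > 0" "{-d<..<d} \<times> cyl i w d \<subseteq> S"
proof -
  obtain A B where AB: "open A" "open B" "(0, w) \<in> A \<times> B" "A \<times> B \<subseteq> S"
    using open_prod_elim[OF assms(1,2)] by blast
  obtain d1 where d1: "d1 > 0" "\<And>s. dist s 0 < d1 \<Longrightarrow> s \<in> A" using AB open_dist[of A] by auto
  obtain d2 where d2: "d2 > 0" "cube w d2 \<subseteq> B" using AB open_contains_cube[of B w] by auto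
  show ?thesis
  proof (rule that[of "min d1 d2"])
    show "min d1 d2 > 0" using d1 d2 by simp
    show "{- min d1 d2<..<min d1 d2} \<times> cyl i w (min d1 d2) \<subseteq> S"
    proof safe
      fix s v assume s: "s \<in> {- min d1 d2<..<min d1 d2}" and v: "v \<in> cyl i w (min d1 d2)"
      have "upd i 0 v \<in> cube w d2"
        using v d2 cyl_mono[of "min d1 d2" d2 i w] by (auto simp: upd_in_cube assms(3))
      moreover have "s \<in> A" using s by (intro d1) (auto simp: dist_real_def)
      ultimately have "(s, upd i 0 v) \<in> S" using AB d2 by auto
      then show "(s, v) \<in> S" by (rule assms(4))
    qed
  qed
qed

text \<open>The Jacobian of u \<mapsto> \<open>upd i (q u) u\<close> is the identity outside row i,
  so it is invertible as soon as the derivative of q along axis i is not 0. The last conclusion says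
  that the inverse merely rescales that axis, which is how kernel directions are tracked.\<close>

lemma coordinate_change:
  fixes q :: "real^'n::finite \<Rightarrow> real"
  assumes q: "smooth_on W q" and u0: "u0 \<in> W" and c: "frechet_derivative q (at u0) (axis i 1) \<noteq> 0"
  obtains U V g where "open U" "u0 \<in> U" "U \<subseteq> W" "open V" "(\<lambda>u. upd i (q u) u) ` U = V" "smooth_on V g" "g ` V = U"
    "\<And>u. u \<in> U \<Longrightarrow> g (upd i (q u) u) = u" "\<And>y. y \<in> V \<Longrightarrow> upd i (q (g y)) (g y) = y"
    "frechet_derivative g (at (upd i (q u0) u0)) (axis i 1) =
       inverse (frechet_derivative q (at u0) (axis i 1)) *\<^sub>R axis i 1"
proof -
  define h where "h u = upd i (q u) u" for u
  have W: "open W" using smooth_on_open[OF q] .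
  have h: "smooth_on W h" unfolding h_def by (intro smooth_on_upd q smooth_on_id W)
  have dh: "frechet_derivative h (at u0) = (\<lambda>v. upd i (frechet_derivative q (at u0) v) v)"
    unfolding h_def
    by (rule frechet_derivative_at[symmetric], rule has_derivative_upd[OF smooth_on_has_derivative[OF q u0] has_derivative_ident])
  have inj: "v = 0" if "frechet_derivative h (at u0) v = 0" for v
  proof -
    have v: "frechet_derivative q (at u0) v = 0" "v = (v $ i) *\<^sub>R axis i 1"
      using that by (auto simp: dh upd_eq_0)
    have "(v $ i) * frechet_derivative q (at u0) (axis i 1) = frechet_derivative q (at u0) v"
      using smooth_on_fd_scale[OF q u0, of "v $ i" "axis i 1"] v(2) by simp
    then show "v = 0" using v c by auto
  qed
  obtain U V g where UV: "open U" "u0 \<in> U" "U \<subseteq> W" "open V" "h ` U = V" "smooth_on V g" "g ` V = U"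
    "\<And>u. u \<in> U \<Longrightarrow> g (h u) = u" "\<And>y. y \<in> V \<Longrightarrow> h (g y) = y"
    using smooth_inverse_function[OF h u0 inj] by blast
  have "frechet_derivative g (at (h u0)) (axis i 1) = inverse (frechet_derivative q (at u0) (axis i 1)) *\<^sub>R axis i 1"
  proof -
    have "frechet_derivative h (at u0) (axis i 1) = frechet_derivative q (at u0) (axis i 1) *\<^sub>R axis i 1"
      by (simp add: dh upd_def vec_eq_iff axis_def)
    moreover have "frechet_derivative g (at (h u0)) (frechet_derivative h (at u0) (axis i 1)) = axis i 1"
      using smooth_left_inverse_fd[OF smooth_on_subset[OF h UV(1,3)] UV(2) UV(6) _ UV(8)] UV by auto
    ultimately have "frechet_derivative q (at u0) (axis i 1) *\<^sub>R frechet_derivative g (at (h u0)) (axis i 1) = axis i 1"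
      using smooth_on_fd_scale[OF UV(6), of "h u0"] UV by auto
    then show ?thesis using c
      by (metis inverse_eq_divide left_inverse scaleR_one scaleR_scaleR)
  qed
  with UV that[of U V g] show ?thesis unfolding h_def by blast
qed

text \<open>An identity s R(s) = 0 gives R(s) = 0 only for s \<noteq> 0; differentiability at 0
  fills the gap for R and for its derivative.\<close>

lemma DERIV_zero_of_punctured_zero:
  fixes D :: "real \<Rightarrow> real"
  assumes D: "(D has_real_derivative d) (at 0)" and "e > 0" and z: "\<And>s. s \<noteq> 0 \<Longrightarrow> \<bar>s\<bar> < e \<Longrightarrow> D s = 0"
  shows "D 0 = 0" "d = 0"
proof -
  have ev: "\<forall>\<^sub>F s in at 0. 0 = D s"
    unfolding eventually_at using \<open>e > 0\<close> by (intro exI[of _ e]) (auto simp: z dist_real_def)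
  have "(D \<longlongrightarrow> 0) (at 0)" by (rule Lim_transform_eventually[OF tendsto_const ev])
  moreover have "(D \<longlongrightarrow> D 0) (at 0)" using DERIV_isCont[OF D] by (simp add: isCont_def)
  ultimately show D0: "D 0 = 0" by (rule LIM_unique[symmetric])
  have "(D has_real_derivative 0) (at 0)"
  proof (rule has_field_derivative_transform_within_open[OF DERIV_const, of "{-e<..<e}"])
    show "0 = D s" if "s \<in> {-e<..<e}" for s
      using z[of s] D0 that by (cases "s = 0") auto
  qed (use \<open>e > 0\<close> in auto)
  from DERIV_unique[OF D this] show "d = 0" .
qed

text \<open>Hadamard's lemma applied twice at a double zero. The last conclusion is Taylor's formula
  of order two and transfers the sign of the second derivative to G.\<close>

lemma smooth_on_divide_fst_twice:
  fixes h :: "real \<times> 'a::euclidean_space \<Rightarrow> real"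
  assumes h: "smooth_on ({-e<..<e} \<times> U) h" and e: "e > 0" and U: "open U"
    and zero: "\<And>v. v \<in> U \<Longrightarrow> h (0, v) = 0"
    and zero': "\<And>v. v \<in> U \<Longrightarrow> frechet_derivative h (at (0, v)) (1, 0) = 0"
  obtains G where "smooth_on ({-e<..<e} \<times> U) G" "\<And>s v. \<bar>s\<bar> < e \<Longrightarrow> v \<in> U \<Longrightarrow> h (s, v) = s\<^sup>2 * G (s, v)"
    "\<And>v. v \<in> U \<Longrightarrow> frechet_derivative (\<lambda>z. frechet_derivative h (at z) (1, 0)) (at (0, v)) (1, 0) = 2 * G (0, v)"
proof -
  have star: "r * s \<in> {-e<..<e}" if "s \<in> {-e<..<e}" "r \<in> {0..1}" for r s
  proof -
    have "\<bar>r * s\<bar> \<le> \<bar>s\<bar>" using that by (simp add: abs_mult mult_left_le_one_le)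
    then show ?thesis using that by auto
  qed
  obtain h1 where h1: "smooth_on ({-e<..<e} \<times> U) h1"
    "\<And>s v. s \<in> {-e<..<e} \<Longrightarrow> v \<in> U \<Longrightarrow> h (s, v) = s * h1 (s, v)"
    by (rule smooth_on_divide_fst[OF h _ U star zero]) auto
  note slice = smooth_on_DERIV_fst
  \<comment> \<open>By the product rule \<open>h1 (0, v)\<close> is the s-derivative of h at 0,
    which vanishes; this permits the second division.\<close>
  have "h1 (0, v) = 0" if v: "v \<in> U" for v
  proof -
    have in0: "(0, v) \<in> {-e<..<e} \<times> U" using e v by auto
    have "((\<lambda>s. s * h1 (s, v)) has_real_derivative h1 (0, v)) (at 0)"
      using slice[OF h1(1) in0] by (auto intro!: derivative_eq_intros)
    then have "((\<lambda>s. h (s, v)) has_real_derivative h1 (0, v)) (at 0)"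
      by (rule has_field_derivative_transform_within_open[of _ _ _ "{-e<..<e}"]) (use e v h1(2) in auto)
    from DERIV_unique[OF this slice[OF h in0]] zero'[OF v] show ?thesis by simp
  qed
  then obtain G where G: "smooth_on ({-e<..<e} \<times> U) G"
    "\<And>s v. s \<in> {-e<..<e} \<Longrightarrow> v \<in> U \<Longrightarrow> h1 (s, v) = s * G (s, v)"
    by (rule smooth_on_divide_fst[OF h1(1) _ U star, rotated 3]) auto
  have hG: "h (s, v) = s\<^sup>2 * G (s, v)" if "\<bar>s\<bar> < e" "v \<in> U" for s v
    using h1(2) G(2) that by (auto simp: power2_eq_square abs_less_iff)
  define hs where "hs z = frechet_derivative h (at z) (1, 0)" for z
  define Gs where "Gs z = frechet_derivative G (at z) (1, 0)" for z
  have hs: "hs (s, v) = 2 * s * G (s, v) + s\<^sup>2 * Gs (s, v)" if "\<bar>s\<bar> < e" "v \<in> U" for s v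
  proof -
    have in0: "(s, v) \<in> {-e<..<e} \<times> U" using that by auto
    have "((\<lambda>s. s\<^sup>2 * G (s, v)) has_real_derivative 2 * s * G (s, v) + s\<^sup>2 * Gs (s, v)) (at s)"
      using slice[OF G(1) in0] by (auto intro!: derivative_eq_intros simp: Gs_def)
    then have "((\<lambda>s. h (s, v)) has_real_derivative 2 * s * G (s, v) + s\<^sup>2 * Gs (s, v)) (at s)"
      by (rule has_field_derivative_transform_within_open[of _ _ _ "{-e<..<e}"]) (use that hG in auto)
    from DERIV_unique[OF slice[OF h in0] this] show ?thesis by (simp add: hs_def)
  qed
  have "frechet_derivative hs (at (0, v)) (1, 0) = 2 * G (0, v)" if v: "v \<in> U" for v
  proof -
    have in0: "(0, v) \<in> {-e<..<e} \<times> U" using e v by auto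
    have Gs: "smooth_on ({-e<..<e} \<times> U) Gs" unfolding Gs_def by (rule smooth_on_deriv[OF G(1)])
    have hs': "smooth_on ({-e<..<e} \<times> U) hs" unfolding hs_def by (rule smooth_on_deriv[OF h])
    have "((\<lambda>s. 2 * s * G (s, v) + s\<^sup>2 * Gs (s, v)) has_real_derivative 2 * G (0, v)) (at 0)"
      using slice[OF G(1) in0] slice[OF Gs in0] by (auto intro!: derivative_eq_intros)
    then have "((\<lambda>s. hs (s, v)) has_real_derivative 2 * G (0, v)) (at 0)"
      by (rule has_field_derivative_transform_within_open[of _ _ _ "{-e<..<e}"]) (use e v hs in auto)
    from DERIV_unique[OF slice[OF hs' in0] this] show ?thesis .
  qed
  with G(1) hG that show ?thesis unfolding hs_def by blast
qed

subsection \<open>Charts of Legendre submanifolds\<close>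

abbreviation (input) pos_of :: "'n::finite pt \<Rightarrow> real^'n" where "pos_of q \<equiv> fst q"
abbreviation (input) mom_of :: "'n::finite pt \<Rightarrow> real^'n" where "mom_of q \<equiv> fst (snd q)"

lemma sub_chart_smooth: "sub_chart L W f \<Longrightarrow> smooth_on W f"
  by (simp add: sub_chart_def)

text \<open>Differentiability passes through the composition; the point at issue is that the smaller
  image is still cut out of L by an open set. It follows from the continuity of the inverse of f on
  its image.\<close>

lemma sub_chart_reparam:
  fixes f :: "real^'n::finite \<Rightarrow> 'n pt"
  assumes f: "sub_chart L W f" and t: "smooth_on W' t" "smooth_on V k" "t ` W' = V" "V \<subseteq> W"
    and kt: "\<And>x. x \<in> W' \<Longrightarrow> k (t x) = x"
  shows "sub_chart L W' (\<lambda>x. f (t x))"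
  unfolding sub_chart_def
proof (intro conjI ballI)
  have fW: "open W" "smooth_on W f" "inj_on f W" "continuous_on (f ` W) (inv_into W f)"
    "\<And>u. u \<in> W \<Longrightarrow> inj (frechet_derivative f (at u))"
    using f by (auto simp: sub_chart_def)
  obtain Ob where Ob: "open Ob" "f ` W = L \<inter> Ob" using f by (auto simp: sub_chart_def)
  show "open W'" by (rule smooth_on_open[OF t(1)])
  show sm: "smooth_on W' (\<lambda>x. f (t x))"
    by (rule smooth_on_compose[OF t(1) fW(2)]) (use t in auto)
  show inj: "inj_on (\<lambda>x. f (t x)) W'"
  proof (rule inj_onI)
    fix x y assume xy: "x \<in> W'" "y \<in> W'" "f (t x) = f (t y)"
    then have "t x = t y" using t by (intro inj_onD[OF fW(3)]) auto
    then show "x = y" using kt xy by metis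
  qed
  have im: "(\<lambda>x. f (t x)) ` W' = f ` V" using t by auto
  have "openin (top_of_set (f ` W)) (f ` W \<inter> inv_into W f -` V)"
    by (rule continuous_openin_preimage_gen[OF fW(4) smooth_on_open[OF t(2)]])
  then obtain O2 where O2: "open O2" "f ` W \<inter> inv_into W f -` V = f ` W \<inter> O2"
    by (auto simp: openin_open)
  moreover have "f ` W \<inter> inv_into W f -` V = f ` V"
  proof (intro equalityI subsetI)
    fix q assume "q \<in> f ` W \<inter> inv_into W f -` V"
    then obtain u where "u \<in> W" "q = f u" "inv_into W f q \<in> V" by auto
    then show "q \<in> f ` V" by (simp add: inv_into_f_f[OF fW(3)])
  next
    fix q assume "q \<in> f ` V"
    then obtain u where "u \<in> V" "u \<in> W" "q = f u" using t(4) by auto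
    then show "q \<in> f ` W \<inter> inv_into W f -` V" by (simp add: inv_into_f_f[OF fW(3)])
  qed
  ultimately have "f ` V = L \<inter> (Ob \<inter> O2)" using Ob by auto
  then show "\<exists>Ob. open Ob \<and> (\<lambda>x. f (t x)) ` W' = L \<inter> Ob"
    using O2 Ob im by (intro exI[of _ "Ob \<inter> O2"]) auto
  have "continuous_on (f ` V) (\<lambda>q. k (inv_into W f q))"
  proof (rule continuous_on_compose2[OF smooth_on_continuous[OF t(2)]])
    show "continuous_on (f ` V) (inv_into W f)"
      by (rule continuous_on_subset[OF fW(4)]) (use t in auto)
    show "inv_into W f ` f ` V \<subseteq> V" using t(4) by (auto simp: inv_into_f_f[OF fW(3)] subset_eq)
  qed
  moreover have "k (inv_into W f q) = inv_into W' (\<lambda>x. f (t x)) q" if q: "q \<in> f ` V" for q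
  proof -
    obtain x where x: "x \<in> W'" "q = f (t x)" using q t by auto
    then have "t x \<in> W" using t by auto
    then show ?thesis using x inv_into_f_f[OF inj x(1)] inv_into_f_f[OF fW(3), of "t x"] kt by simp
  qed
  ultimately show "continuous_on ((\<lambda>x. f (t x)) ` W') (inv_into W' (\<lambda>x. f (t x)))"
    unfolding im by (rule continuous_on_eq)
  fix u assume u: "u \<in> W'"
  then have tu: "t u \<in> W" "t u \<in> V" using t by auto
  have "inj (frechet_derivative t (at u))"
    by (rule inj_on_inverseI[of _ "frechet_derivative k (at (t u))"])
      (rule smooth_left_inverse_fd[OF t(1) u t(2) tu(2) kt])
  then have "inj (frechet_derivative f (at (t u)) \<circ> frechet_derivative t (at u))"
    using fW(5)[OF tu(1)] by (intro inj_compose)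
  then show "inj (frechet_derivative (\<lambda>x. f (t x)) (at u))"
    unfolding smooth_on_fd_chain[OF t(1) u fW(2) tu(1)] by (simp add: o_def)
qed

lemma fd_components:
  assumes f: "smooth_on W f" and u: "u \<in> W"
  shows "frechet_derivative (\<lambda>u. pos_of (f u)) (at u) v = pos_of (frechet_derivative f (at u) v)"
    "frechet_derivative (\<lambda>u. mom_of (f u)) (at u) v = mom_of (frechet_derivative f (at u) v)"
    "frechet_derivative (\<lambda>u. pos_of (f u) $ j) (at u) v = pos_of (frechet_derivative f (at u) v) $ j"
    "frechet_derivative (\<lambda>u. mom_of (f u) $ j) (at u) v = mom_of (frechet_derivative f (at u) v) $ j"
  by (simp_all add: smooth_on_fd_linear[OF bounded_linear_fst f u]
      smooth_on_fd_linear[OF bounded_linear_compose[OF bounded_linear_fst bounded_linear_snd] f u]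
      smooth_on_fd_linear[OF bounded_linear_compose[OF bounded_linear_vec_nth bounded_linear_fst] f u]
      smooth_on_fd_linear[OF bounded_linear_compose[OF bounded_linear_vec_nth
          bounded_linear_compose[OF bounded_linear_fst bounded_linear_snd]] f u])

lemma smooth_on_components:
  assumes f: "smooth_on W f"
  shows "smooth_on W (\<lambda>u. pos_of (f u))" "smooth_on W (\<lambda>u. mom_of (f u))" "smooth_on W (\<lambda>u. snd (snd (f u)))"
    "smooth_on W (\<lambda>u. pos_of (f u) $ j)" "smooth_on W (\<lambda>u. mom_of (f u) $ j)"
  by (intro smooth_on_fst smooth_on_snd smooth_on_nth f)+

lemma has_derivative_pi_m:
  fixes q :: "'n::finite pt"
  shows "(pi_m has_derivative (\<lambda>w. (mom_of w, mom_of q \<bullet> pos_of w + mom_of w \<bullet> pos_of q - snd (snd w)))) (at q)"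
  unfolding pi_m_def[abs_def]
  by (intro has_derivative_Pair has_derivative_diff has_derivative_inner has_derivative_fst has_derivative_snd
      has_derivative_ident)

lemma fd_pi_m:
  "frechet_derivative pi_m (at q) w = (mom_of w, mom_of q \<bullet> pos_of w + mom_of w \<bullet> pos_of q - snd (snd w))"
  using fun_cong[OF frechet_derivative_at[OF has_derivative_pi_m[of q]], of w] by simp

text \<open>On contact vectors the terms p . dx - dz cancel, so the differential of
  \<open>pi_m\<close> is determined by dp alone; rank and kernel of the former are those of the
  latter.\<close>

lemma fd_pi_m_contact:
  "contact_form q w = 0 \<Longrightarrow> frechet_derivative pi_m (at q) w = (mom_of w, mom_of w \<bullet> pos_of q)"
  by (simp add: fd_pi_m contact_form_def)

lemma fd_pi_e: "frechet_derivative pi_e (at q) w = (pos_of w, snd (snd w))"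
proof -
  have "(pi_e has_derivative (\<lambda>w. (pos_of w, snd (snd w)))) (at q)"
    unfolding pi_e_def[abs_def] by (intro has_derivative_Pair has_derivative_fst has_derivative_snd has_derivative_ident)
  from fun_cong[OF frechet_derivative_at[OF this], of w] show ?thesis by simp
qed

lemma smooth_on_pi_m:
  assumes f: "smooth_on W f"
  shows "smooth_on W (\<lambda>u. pi_m (f u))"
  unfolding pi_m_def
  by (intro smooth_on_Pair smooth_on_diff smooth_on_inner smooth_on_components[OF f])

text \<open>The fold is the hyperplane w_i = 0, and \<open>k1\<close> is the minimum of p_i along
  the lines parallel to axis i, hence invariant in that coordinate.\<close>

definition fold_chart :: "'n::finite pt set \<Rightarrow> 'n \<Rightarrow> real^'n \<Rightarrow> real \<Rightarrow> (real^'n \<Rightarrow> 'n pt) \<Rightarrow> (real^'n \<Rightarrow> real) \<Rightarrow> bool" where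
  "fold_chart L i w0 e F k1 \<longleftrightarrow> e > 0 \<and> w0 $ i = 0 \<and> sub_chart L (cube w0 e) F \<and>
     (\<forall>w\<in>cube w0 e. mom_of (F w) = upd i (k1 w + (w $ i)\<^sup>2) w) \<and>
     smooth_on (cyl i w0 e) k1 \<and> (\<forall>v s. k1 (upd i s v) = k1 v)"

text \<open>The parametric Morse lemma for p_i as a function of coordinate i, with the other
  coordinates as parameters. \<open>P1\<close> and \<open>P2\<close> say that \<open>v0\<close> is a
  non-degenerate minimum in that direction; \<open>X1\<close> is carried along to the new
  chart.\<close>

lemma fold_chart_exists:
  fixes f :: "real^'n::finite \<Rightarrow> 'n pt"
  assumes ch: "sub_chart L W f" and v0: "v0 \<in> W"
    and coords: "\<And>u j. u \<in> W \<Longrightarrow> j \<noteq> i \<Longrightarrow> mom_of (f u) $ j = u $ j"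
    and P1: "mom_of (frechet_derivative f (at v0) (axis i 1)) $ i = 0"
    and P2: "frechet_derivative (\<lambda>u. mom_of (frechet_derivative f (at u) (axis i 1)) $ i) (at v0) (axis i 1) > 0"
    and X1: "pos_of (frechet_derivative f (at v0) (axis i 1)) $ i \<noteq> 0"
  obtains w0 e F k1 where "fold_chart L i w0 e F k1" "F w0 = f v0"
    "pos_of (frechet_derivative F (at w0) (axis i 1)) $ i \<noteq> 0"
proof -
  have f: "smooth_on W f" and W: "open W" using ch by (auto simp: sub_chart_def)
  define P where "P u = mom_of (f u) $ i" for u
  define Pi where "Pi u = mom_of (frechet_derivative f (at u) (axis i 1)) $ i" for u
  have P: "smooth_on W P" unfolding P_def by (rule smooth_on_components[OF f])
  have Pi: "smooth_on W Pi" unfolding Pi_def by (intro smooth_on_components smooth_on_deriv f)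
  have Pi_eq: "frechet_derivative P (at u) (axis i 1) = Pi u" if "u \<in> W" for u
    unfolding P_def Pi_def by (rule fd_components[OF f that])
  have Pi0: "Pi v0 = 0" using P1 by (simp add: Pi_def)
  have Pii: "frechet_derivative Pi (at v0) (axis i 1) > 0" using P2 by (simp add: Pi_def[abs_def])
  then have Pii': "frechet_derivative Pi (at v0) (axis i 1) \<noteq> 0" by simp
  \<comment> \<open>The implicit function theorem in the form of a coordinate change: with
    \<open>Pi\<close> as new coordinate i the critical set becomes a coordinate hyperplane, and g
    maps that hyperplane to the graph of \<open>\<tau>\<close> defined below.\<close>
  obtain U V g where UVg: "open U" "v0 \<in> U" "U \<subseteq> W" "open V" "(\<lambda>u. upd i (Pi u) u) ` U = V" "smooth_on V g" "g ` V = U"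
    "\<And>u. u \<in> U \<Longrightarrow> g (upd i (Pi u) u) = u" "\<And>y. y \<in> V \<Longrightarrow> upd i (Pi (g y)) (g y) = y"
    "frechet_derivative g (at (upd i (Pi v0) v0)) (axis i 1) =
       inverse (frechet_derivative Pi (at v0) (axis i 1)) *\<^sub>R axis i 1"
    by (rule coordinate_change[OF Pi v0 Pii' that])
  define C where "C = {v. upd i 0 v \<in> V}"
  have sm0: "smooth_on UNIV (\<lambda>v. upd i 0 v)"
    by (intro smooth_on_upd smooth_on_const smooth_on_id open_UNIV)
  have C: "open C"
    using open_vimage[OF UVg(4) smooth_on_continuous[OF sm0]] by (simp add: C_def vimage_def)
  have "upd i (Pi v0) v0 \<in> V" using UVg(2,5) by blast
  then have v0C: "v0 \<in> C" by (simp add: C_def Pi0)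
  define \<tau> where "\<tau> v = g (upd i 0 v) $ i" for v
  have \<tau>_upd: "\<tau> (upd i s v) = \<tau> v" for s v by (simp add: \<tau>_def)
  have \<tau>: "smooth_on C \<tau>"
    unfolding \<tau>_def
    by (intro smooth_on_nth smooth_on_compose[OF smooth_on_subset[OF sm0 C] UVg(6)]) (auto simp: C_def)
  have g_eq: "g (upd i 0 v) = upd i (\<tau> v) v" if "v \<in> C" for v
  proof (rule upd_eqI)
    fix j assume "j \<noteq> i"
    have "upd i (Pi (g (upd i 0 v))) (g (upd i 0 v)) $ j = upd i 0 v $ j"
      using UVg(9)[of "upd i 0 v"] that by (simp add: C_def)
    then show "g (upd i 0 v) $ j = v $ j" using \<open>j \<noteq> i\<close> by (simp add: upd_other)
  qed (simp add: \<tau>_def)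
  have crit: "upd i (\<tau> v) v \<in> W" "Pi (upd i (\<tau> v) v) = 0" if "v \<in> C" for v
  proof -
    have y: "upd i 0 v \<in> V" using that by (simp add: C_def)
    then have "g (upd i 0 v) \<in> U" using UVg(7) by auto
    then show "upd i (\<tau> v) v \<in> W" using UVg(3) unfolding g_eq[OF that] by auto
    have "upd i (Pi (g (upd i 0 v))) (g (upd i 0 v)) $ i = upd i 0 v $ i"
      unfolding UVg(9)[OF y] by (rule refl)
    then show "Pi (upd i (\<tau> v) v) = 0" unfolding g_eq[OF that] by simp
  qed
  have \<tau>0: "\<tau> v0 = v0 $ i"
    using UVg(8)[OF UVg(2)] unfolding Pi0 \<tau>_def by simp
  \<comment> \<open>Measures coordinate i from the critical point, so that the critical set is s = 0
    for every parameter.\<close>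
  define m where "m z = upd i (\<tau> (snd z) + fst z) (snd z)" for z :: "real \<times> (real^'n)"
  have UC: "open (UNIV \<times> C :: (real \<times> (real^'n)) set)" using C by (intro open_Times) auto
  have sm_m: "smooth_on (UNIV \<times> C) m"
    unfolding m_def
    by (intro smooth_on_upd smooth_on_add smooth_on_fst smooth_on_snd smooth_on_id UC
        smooth_on_compose[OF smooth_on_snd[OF smooth_on_id[OF UC]] \<tau>]) auto
  have "open ((UNIV \<times> C) \<inter> m -` W)"
    by (rule continuous_open_preimage[OF smooth_on_continuous[OF sm_m] UC W])
  moreover have "(0, v0) \<in> (UNIV \<times> C) \<inter> m -` W" using v0 v0C by (simp add: m_def \<tau>0)
  ultimately obtain A B where AB: "open A" "open B" "(0, v0) \<in> A \<times> B" "A \<times> B \<subseteq> (UNIV \<times> C) \<inter> m -` W"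
    by (rule open_prod_elim)
  obtain d where d: "d > 0" "\<And>s. dist s 0 < d \<Longrightarrow> s \<in> A" using AB open_dist[of A] by auto
  let ?I = "{-d<..<d}"
  have IB: "open (?I \<times> B)" using AB by (intro open_Times) auto
  have mW: "m (s, v) \<in> W" if "\<bar>s\<bar> < d" "v \<in> B" for s v
    using AB(4) d(2)[of s] that by (auto simp: dist_real_def)
  have BC: "B \<subseteq> C" using AB by auto
  have v0B: "v0 \<in> B" using AB by auto
  define Q where "Q z = P (m z)" for z
  have Q: "smooth_on (?I \<times> B) Q"
    unfolding Q_def
    by (rule smooth_on_compose[OF smooth_on_subset[OF sm_m IB] P]) (use BC mW in auto)
  have DERIV_m: "((\<lambda>s. p (m (s, v))) has_real_derivative frechet_derivative p (at (m (s, v))) (axis i 1)) (at s)"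
    if p: "smooth_on W p" and sv: "\<bar>s\<bar> < d" "v \<in> B" for p s v
  proof -
    have "((\<lambda>t. p (upd i t v)) has_real_derivative frechet_derivative p (at (m (s, v))) (axis i 1)) (at (\<tau> v + s))"
      using DERIV_along_axis[OF p, of i "\<tau> v + s" v] mW[OF sv] by (simp add: m_def)
    moreover have "((\<lambda>s. \<tau> v + s) has_real_derivative 1) (at s)"
      by (auto intro!: derivative_eq_intros)
    ultimately have "((\<lambda>s. p (upd i (\<tau> v + s) v)) has_real_derivative
        frechet_derivative p (at (m (s, v))) (axis i 1) * 1) (at s)"
      by (rule DERIV_chain2)
    then show ?thesis by (simp add: m_def)
  qed
  have Qs: "frechet_derivative Q (at (s, v)) (1, 0) = Pi (m (s, v))" if "\<bar>s\<bar> < d" "v \<in> B" for s v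
  proof -
    have in0: "(s, v) \<in> ?I \<times> B" using that by auto
    have "((\<lambda>s. Q (s, v)) has_real_derivative Pi (m (s, v))) (at s)"
      using DERIV_m[OF P that] unfolding Q_def Pi_eq[OF mW[OF that]] .
    from DERIV_unique[OF smooth_on_DERIV_fst[OF Q in0] this] show ?thesis .
  qed
  \<comment> \<open>After subtraction of the critical value both h and its s-derivative vanish at s
    = 0, the latter by \<open>crit\<close>.\<close>
  define h where "h z = Q z - Q (0, snd z)" for z
  have sm_Q0: "smooth_on (?I \<times> B) (\<lambda>z. Q (0, snd z))"
    by (rule smooth_on_compose[OF smooth_on_Pair[OF smooth_on_const[OF IB] smooth_on_snd[OF smooth_on_id[OF IB]]] Q])
      (use d in auto)
  have h: "smooth_on (?I \<times> B) h" unfolding h_def by (intro smooth_on_diff Q sm_Q0)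
  have hs: "frechet_derivative h (at (s, v)) (1, 0) = Pi (m (s, v))" if "\<bar>s\<bar> < d" "v \<in> B" for s v
  proof -
    have in0: "(s, v) \<in> ?I \<times> B" using that by auto
    have "((\<lambda>s. h (s, v)) has_real_derivative frechet_derivative Q (at (s, v)) (1, 0)) (at s)"
      using smooth_on_DERIV_fst[OF Q in0] by (auto simp: h_def intro!: derivative_eq_intros)
    from DERIV_unique[OF smooth_on_DERIV_fst[OF h in0] this] Qs[OF that] show ?thesis by simp
  qed
  obtain G where G: "smooth_on (?I \<times> B) G" "\<And>s v. \<bar>s\<bar> < d \<Longrightarrow> v \<in> B \<Longrightarrow> h (s, v) = s\<^sup>2 * G (s, v)"
    "\<And>v. v \<in> B \<Longrightarrow> frechet_derivative (\<lambda>z. frechet_derivative h (at z) (1, 0)) (at (0, v)) (1, 0) = 2 * G (0, v)"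
  proof (rule smooth_on_divide_fst_twice[OF h d(1) AB(2) _ _ that])
    show "h (0, v) = 0" if "v \<in> B" for v by (simp add: h_def)
    show "frechet_derivative h (at (0, v)) (1, 0) = 0" if "v \<in> B" for v
      using hs[of 0 v] crit[of v] that BC d(1) by (auto simp: m_def)
  qed
  have "frechet_derivative (\<lambda>z. frechet_derivative h (at z) (1, 0)) (at (0, v0)) (1, 0) =
      frechet_derivative Pi (at v0) (axis i 1)"
  proof -
    have in0: "(0, v0) \<in> ?I \<times> B" using v0B d by auto
    have "((\<lambda>s. Pi (m (s, v0))) has_real_derivative frechet_derivative Pi (at (m (0, v0))) (axis i 1)) (at 0)"
      by (rule DERIV_m[OF Pi _ v0B]) (use d in auto)
    then have "((\<lambda>s. frechet_derivative h (at (s, v0)) (1, 0)) has_real_derivative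
        frechet_derivative Pi (at (m (0, v0))) (axis i 1)) (at 0)"
      by (rule has_field_derivative_transform_within_open[of _ _ _ ?I]) (use d hs v0B in auto)
    from DERIV_unique[OF smooth_on_DERIV_fst[OF smooth_on_deriv[OF h] in0] this]
    show ?thesis by (simp add: m_def \<tau>0)
  qed
  then have G0: "G (0, v0) > 0" using G(3)[OF v0B] Pii by simp
  define n where "n u = (u $ i - \<tau> u, u)" for u
  have B_i: "smooth_on B (\<lambda>u. u $ i)" by (intro smooth_on_nth smooth_on_id AB)
  have \<tau>B: "smooth_on B \<tau>" by (rule smooth_on_subset[OF \<tau> AB(2) BC])
  have sm_n: "smooth_on B n"
    unfolding n_def by (intro smooth_on_Pair smooth_on_diff B_i \<tau>B smooth_on_id AB)
  define W2 where "W2 = B \<inter> n -` ((?I \<times> B) \<inter> G -` {0<..})"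
  have W2: "open W2"
    unfolding W2_def
    by (intro continuous_open_preimage[OF smooth_on_continuous[OF sm_n] AB(2)]
        continuous_open_preimage[OF smooth_on_continuous[OF G(1)] IB]) auto
  have v0W2: "v0 \<in> W2" using v0B d G0 by (simp add: W2_def n_def \<tau>0)
  \<comment> \<open>The signed square root of h = s^2 G. It is smooth because G > 0 on
    \<open>W2\<close>, and unlike sqrt (s^2 G) it changes sign with s, so it can serve as a
    coordinate.\<close>
  define q where "q u = (u $ i - \<tau> u) * sqrt (G (n u))" for u
  have sm_nG: "smooth_on W2 (\<lambda>u. G (n u))"
    by (rule smooth_on_compose[OF smooth_on_subset[OF sm_n W2] G(1)]) (auto simp: W2_def)
  have sm_q: "smooth_on W2 q"
    unfolding q_def
    by (intro smooth_on_mult smooth_on_diff smooth_on_subset[OF B_i W2] smooth_on_subset[OF \<tau>B W2] smooth_on_sqrt sm_nG)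
      (auto simp: W2_def)
  have q0: "q v0 = 0" by (simp add: q_def \<tau>0)
  have qi: "frechet_derivative q (at v0) (axis i 1) = sqrt (G (0, v0))"
  proof -
    let ?K = "\<lambda>t. sqrt (G (n (upd i t v0)))"
    have K: "((\<lambda>t. ?K t) has_real_derivative frechet_derivative (\<lambda>u. sqrt (G (n u))) (at (upd i (v0 $ i) v0)) (axis i 1)) (at (v0 $ i))"
      by (rule DERIV_along_axis[OF smooth_on_sqrt[OF sm_nG]]) (use v0W2 in \<open>auto simp: W2_def\<close>)
    have "((\<lambda>t. t - v0 $ i) has_real_derivative 1) (at (v0 $ i))"
      by (auto intro!: derivative_eq_intros)
    from DERIV_mult'[OF this K]
    have "((\<lambda>t. (t - v0 $ i) * ?K t) has_real_derivative ?K (v0 $ i)) (at (v0 $ i))"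
      by simp
    moreover have "(\<lambda>t. (t - v0 $ i) * ?K t) = (\<lambda>t. q (upd i t v0))"
      by (simp add: q_def \<tau>_upd \<tau>0)
    moreover have "((\<lambda>t. q (upd i t v0)) has_real_derivative frechet_derivative q (at v0) (axis i 1)) (at (v0 $ i))"
      using DERIV_along_axis[OF sm_q, of i "v0 $ i" v0] v0W2 by simp
    ultimately have "frechet_derivative q (at v0) (axis i 1) = ?K (v0 $ i)"
      using DERIV_unique by metis
    then show ?thesis by (simp add: n_def \<tau>0)
  qed
  then have qi': "frechet_derivative q (at v0) (axis i 1) \<noteq> 0" using G0 by simp
  obtain U' V' t where t: "open U'" "v0 \<in> U'" "U' \<subseteq> W2" "open V'" "(\<lambda>u. upd i (q u) u) ` U' = V'" "smooth_on V' t" "t ` V' = U'"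
    "\<And>u. u \<in> U' \<Longrightarrow> t (upd i (q u) u) = u" "\<And>y. y \<in> V' \<Longrightarrow> upd i (q (t y)) (t y) = y"
    "frechet_derivative t (at (upd i (q v0) v0)) (axis i 1) =
       inverse (frechet_derivative q (at v0) (axis i 1)) *\<^sub>R axis i 1"
    by (rule coordinate_change[OF sm_q v0W2 qi' that])
  define w0 where "w0 = upd i 0 v0"
  have w0: "w0 $ i = 0" "w0 \<in> V'" "w0 \<in> C" "t w0 = v0"
  proof -
    have "upd i (q v0) v0 \<in> V'" using t(2,5) by auto
    then show "w0 $ i = 0" "w0 \<in> V'" "w0 \<in> C" "t w0 = v0"
      using t(8)[OF t(2)] v0C by (simp_all add: q0 w0_def C_def)
  qed
  obtain e where e: "e > 0" "cube w0 e \<subseteq> V' \<inter> C"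
    using open_contains_cube[of "V' \<inter> C" w0] t(4) C w0 by auto
  have cylC: "cyl i w0 e \<subseteq> C"
  proof
    fix v assume "v \<in> cyl i w0 e"
    then have "upd i 0 v \<in> C" using e by (auto simp: upd_in_cube[OF w0(1)] subset_eq)
    then show "v \<in> C" by (simp add: C_def)
  qed
  define k1 where "k1 v = P (upd i (\<tau> v) v)" for v
  have k1_upd: "k1 (upd i s v) = k1 v" for s v by (simp add: k1_def \<tau>_upd)
  have sm_k1: "smooth_on (cyl i w0 e) k1"
  proof (rule smooth_on_subset[OF _ open_cyl cylC])
    show "smooth_on C k1"
      unfolding k1_def
      by (rule smooth_on_compose[OF smooth_on_upd[OF \<tau> smooth_on_id[OF C]] P]) (use crit in auto)
  qed
  have PG: "P u = k1 u + (q u)\<^sup>2" if "u \<in> W2" for u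
  proof -
    have u: "\<bar>u $ i - \<tau> u\<bar> < d" "u \<in> B" "G (n u) > 0" using that by (auto simp: W2_def n_def)
    have "P u - k1 u = h (n u)" by (simp add: h_def Q_def m_def n_def k1_def)
    also have "\<dots> = (u $ i - \<tau> u)\<^sup>2 * G (n u)" using G(2)[OF u(1,2)] by (simp add: n_def)
    finally show ?thesis using u(3) by (simp add: q_def power_mult_distrib)
  qed
  define F where "F w = f (t w)" for w
  have cV: "cube w0 e \<subseteq> V'" using e by auto
  have tW2: "t w \<in> W2" if "w \<in> cube w0 e" for w using that cV t(3,7) by blast
  have W2W: "W2 \<subseteq> W"
  proof
    fix u assume "u \<in> W2"
    then have "m (n u) \<in> W" using mW[of "u $ i - \<tau> u" u] by (auto simp: W2_def n_def)
    then show "u \<in> W" by (simp add: m_def n_def)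
  qed
  have chF: "sub_chart L (cube w0 e) F"
    unfolding F_def
  proof (rule sub_chart_reparam[OF ch smooth_on_subset[OF t(6) open_cube cV]])
    have sq: "smooth_on U' (\<lambda>u. upd i (q u) u)"
      by (intro smooth_on_upd smooth_on_id smooth_on_subset[OF sm_q] t)
    have eq: "t ` cube w0 e = U' \<inter> (\<lambda>u. upd i (q u) u) -` cube w0 e"
    proof (intro equalityI subsetI)
      fix u assume "u \<in> t ` cube w0 e"
      then obtain w where "w \<in> cube w0 e" "u = t w" by auto
      then show "u \<in> U' \<inter> (\<lambda>u. upd i (q u) u) -` cube w0 e" using cV t(7,9) by auto
    next
      fix u assume u: "u \<in> U' \<inter> (\<lambda>u. upd i (q u) u) -` cube w0 e"
      then have "u = t (upd i (q u) u)" using t(8) by auto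
      then show "u \<in> t ` cube w0 e" using u by (metis IntD2 image_eqI vimage_eq)
    qed
    have "open (t ` cube w0 e)"
      unfolding eq by (rule continuous_open_preimage[OF smooth_on_continuous[OF sq] t(1) open_cube])
    then show "smooth_on (t ` cube w0 e) (\<lambda>u. upd i (q u) u)"
      by (rule smooth_on_subset[OF sq]) (auto simp: eq)
    show "t ` cube w0 e \<subseteq> W" using tW2 W2W by auto
    show "upd i (q (t x)) (t x) = x" if "x \<in> cube w0 e" for x using t(9) cV that by auto
  qed simp
  have t_nth: "t w $ j = w $ j" if "w \<in> cube w0 e" "j \<noteq> i" for w j
  proof -
    have "upd i (q (t w)) (t w) = w" using t(9) cV that(1) by auto
    from arg_cong[OF this, of "\<lambda>x. x $ j"] show ?thesis using that(2) by (simp add: upd_other)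
  qed
  have q_t: "q (t w) = w $ i" if "w \<in> cube w0 e" for w
  proof -
    have "upd i (q (t w)) (t w) = w" using t(9) cV that(1) by auto
    from arg_cong[OF this, of "\<lambda>x. x $ i"] show ?thesis by simp
  qed
  have mom: "mom_of (F w) = upd i (k1 w + (w $ i)\<^sup>2) w" if w: "w \<in> cube w0 e" for w
  proof (rule upd_eqI)
    have "w = upd i (w $ i) (t w)" by (rule upd_eqI) (simp_all add: t_nth[OF w])
    then have "k1 (t w) = k1 w" using k1_upd by metis
    then show "mom_of (F w) $ i = k1 w + (w $ i)\<^sup>2"
      using PG[OF tW2[OF w]] q_t[OF w] by (simp add: P_def F_def)
    show "mom_of (F w) $ j = w $ j" if "j \<noteq> i" for j
      using coords[of "t w" j] tW2[OF w] W2W t_nth[OF w that] that by (auto simp: F_def)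
  qed
  \<comment> \<open>The inverse coordinate change rescales axis i by a positive factor at the base
    point, so the non-vanishing derivative of x_i survives.\<close>
  have "frechet_derivative F (at w0) (axis i 1) = frechet_derivative f (at v0) (frechet_derivative t (at w0) (axis i 1))"
    unfolding F_def by (subst smooth_on_fd_chain[OF t(6) w0(2) f]) (use w0 v0 in auto)
  also have "frechet_derivative t (at w0) (axis i 1) = inverse (sqrt (G (0, v0))) *\<^sub>R axis i 1"
    using t(10) by (simp add: q0 w0_def qi)
  also have "frechet_derivative f (at v0) \<dots> = inverse (sqrt (G (0, v0))) *\<^sub>R frechet_derivative f (at v0) (axis i 1)"
    by (rule smooth_on_fd_scale[OF f v0])
  finally have "pos_of (frechet_derivative F (at w0) (axis i 1)) $ i \<noteq> 0"
    using X1 G0 by simp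
  moreover have "fold_chart L i w0 e F k1"
    using e w0 chF mom sm_k1 k1_upd by (simp add: fold_chart_def)
  moreover have "F w0 = f v0" using w0 by (simp add: F_def)
  ultimately show ?thesis by (rule that[rotated 2])
qed

subsection \<open>Normal form of a fold\<close>

text \<open>The interface between geometry and singularity theory: both the formula for the image
  and the type of the germ are derived from these data of g, without reference to L.\<close>

definition fold_normal_form ::
  "'n::finite \<Rightarrow> real^'n \<Rightarrow> real \<Rightarrow> (real^'n \<Rightarrow> real) \<Rightarrow> (real^'n \<Rightarrow> real) \<Rightarrow> (real \<times> (real^'n) \<Rightarrow> real) \<Rightarrow>
     (real^'n \<Rightarrow> (real^'n) \<times> real) \<Rightarrow> bool" where
  "fold_normal_form i w0 e k1 k2 \<phi> g \<longleftrightarrow> e > 0 \<and> w0 $ i = 0 \<and>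
     smooth_on (cyl i w0 e) k1 \<and> smooth_on (cyl i w0 e) k2 \<and>
     (\<forall>v s. k1 (upd i s v) = k1 v) \<and> (\<forall>v s. k2 (upd i s v) = k2 v) \<and>
     smooth_on ({-e<..<e} \<times> cyl i w0 e) \<phi> \<and> (\<forall>s v t. \<phi> (s, upd i t v) = \<phi> (s, v)) \<and>
     (\<forall>s\<in>{-e<..<e}. \<forall>v\<in>cyl i w0 e. frechet_derivative \<phi> (at (s, v)) (1, 0) \<noteq> 0) \<and>
     (\<forall>w\<in>cube w0 e. g w = (upd i (k1 w + (w $ i)\<^sup>2) w, k2 w + (w $ i)\<^sup>2 * \<phi> (w $ i, w)))"

text \<open>Along axis i only p_i varies, with derivative 2 s, so dz' = x . dp reduces to a
  derivative 2 s x_i of the potential. Its increment from the fold therefore has a double zero and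
  can be divided by s^2.\<close>

lemma fold_potential:
  fixes F :: "real^'n::finite \<Rightarrow> 'n pt"
  assumes fc: "fold_chart L i w0 e F k1"
    and contact: "\<And>u v. u \<in> cube w0 e \<Longrightarrow> contact_form (F u) (frechet_derivative F (at u) v) = 0"
    and X0: "pos_of (frechet_derivative F (at w0) (axis i 1)) $ i \<noteq> 0"
  obtains d k2 \<phi> where "d \<le> e" "fold_normal_form i w0 d k1 k2 \<phi> (\<lambda>w. pi_m (F w))"
proof -
  have e: "e > 0" and w0: "w0 $ i = 0" and ch: "sub_chart L (cube w0 e) F"
    and mom: "\<And>w. w \<in> cube w0 e \<Longrightarrow> mom_of (F w) = upd i (k1 w + (w $ i)\<^sup>2) w"
    and k1: "smooth_on (cyl i w0 e) k1" "\<And>v s. k1 (upd i s v) = k1 v"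
    using fc by (auto simp: fold_chart_def)
  have F: "smooth_on (cube w0 e) F" by (rule sub_chart_smooth[OF ch])
  define Z where "Z w = snd (pi_m (F w))" for w
  define X where "X w = pos_of (F w) $ i" for w
  have Z: "smooth_on (cube w0 e) Z" unfolding Z_def by (intro smooth_on_snd smooth_on_pi_m F)
  have X: "smooth_on (cube w0 e) X" unfolding X_def by (rule smooth_on_components[OF F])
  have cube: "upd i s v \<in> cube w0 e \<longleftrightarrow> \<bar>s\<bar> < e \<and> v \<in> cyl i w0 e" for s v
    by (rule upd_in_cube[OF w0])
  have dmom: "mom_of (frechet_derivative F (at (upd i s v)) (axis i 1)) = (2 * s) *\<^sub>R axis i 1"
    if sv: "\<bar>s\<bar> < e" "v \<in> cyl i w0 e" for s v
  proof -
    have u: "upd i s v \<in> cube w0 e" using sv by (simp add: cube)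
    have "mom_of (frechet_derivative F (at (upd i s v)) (axis i 1)) $ j = (if j = i then 2 * s else 0)" for j
    proof -
      have "((\<lambda>t. if j = i then k1 v + t\<^sup>2 else v $ j) has_real_derivative (if j = i then 2 * s else 0)) (at s)"
        by (cases "j = i") (auto intro!: derivative_eq_intros)
      then have "((\<lambda>t. mom_of (F (upd i t v)) $ j) has_real_derivative (if j = i then 2 * s else 0)) (at s)"
      proof (rule has_field_derivative_transform_within_open[of _ _ _ "{-e<..<e}"])
        show "(if j = i then k1 v + t\<^sup>2 else v $ j) = mom_of (F (upd i t v)) $ j" if "t \<in> {-e<..<e}" for t
          using that sv mom[of "upd i t v"] by (simp add: cube k1(2) upd_nth abs_less_iff)
      qed (use sv in auto)
      from DERIV_unique[OF DERIV_along_axis[OF smooth_on_components(5)[OF F] u] this]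
      show ?thesis by (simp add: fd_components[OF F u])
    qed
    then show ?thesis by (simp add: vec_eq_iff axis_def)
  qed
  have DERIV_Z: "((\<lambda>t. Z (upd i t v)) has_real_derivative 2 * s * X (upd i s v)) (at s)"
    if sv: "\<bar>s\<bar> < e" "v \<in> cyl i w0 e" for s v
  proof -
    let ?u = "upd i s v"
    have u: "?u \<in> cube w0 e" using sv by (simp add: cube)
    have "((\<lambda>w. pi_m (F w)) has_derivative (\<lambda>v. frechet_derivative pi_m (at (F ?u)) (frechet_derivative F (at ?u) v))) (at ?u)"
      using has_derivative_compose[OF smooth_on_has_derivative[OF F u] has_derivative_pi_m[of "F ?u"]]
      by (simp only: fd_pi_m)
    then have "(Z has_derivative (\<lambda>v. snd (frechet_derivative pi_m (at (F ?u)) (frechet_derivative F (at ?u) v)))) (at ?u)"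
      unfolding Z_def[abs_def] by (rule has_derivative_snd)
    from fun_cong[OF frechet_derivative_at[OF this], of "axis i 1"]
    have "frechet_derivative Z (at ?u) (axis i 1) = 2 * s * X ?u"
      by (simp add: fd_pi_m_contact[OF contact[OF u]] dmom[OF sv] X_def inner_axis' inner_commute[of "axis i 1"] inner_axis)
    then show ?thesis using DERIV_along_axis[OF Z u] by simp
  qed
  let ?D = "{-e<..<e} \<times> cyl i w0 e"
  have D: "open ?D" by (intro open_Times open_cyl) auto
  have sm_u: "smooth_on ?D (\<lambda>z. upd i (fst z) (snd z))" "smooth_on ?D (\<lambda>z. upd i 0 (snd z))"
    by (intro smooth_on_upd smooth_on_fst smooth_on_snd smooth_on_const smooth_on_id D)+
  define h where "h z = Z (upd i (fst z) (snd z)) - Z (upd i 0 (snd z))" for z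
  have h: "smooth_on ?D h"
    unfolding h_def
    by (intro smooth_on_diff smooth_on_compose[OF sm_u(1) Z] smooth_on_compose[OF sm_u(2) Z])
      (use e in \<open>auto simp: cube\<close>)
  have hs: "((\<lambda>s. h (s, v)) has_real_derivative 2 * s * X (upd i s v)) (at s)" if "\<bar>s\<bar> < e" "v \<in> cyl i w0 e" for s v
    using DERIV_diff[OF DERIV_Z[OF that] DERIV_const[of "Z (upd i 0 v)"]] by (simp add: h_def)
  have hs': "frechet_derivative h (at (s, v)) (1, 0) = 2 * s * X (upd i s v)" if "\<bar>s\<bar> < e" "v \<in> cyl i w0 e" for s v
  proof (rule DERIV_unique[OF smooth_on_DERIV_fst[OF h] hs[OF that]])
    show "(s, v) \<in> ?D" using that by auto
  qed
  obtain G where G: "smooth_on ?D G" "\<And>s v. \<bar>s\<bar> < e \<Longrightarrow> v \<in> cyl i w0 e \<Longrightarrow> h (s, v) = s\<^sup>2 * G (s, v)"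
    "\<And>v. v \<in> cyl i w0 e \<Longrightarrow> frechet_derivative (\<lambda>z. frechet_derivative h (at z) (1, 0)) (at (0, v)) (1, 0) = 2 * G (0, v)"
  proof (rule smooth_on_divide_fst_twice[OF h e open_cyl _ _ that])
    show "h (0, v) = 0" for v by (simp add: h_def)
    show "frechet_derivative h (at (0, v)) (1, 0) = 0" if "v \<in> cyl i w0 e" for v
      using hs'[of 0 v] that e by simp
  qed
  define Gs where "Gs z = frechet_derivative G (at z) (1, 0)" for z
  have Gs: "smooth_on ?D Gs" unfolding Gs_def by (rule smooth_on_deriv[OF G(1)])
  have DERIV_G: "((\<lambda>s. G (s, v)) has_real_derivative Gs (s, v)) (at s)" if "\<bar>s\<bar> < e" "v \<in> cyl i w0 e" for s v
    unfolding Gs_def by (rule smooth_on_DERIV_fst[OF G(1)]) (use that in auto)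
  have w0c: "w0 \<in> cyl i w0 e" "upd i 0 w0 = w0" "w0 \<in> cube w0 e"
    using e w0 upd_triv[of i w0] by (auto intro: cyl_center cube_center)
  \<comment> \<open>Differentiating h = s^2 G and comparing with 2 s X gives s R(s) = 0 for R = 2 G
    + s G_s - 2 X. So R has derivative 0 at s = 0, that is 3 G_s = 2 X_s there; G_s = 0 would
    contradict \<open>X0\<close>.\<close>
  have Gs0: "Gs (0, w0) \<noteq> 0"
  proof
    assume 0: "Gs (0, w0) = 0"
    let ?R = "\<lambda>s. 2 * G (s, w0) + s * Gs (s, w0) - 2 * X (upd i s w0)"
    have "?R s = 0" if s: "s \<noteq> 0" "\<bar>s\<bar> < e" for s
    proof -
      have "((\<lambda>s. s\<^sup>2 * G (s, w0)) has_real_derivative 2 * s * G (s, w0) + s\<^sup>2 * Gs (s, w0)) (at s)"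
        using DERIV_G[OF s(2) w0c(1)] by (auto intro!: derivative_eq_intros)
      then have "((\<lambda>s. h (s, w0)) has_real_derivative 2 * s * G (s, w0) + s\<^sup>2 * Gs (s, w0)) (at s)"
        by (rule has_field_derivative_transform_within_open[of _ _ _ "{-e<..<e}"]) (use s w0c G(2) in auto)
      from DERIV_unique[OF hs[OF s(2) w0c(1)] this]
      have "s * ?R s = 0" by (simp add: algebra_simps power2_eq_square)
      then show ?thesis using s by simp
    qed
    moreover have "(?R has_real_derivative - 2 * frechet_derivative X (at w0) (axis i 1)) (at 0)"
    proof -
      have "((\<lambda>s. Gs (s, w0)) has_real_derivative frechet_derivative Gs (at (0, w0)) (1, 0)) (at 0)"
        by (rule smooth_on_DERIV_fst[OF Gs]) (use e w0c in auto)
      moreover have "((\<lambda>t. X (upd i t w0)) has_real_derivative frechet_derivative X (at w0) (axis i 1)) (at 0)"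
        using DERIV_along_axis[OF X, of i 0 w0] w0c by simp
      moreover have "((\<lambda>s. G (s, w0)) has_real_derivative 0) (at 0)"
        using DERIV_G[of 0 w0] e w0c 0 by simp
      ultimately show ?thesis using 0 by (auto intro!: derivative_eq_intros)
    qed
    ultimately have "- 2 * frechet_derivative X (at w0) (axis i 1) = 0"
      using DERIV_zero_of_punctured_zero(2)[OF _ e] by blast
    then show False using X0 fd_components(3)[OF F w0c(3)] by (simp add: X_def[abs_def])
  qed
  \<comment> \<open>The quotient G is not known to ignore coordinate i of its second argument.
    Freezing that coordinate at 0 enforces this and preserves the identity with h, which ignores
    it.\<close>
  define \<phi> where "\<phi> z = G (fst z, upd i 0 (snd z))" for z
  have sm_p: "smooth_on ?D (\<lambda>z. (fst z, upd i 0 (snd z)))"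
    by (intro smooth_on_Pair sm_u smooth_on_fst smooth_on_id D)
  have \<phi>: "smooth_on ?D \<phi>" unfolding \<phi>_def by (rule smooth_on_compose[OF sm_p G(1)]) auto
  have \<phi>s: "frechet_derivative \<phi> (at (s, v)) (1, 0) = Gs (s, upd i 0 v)" if "\<bar>s\<bar> < e" "v \<in> cyl i w0 e" for s v
  proof (rule DERIV_unique[OF smooth_on_DERIV_fst[OF \<phi>]])
    show "(s, v) \<in> ?D" using that by auto
    show "((\<lambda>t. \<phi> (t, v)) has_real_derivative Gs (s, upd i 0 v)) (at s)"
      using DERIV_G[of s "upd i 0 v"] that by (simp add: \<phi>_def)
  qed
  define S where "S = ?D \<inter> (\<lambda>z. Gs (fst z, upd i 0 (snd z))) -` (- {0})"
  have "smooth_on ?D (\<lambda>z. Gs (fst z, upd i 0 (snd z)))" by (rule smooth_on_compose[OF sm_p Gs]) auto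
  then have S: "open S"
    unfolding S_def by (intro continuous_open_preimage[OF smooth_on_continuous D]) auto
  obtain d where d: "d > 0" "{-d<..<d} \<times> cyl i w0 d \<subseteq> S"
  proof (rule product_cyl_nbhd[OF S _ w0 _ that])
    show "(0, w0) \<in> S" using e w0c Gs0 by (simp add: S_def)
    show "(s, v) \<in> S" if "(s, upd i 0 v) \<in> S" for s v using that by (simp add: S_def)
  qed
  define d' where "d' = min d e"
  have d': "d' > 0" "d' \<le> d" "d' \<le> e" using d e by (auto simp: d'_def)
  have sub: "{-d'<..<d'} \<times> cyl i w0 d' \<subseteq> ?D" "cyl i w0 d' \<subseteq> cyl i w0 e" "cube w0 d' \<subseteq> cube w0 e"
    using d' cyl_mono[of d' e i w0] cube_mono[of d' e w0] by auto
  define k2 where "k2 v = Z (upd i 0 v)" for v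
  have "fold_normal_form i w0 d' k1 k2 \<phi> (\<lambda>w. pi_m (F w))"
    unfolding fold_normal_form_def
  proof (intro conjI allI ballI)
    show "smooth_on (cyl i w0 d') k1" by (rule smooth_on_subset[OF k1(1) open_cyl sub(2)])
    show "smooth_on (cyl i w0 d') k2"
      unfolding k2_def
      by (rule smooth_on_compose[OF smooth_on_upd[OF smooth_on_const[OF open_cyl] smooth_on_id[OF open_cyl]] Z])
        (use sub e in \<open>auto simp: cube\<close>)
    show "smooth_on ({-d'<..<d'} \<times> cyl i w0 d') \<phi>"
      by (rule smooth_on_subset[OF \<phi> _ sub(1)]) (intro open_Times open_cyl, auto)
    show "frechet_derivative \<phi> (at (s, v)) (1, 0) \<noteq> 0" if "s \<in> {-d'<..<d'}" "v \<in> cyl i w0 d'" for s v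
    proof -
      have "(s, v) \<in> {-d<..<d} \<times> cyl i w0 d" using that d' cyl_mono[OF d'(2), of i w0] by auto
      then have "(s, v) \<in> S" using d by blast
      then have "\<bar>s\<bar> < e" "v \<in> cyl i w0 e" "Gs (s, upd i 0 v) \<noteq> 0" by (auto simp: S_def)
      then show ?thesis using \<phi>s[of s v] by simp
    qed
    fix w assume "w \<in> cube w0 d'"
    then have w: "w \<in> cube w0 e" using sub by auto
    then have wc: "\<bar>w $ i\<bar> < e" "w \<in> cyl i w0 e" using cube[of "w $ i" w] by auto
    have "Z w = k2 w + (w $ i)\<^sup>2 * \<phi> (w $ i, w)"
      using G(2)[OF wc(1), of "upd i 0 w"] wc(2) by (simp add: h_def k2_def \<phi>_def)
    moreover have "fst (pi_m (F w)) = upd i (k1 w + (w $ i)\<^sup>2) w" using mom[OF w] by (simp add: pi_m_def)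
    ultimately show "pi_m (F w) = (upd i (k1 w + (w $ i)\<^sup>2) w, k2 w + (w $ i)\<^sup>2 * \<phi> (w $ i, w))"
      by (simp add: Z_def prod_eq_iff)
  qed (simp_all add: d' w0 k1 k2_def \<phi>_def)
  with d'(3) show ?thesis by (rule that)
qed

lemma fold_image:
  assumes nf: "fold_normal_form i w0 e k1 k2 \<phi> g"
  shows "g ` cube w0 e = {(p, k2 p + (p $ i - k1 p) * \<phi> (sg * sqrt (p $ i - k1 p), p)) | p sg.
     sg \<in> {1, -1} \<and> p \<in> cyl i w0 e \<and> k1 p \<le> p $ i \<and> sg * sqrt (p $ i - k1 p) \<in> {-e<..<e}}"
proof -
  have w0: "w0 $ i = 0"
    and g: "\<And>w. w \<in> cube w0 e \<Longrightarrow> g w = (upd i (k1 w + (w $ i)\<^sup>2) w, k2 w + (w $ i)\<^sup>2 * \<phi> (w $ i, w))"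
    and k: "\<And>v s. k1 (upd i s v) = k1 v" "\<And>v s. k2 (upd i s v) = k2 v" "\<And>s v t. \<phi> (s, upd i t v) = \<phi> (s, v)"
    using nf by (auto simp: fold_normal_form_def)
  note cube = cube_iff_cyl[OF w0]
  show ?thesis
  proof (intro equalityI subsetI)
    fix y assume "y \<in> g ` cube w0 e"
    then obtain w where w: "w \<in> cube w0 e" "y = g w" by auto
    let ?p = "upd i (k1 w + (w $ i)\<^sup>2) w"
    \<comment> \<open>The branch of the root is the sign of w_i; on the edge w_i = 0 both signs give
      the same point and 1 is taken.\<close>
    define sg :: real where "sg = (if w $ i \<ge> 0 then 1 else - 1)"
    have "sg * sqrt (?p $ i - k1 ?p) = w $ i" by (simp add: k sg_def)
    moreover have "y = (?p, k2 ?p + (?p $ i - k1 ?p) * \<phi> (w $ i, ?p))" using g[OF w(1)] w(2) by (simp add: k)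
    moreover have "?p \<in> cyl i w0 e" "w $ i \<in> {-e<..<e}" "k1 ?p \<le> ?p $ i" using w(1) by (auto simp: cube k)
    moreover have "sg \<in> {1, -1}" by (simp add: sg_def)
    ultimately show "y \<in> {(p, k2 p + (p $ i - k1 p) * \<phi> (sg * sqrt (p $ i - k1 p), p)) | p sg.
       sg \<in> {1, -1} \<and> p \<in> cyl i w0 e \<and> k1 p \<le> p $ i \<and> sg * sqrt (p $ i - k1 p) \<in> {-e<..<e}}"
      unfolding mem_Collect_eq by (intro exI[of _ ?p] exI[of _ sg]) simp
  next
    fix y assume "y \<in> {(p, k2 p + (p $ i - k1 p) * \<phi> (sg * sqrt (p $ i - k1 p), p)) | p sg.
       sg \<in> {1, -1} \<and> p \<in> cyl i w0 e \<and> k1 p \<le> p $ i \<and> sg * sqrt (p $ i - k1 p) \<in> {-e<..<e}}"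
    then obtain p sg where y: "y = (p, k2 p + (p $ i - k1 p) * \<phi> (sg * sqrt (p $ i - k1 p), p))"
      and sg: "sg \<in> {1, -1}" and p: "p \<in> cyl i w0 e" "k1 p \<le> p $ i" "sg * sqrt (p $ i - k1 p) \<in> {-e<..<e}"
      by blast
    define s where "s = sg * sqrt (p $ i - k1 p)"
    have s2: "s\<^sup>2 = p $ i - k1 p" using sg p(2) by (auto simp: s_def power_mult_distrib)
    have w: "upd i s p \<in> cube w0 e" using p by (auto simp: cube s_def abs_less_iff)
    have "g (upd i s p) = y" unfolding g[OF w] y s_def[symmetric] by (simp add: k s2)
    then show "y \<in> g ` cube w0 e" using w by blast
  qed
qed

text \<open>The target coordinates must be smooth where y = p_i - k1 is negative as well, so
  phi(sqrt y) has to be replaced by terms free of roots. The condition on the derivative of phi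
  makes the coefficient of the odd part invertible, which turns w_i^3 into a target
  coordinate.\<close>

lemma fold_cuspidal_edge:
  fixes g :: "real^'n::finite \<Rightarrow> (real^'n) \<times> real"
  assumes nf: "fold_normal_form i w0 e k1 k2 \<phi> g"
  shows "cuspidal_edge_germ g w0"
proof -
  let ?C = "cyl i w0 e"
  have e: "e > 0" and w0: "w0 $ i = 0" and k1: "smooth_on ?C k1" and k2: "smooth_on ?C k2"
    and \<phi>: "smooth_on ({-e<..<e} \<times> ?C) \<phi>"
    and \<phi>s: "\<And>s v. \<bar>s\<bar> < e \<Longrightarrow> v \<in> ?C \<Longrightarrow> frechet_derivative \<phi> (at (s, v)) (1, 0) \<noteq> 0"
    and g: "\<And>w. w \<in> cube w0 e \<Longrightarrow> g w = (upd i (k1 w + (w $ i)\<^sup>2) w, k2 w + (w $ i)\<^sup>2 * \<phi> (w $ i, w))"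
    and k: "\<And>v s. k1 (upd i s v) = k1 v" "\<And>v s. k2 (upd i s v) = k2 v" "\<And>s v t. \<phi> (s, upd i t v) = \<phi> (s, v)"
    using nf by (auto simp: fold_normal_form_def abs_less_iff)
  let ?D = "{-e<..<e} \<times> ?C"
  have D: "open ?D" by (intro open_Times open_cyl) auto
  have sm_neg: "smooth_on ?D (\<lambda>z. \<phi> (- fst z, snd z))"
    by (rule smooth_on_compose[OF smooth_on_Pair[OF smooth_on_minus[OF smooth_on_fst[OF smooth_on_id[OF D]]]
            smooth_on_snd[OF smooth_on_id[OF D]]] \<phi>]) auto
  define ev where "ev z = 1/2 * (\<phi> z + \<phi> (- fst z, snd z))" for z
  define od where "od z = 1/2 * (\<phi> z - \<phi> (- fst z, snd z))" for z
  have ev: "smooth_on ?D ev" and od: "smooth_on ?D od"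
    unfolding ev_def od_def by (intro smooth_on_mult smooth_on_const D smooth_on_add smooth_on_diff \<phi> sm_neg)+
  have star: "r * s \<in> {-e<..<e}" if "s \<in> {-e<..<e}" "r \<in> {0..1}" for r s
  proof -
    have "\<bar>r * s\<bar> \<le> \<bar>s\<bar>" using that by (simp add: abs_mult mult_left_le_one_le)
    then show ?thesis using that by auto
  qed
  obtain O1 where O1: "smooth_on ?D O1" "\<And>s v. s \<in> {-e<..<e} \<Longrightarrow> v \<in> ?C \<Longrightarrow> od (s, v) = s * O1 (s, v)"
    by (rule smooth_on_divide_fst[OF od _ open_cyl star]) (auto simp: od_def)
  \<comment> \<open>The quotient of the odd part by s has at 0 the value of the s-derivative of the
    odd part, which is that of \<open>\<phi>\<close>.\<close>
  have O1_0: "O1 (0, v) \<noteq> 0" if v: "v \<in> ?C" for v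
  proof -
    have in0: "(0, v) \<in> ?D" using v e by auto
    have "((\<lambda>s. s * O1 (s, v)) has_real_derivative O1 (0, v)) (at 0)"
      using smooth_on_DERIV_fst[OF O1(1) in0] by (auto intro!: derivative_eq_intros)
    then have 1: "((\<lambda>s. od (s, v)) has_real_derivative O1 (0, v)) (at 0)"
      by (rule has_field_derivative_transform_within_open[of _ _ _ "{-e<..<e}"]) (use v e O1(2) in auto)
    let ?d = "frechet_derivative \<phi> (at (0, v)) (1, 0)"
    have d: "((\<lambda>s. \<phi> (s, v)) has_real_derivative ?d) (at 0)" by (rule smooth_on_DERIV_fst[OF \<phi> in0])
    then have "((\<lambda>s. \<phi> (- s, v)) has_real_derivative ?d * - 1) (at 0)"
      by (intro DERIV_chain2[where f = "\<lambda>s. \<phi> (s, v)" and g = uminus]) (auto intro!: derivative_eq_intros)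
    from DERIV_cmult[OF DERIV_diff[OF d this], of "1/2"]
    have "((\<lambda>s. od (s, v)) has_real_derivative ?d) (at 0)" by (simp add: od_def)
    from DERIV_unique[OF 1 this] \<phi>s[of 0 v] v e show ?thesis by simp
  qed
  have O1_even: "O1 (- s, v) = O1 (s, v)" if "\<bar>s\<bar> < e" "v \<in> ?C" for s v
  proof (cases "s = 0")
    case False
    have "od (- s, v) = - od (s, v)" by (simp add: od_def field_simps)
    moreover have "s \<in> {-e<..<e}" "- s \<in> {-e<..<e}" using that by auto
    ultimately have "- s * O1 (- s, v) = - (s * O1 (s, v))"
      using O1(2)[of s v] O1(2)[of "- s" v] that(2) by (simp only:)
    then show ?thesis using False by simp
  qed simp
  have ev_even: "ev (- s, v) = ev (s, v)" for s v by (simp add: ev_def)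
  obtain E0 d1 where E0: "d1 > 0" "d1 \<le> e" "smooth_on (UNIV \<times> ?C) E0"
    "\<And>s v. \<bar>s\<bar> < d1 \<Longrightarrow> v \<in> ?C \<Longrightarrow> ev (s, v) = E0 (s\<^sup>2, v)"
    by (rule whitney_even[OF ev e open_cyl ev_even], rule that) simp_all
  obtain A0 d2 where A0: "d2 > 0" "d2 \<le> e" "smooth_on (UNIV \<times> ?C) A0"
    "\<And>s v. \<bar>s\<bar> < d2 \<Longrightarrow> v \<in> ?C \<Longrightarrow> O1 (s, v) = A0 (s\<^sup>2, v)"
    by (rule whitney_even[OF O1(1) e open_cyl], erule (1) O1_even, rule that) simp_all
  let ?UC = "UNIV \<times> ?C :: (real \<times> (real^'n)) set"
  have UC: "open ?UC" by (intro open_Times open_cyl) auto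
  have sm_p: "smooth_on ?UC (\<lambda>z. (fst z, upd i 0 (snd z)))"
    by (intro smooth_on_Pair smooth_on_upd smooth_on_fst smooth_on_snd smooth_on_const smooth_on_id UC)
  \<comment> \<open>As for \<open>\<phi>\<close>, freezing coordinate i makes the extensions
    invariant; the decomposition of \<open>\<phi>\<close> persists because \<open>\<phi>\<close>
    itself ignores that coordinate.\<close>
  define E where "E z = E0 (fst z, upd i 0 (snd z))" for z
  define A where "A z = A0 (fst z, upd i 0 (snd z))" for z
  have E: "smooth_on ?UC E" and A: "smooth_on ?UC A"
    unfolding E_def A_def by (intro smooth_on_compose[OF sm_p E0(3)] smooth_on_compose[OF sm_p A0(3)]; auto)+
  have EA_upd: "E (y, upd i s v) = E (y, v)" "A (y, upd i s v) = A (y, v)" for y s v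
    by (simp_all add: E_def A_def)
  have \<phi>_EA: "\<phi> (s, v) = E (s\<^sup>2, v) + s * A (s\<^sup>2, v)" if s: "\<bar>s\<bar> < d1" "\<bar>s\<bar> < d2" and v: "v \<in> ?C" for s v
  proof -
    have "\<phi> (s, v) = ev (s, upd i 0 v) + od (s, upd i 0 v)" by (simp add: ev_def od_def k field_simps)
    then show ?thesis
      using E0(4)[OF s(1), of "upd i 0 v"] A0(4)[OF s(2), of "upd i 0 v"] O1(2)[of s "upd i 0 v"] s v E0(2)
      by (simp add: E_def A_def abs_less_iff)
  qed
  have w0C: "w0 \<in> ?C" and w0_upd: "upd i 0 w0 = w0"
    using e w0 upd_triv[of i w0] by (auto intro: cyl_center)
  have A_w0: "A (0, w0) \<noteq> 0"
    using O1_0[OF w0C] A0(4)[of 0 w0] A0(1) w0C by (simp add: A_def w0_upd)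
  define S where "S = ?UC \<inter> A -` (- {0})"
  have S: "open S" unfolding S_def by (intro continuous_open_preimage[OF smooth_on_continuous[OF A] UC]) auto
  obtain d3 where d3: "d3 > 0" "{-d3<..<d3} \<times> cyl i w0 d3 \<subseteq> S"
  proof (rule product_cyl_nbhd[OF S _ w0 _ that])
    show "(0, w0) \<in> S" using w0C A_w0 by (simp add: S_def)
    show "(s, v) \<in> S" if "(s, upd i 0 v) \<in> S" for s v using that by (simp add: S_def EA_upd)
  qed
  define \<delta> where "\<delta> = min d3 e"
  have \<delta>: "\<delta> > 0" "\<delta> \<le> d3" "\<delta> \<le> e" using d3 e by (auto simp: \<delta>_def)
  let ?B = "cyl i w0 \<delta>"
  have BC: "?B \<subseteq> ?C" by (rule cyl_mono[OF \<delta>(3)])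
  have A_nz: "A (y, v) \<noteq> 0" if "\<bar>y\<bar> < \<delta>" "v \<in> ?B" for y v
  proof -
    have "(y, v) \<in> {-d3<..<d3} \<times> cyl i w0 d3"
      using that \<delta>(2) cyl_mono[OF \<delta>(2), of i w0] by auto
    then have "(y, v) \<in> S" using d3(2) by blast
    then show ?thesis by (simp add: S_def)
  qed
  let ?BR = "?B \<times> UNIV :: ((real^'n) \<times> real) set"
  have BR: "open ?BR" by (intro open_Times open_cyl) auto
  note k1B = smooth_on_subset[OF k1 open_cyl BC] and k2B = smooth_on_subset[OF k2 open_cyl BC]
  define Y where "Y z = fst z $ i - k1 (fst z)" for z :: "(real^'n) \<times> real"
  have Y: "smooth_on ?BR Y"
    unfolding Y_def
    by (intro smooth_on_diff smooth_on_nth smooth_on_fst smooth_on_id BR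
        smooth_on_compose[OF smooth_on_fst[OF smooth_on_id[OF BR]] k1B]) auto
  define T where "T = ?BR \<inter> Y -` {-\<delta><..<\<delta>}"
  have T: "open T" unfolding T_def by (intro continuous_open_preimage[OF smooth_on_continuous[OF Y] BR]) auto
  \<comment> \<open>The model has its cube in slot i and its square in the last slot. Slot i
    receives (z' - k2 - y E) / A, which is w_i^3 on the front, the last slot y = w_i^2, and the
    shift by \<open>w0\<close> centres the other coordinates. \<open>N\<close> solves these
    equations for p_i and z'.\<close>
  define K where "K z = (upd i ((snd z - k2 (fst z) - Y z * E (Y z, fst z)) / A (Y z, fst z)) (fst z - w0), Y z)" for z
  define T' where "T' = (\<lambda>z. fst z + w0) -` ?B \<inter> snd -` {-\<delta><..<\<delta>}"
  define N where "N z = (upd i (snd z + k1 (fst z + w0)) (fst z + w0),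
      k2 (fst z + w0) + snd z * E (snd z, fst z + w0) + fst z $ i * A (snd z, fst z + w0))" for z
  have T': "open T'"
    unfolding T'_def by (intro open_Int open_vimage open_cyl open_greaterThanLessThan continuous_intros)
  have K_T': "K z \<in> T'" if "z \<in> T" for z
  proof -
    have "upd i c (fst z - w0) + w0 = upd i c (fst z)" for c
      using w0 by (simp add: vec_eq_iff upd_nth)
    then show ?thesis using that by (auto simp: T_def T'_def K_def)
  qed
  have N_Y: "Y (N z) = snd z" for z by (simp add: Y_def N_def k)
  have N_T: "N z \<in> T" if "z \<in> T'" for z
    using that N_Y[of z] by (auto simp: T_def T'_def mem_Times_iff N_def)
  have NK: "N (K z) = z" if "z \<in> T" for z
  proof -
    have z: "fst z \<in> ?B" "\<bar>Y z\<bar> < \<delta>" using that by (auto simp: T_def)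
    have *: "upd i c (fst z - w0) + w0 = upd i c (fst z)" for c
      using w0 by (simp add: vec_eq_iff upd_nth)
    have "fst (N (K z)) = upd i (Y z + k1 (fst z)) (fst z)" by (simp add: N_def K_def * k)
    also have "\<dots> = fst z" by (simp add: Y_def)
    finally have 1: "fst (N (K z)) = fst z" .
    have "snd (N (K z)) = snd z"
      using A_nz[OF z(2,1)] by (simp add: N_def K_def * k EA_upd)
    with 1 show ?thesis by (simp add: prod_eq_iff)
  qed
  have KN: "K (N z) = z" if "z \<in> T'" for z
  proof -
    have z: "fst z + w0 \<in> ?B" "\<bar>snd z\<bar> < \<delta>" using that by (auto simp: T'_def)
    have A: "A (snd z, fst z + w0) \<noteq> 0" by (rule A_nz[OF z(2,1)])
    have "fst (K (N z)) = upd i (fst z $ i) (fst (N z) - w0)"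
      unfolding K_def N_Y using A by (simp add: N_def k EA_upd)
    also have "\<dots> = fst z" by (simp add: N_def vec_eq_iff upd_nth)
    finally show ?thesis by (simp add: prod_eq_iff) (simp add: K_def N_Y)
  qed
  have TB: "T \<subseteq> ?BR" by (auto simp: T_def)
  have YT: "smooth_on T Y" by (rule smooth_on_subset[OF Y T TB])
  have fT: "smooth_on T fst" "smooth_on T snd"
    using smooth_on_fst[OF smooth_on_id[OF T]] smooth_on_snd[OF smooth_on_id[OF T]] by auto
  have YfT: "smooth_on T (\<lambda>z. (Y z, fst z))" by (intro smooth_on_Pair YT fT)
  have K: "smooth_on T K"
    unfolding K_def
  proof (intro smooth_on_Pair smooth_on_upd smooth_on_divide smooth_on_diff smooth_on_mult YT fT smooth_on_const T)
    show "smooth_on T (\<lambda>z. k2 (fst z))"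
      by (rule smooth_on_compose[OF fT(1) k2]) (use TB BC in auto)
    show "smooth_on T (\<lambda>z. E (Y z, fst z))"
      by (rule smooth_on_compose[OF YfT E]) (use TB BC in auto)
    show "smooth_on T (\<lambda>z. A (Y z, fst z))"
      by (rule smooth_on_compose[OF YfT A]) (use TB BC in auto)
    show "A (Y z, fst z) \<noteq> 0" if "z \<in> T" for z
      using that by (intro A_nz) (auto simp: T_def)
  qed
  have fT': "smooth_on T' (\<lambda>z. fst z + w0)" "smooth_on T' snd"
    using smooth_on_add[OF smooth_on_fst[OF smooth_on_id[OF T']] smooth_on_const[OF T']]
      smooth_on_snd[OF smooth_on_id[OF T']] by auto
  have pT': "smooth_on T' (\<lambda>z. (snd z, fst z + w0))" by (intro smooth_on_Pair fT')
  have T'B: "fst z + w0 \<in> ?C" if "z \<in> T'" for z using that BC by (auto simp: T'_def)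
  have N: "smooth_on T' N"
    unfolding N_def
  proof (intro smooth_on_Pair smooth_on_upd smooth_on_add smooth_on_mult fT' smooth_on_nth)
    show "smooth_on T' (\<lambda>z. k1 (fst z + w0))" by (rule smooth_on_compose[OF fT'(1) k1]) (use T'B in auto)
    show "smooth_on T' (\<lambda>z. k2 (fst z + w0))" by (rule smooth_on_compose[OF fT'(1) k2]) (use T'B in auto)
    show "smooth_on T' (\<lambda>z. E (snd z, fst z + w0))" by (rule smooth_on_compose[OF pT' E]) (use T'B in auto)
    show "smooth_on T' (\<lambda>z. A (snd z, fst z + w0))" by (rule smooth_on_compose[OF pT' A]) (use T'B in auto)
  qed (use smooth_on_const[OF T'] smooth_on_fst[OF smooth_on_id[OF T']] in auto)
  have diffeo_K: "diffeo_on T K"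
    by (rule diffeo_onI[OF K N]) (use K_T' N_T NK KN in auto)
  \<comment> \<open>The bounds d1 and d2 ensure the decomposition of \<open>\<phi>\<close>. The
    bound 1 gives w_i^2 \<le> \<bar>w_i\<bar> < \<open>\<delta>\<close>, so that the image stays in
    T.\<close>
  define \<epsilon> where "\<epsilon> = min (min d1 d2) (min \<delta> (min 1 \<delta>))"
  have \<epsilon>: "\<epsilon> > 0" "\<epsilon> \<le> d1" "\<epsilon> \<le> d2" "\<epsilon> \<le> \<delta>" "\<epsilon> \<le> 1" "\<epsilon> \<le> e" using E0 A0 \<delta> by (auto simp: \<epsilon>_def)
  let ?S = "cube w0 \<epsilon>"
  have diffeo_h: "diffeo_on ?S (\<lambda>w. w - w0)"
  proof (rule diffeo_onI)
    show "smooth_on ?S (\<lambda>w. w - w0)"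
      by (intro smooth_on_diff smooth_on_id smooth_on_const open_cube)
    show "smooth_on (cube 0 \<epsilon>) (\<lambda>w. w + w0)"
      by (intro smooth_on_add smooth_on_id smooth_on_const open_cube)
  qed (auto simp: cube_def)
  have gT: "g w \<in> T" and Kg: "K (g w) = cusp_edge_model i (w - w0)" if w: "w \<in> ?S" for w
  proof -
    have wc: "\<bar>w $ i\<bar> < \<epsilon>" "w \<in> cyl i w0 \<epsilon>" using w cube_iff_cyl[OF w0] by auto
    have we: "w \<in> cube w0 e" using w cube_mono[OF \<epsilon>(6), of w0] by auto
    have wB: "w \<in> ?B" using wc cyl_mono[OF \<epsilon>(4), of i w0] by auto
    have sq: "(w $ i)\<^sup>2 < \<delta>"
    proof -
      have "(w $ i)\<^sup>2 = \<bar>w $ i\<bar> * \<bar>w $ i\<bar>" by (simp add: power2_eq_square)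
      also have "\<dots> \<le> \<bar>w $ i\<bar> * 1" using wc \<epsilon> by (intro mult_left_mono) auto
      also have "\<dots> < \<delta>" using wc \<epsilon> by auto
      finally show ?thesis .
    qed
    have Yg: "Y (g w) = (w $ i)\<^sup>2" by (simp add: g[OF we] Y_def k)
    have fg: "fst (g w) = upd i (k1 w + (w $ i)\<^sup>2) w" by (simp add: g[OF we])
    have "- \<delta> < (w $ i)\<^sup>2" using \<delta>(1) by (smt (verit) zero_le_power2)
    then show "g w \<in> T" using wB sq by (simp add: T_def mem_Times_iff fg Yg)
    have A: "A ((w $ i)\<^sup>2, w) \<noteq> 0" using sq wB by (intro A_nz) auto
    have "\<phi> (w $ i, w) = E ((w $ i)\<^sup>2, w) + w $ i * A ((w $ i)\<^sup>2, w)"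
      using wc wB BC \<epsilon> by (intro \<phi>_EA) auto
    then have "snd (g w) - k2 w - (w $ i)\<^sup>2 * E ((w $ i)\<^sup>2, w) = (w $ i) ^ 3 * A ((w $ i)\<^sup>2, w)"
      by (simp add: g[OF we] algebra_simps power2_eq_square power3_eq_cube)
    then have "K (g w) = (upd i ((w $ i) ^ 3) (upd i (k1 w + (w $ i)\<^sup>2) w - w0), (w $ i)\<^sup>2)"
      using A by (simp add: K_def Yg fg k EA_upd)
    also have "\<dots> = cusp_edge_model i (w - w0)"
      using w0 by (simp add: cusp_edge_model_def vec_eq_iff upd_nth)
    finally show "K (g w) = cusp_edge_model i (w - w0)" .
  qed
  have c: "w0 \<in> ?S" using \<epsilon> by (auto intro: cube_center)
  have "cusp_edge_model i (w0 - w0) = 0" by (simp add: cusp_edge_model_def vec_eq_iff prod_eq_iff)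
  then have "K (g w0) = 0" using Kg[OF c] by simp
  then show ?thesis
    unfolding cuspidal_edge_germ_def
    using c diffeo_h diffeo_K gT Kg
    by (intro exI[of _ i] exI[of _ ?S] exI[of _ "\<lambda>w. w - w0"] exI[of _ T] exI[of _ K]) auto
qed

subsection \<open>The bi-valued potential\<close>

lemma sub_chart_restrict:
  assumes "sub_chart L W f" "open V" "V \<subseteq> W"
  shows "sub_chart L V f"
  using sub_chart_reparam[OF assms(1) smooth_on_id[OF assms(2)] smooth_on_id[OF assms(2)] _ assms(3)] by simp

text \<open>The definition ranges over all charts; one chart suffices because any other one factors
  locally through it. A linear left inverse l of the derivative of f makes l o f a local
  diffeomorphism, and its inverse m yields the smooth transition map m o l o g.\<close>

lemma tangent_space_eq:
  fixes f :: "real^'n::finite \<Rightarrow> 'n pt"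
  assumes f: "sub_chart L W f" and u0: "u0 \<in> W"
  shows "tangent_space L (f u0) = range (frechet_derivative f (at u0))"
proof (intro equalityI subsetI)
  fix w assume "w \<in> range (frechet_derivative f (at u0))"
  then show "w \<in> tangent_space L (f u0)" using f u0 unfolding tangent_space_def by blast
next
  fix w assume "w \<in> tangent_space L (f u0)"
  then obtain W' g u v where g: "sub_chart L W' g" "u \<in> W'" "g u = f u0" and w: "w = frechet_derivative g (at u) v"
    unfolding tangent_space_def by auto
  have smf: "smooth_on W f" and smg: "smooth_on W' g" using f g sub_chart_smooth by auto
  have "linear (frechet_derivative f (at u0))"
    using smooth_on_has_derivative[OF smf u0] by (rule has_derivative_linear)
  moreover have "inj (frechet_derivative f (at u0))" using f u0 by (auto simp: sub_chart_def)
  ultimately obtain l where l: "linear l" "l \<circ> frechet_derivative f (at u0) = id"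
    using linear_injective_left_inverse by blast
  have bl: "bounded_linear l" using l(1) by (simp add: linear_conv_bounded_linear)
  have lf: "smooth_on W (\<lambda>x. l (f x))" by (rule smooth_on_bounded_linear_comp[OF bl smf])
  have lf_inj: "v = 0" if "frechet_derivative (\<lambda>x. l (f x)) (at u0) v = 0" for v
    using fun_cong[OF l(2), of v] that by (simp add: smooth_on_fd_linear[OF bl smf u0])
  obtain U V m where UV: "open U" "u0 \<in> U" "U \<subseteq> W" "open V" "(\<lambda>x. l (f x)) ` U = V" "smooth_on V m" "m ` V = U"
    "\<And>x. x \<in> U \<Longrightarrow> m (l (f x)) = x" "\<And>y. y \<in> V \<Longrightarrow> l (f (m y)) = y"
    using smooth_inverse_function[OF lf u0 lf_inj] by blast
  obtain Ob where Ob: "open Ob" "f ` U = L \<inter> Ob"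
    using sub_chart_restrict[OF f UV(1,3)] by (auto simp: sub_chart_def)
  \<comment> \<open>\<open>Ob\<close> cuts out of L exactly the image of U under f, so on N the
    second chart takes its values there.\<close>
  define N where "N = W' \<inter> g -` Ob"
  have N: "open N"
    unfolding N_def by (rule continuous_open_preimage[OF smooth_on_continuous[OF smg] smooth_on_open[OF smg] Ob(1)])
  have "f u0 \<in> Ob" using UV(2) Ob(2) by auto
  then have uN: "u \<in> N" using g by (simp add: N_def)
  have NW': "N \<subseteq> W'" by (auto simp: N_def)
  have gN: "g y \<in> f ` U" if "y \<in> N" for y
    using g(1) that Ob(2) by (auto simp: N_def sub_chart_def)
  note smgN = smooth_on_subset[OF smg N NW']
  have "smooth_on N (\<lambda>y. l (g y))" by (rule smooth_on_bounded_linear_comp[OF bl smgN])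
  then have k: "smooth_on N (\<lambda>y. m (l (g y)))"
  proof (rule smooth_on_compose[OF _ UV(6)])
    show "(\<lambda>y. l (g y)) ` N \<subseteq> V"
    proof (intro image_subsetI)
      fix y assume "y \<in> N"
      then obtain x where "x \<in> U" "g y = f x" using gN by blast
      then show "l (g y) \<in> V" using UV(5) by auto
    qed
  qed
  have fk: "f (m (l (g y))) = g y" if "y \<in> N" for y
    using gN[OF that] UV(8) by auto
  have mu: "m (l (g u)) = u0" using UV(2,8) g by simp
  have "frechet_derivative g (at u) = frechet_derivative (\<lambda>y. f (m (l (g y)))) (at u)"
    by (rule frechet_derivative_cong_open[OF N uN]) (simp add: fk)
  also have "\<dots> = (\<lambda>v. frechet_derivative f (at u0) (frechet_derivative (\<lambda>y. m (l (g y))) (at u) v))"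
    by (subst smooth_on_fd_chain[OF k uN smf]) (use mu u0 in auto)
  finally show "w \<in> range (frechet_derivative f (at u0))" using w by simp
qed

text \<open>The momenta other than p_i, completed by a linear function that does not vanish on the
  kernel of dp, form coordinates. In them dp maps axis i to a multiple of itself, and since that
  axis is outside the range, to 0.\<close>

lemma adapted_chart_exists:
  fixes L :: "'n::finite pt set"
  assumes leg: "legendre_submanifold L" and pL: "pbar \<in> L"
    and rank: "dim (frechet_derivative pi_m (at pbar) ` tangent_space L pbar) = CARD('n) - 1"
  obtains V f v0 i where "sub_chart L V f" "v0 \<in> V" "f v0 = pbar"
    "\<And>v j. v \<in> V \<Longrightarrow> j \<noteq> i \<Longrightarrow> mom_of (f v) $ j = v $ j"
    "mom_of (frechet_derivative f (at v0) (axis i 1)) = 0"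
proof -
  obtain W f where f': "sub_chart L W f" "pbar \<in> f ` W"
    using leg pL unfolding legendre_submanifold_def by blast
  then obtain u0 where f: "sub_chart L W f" "u0 \<in> W" "f u0 = pbar" by auto
  have smf: "smooth_on W f" by (rule sub_chart_smooth[OF f(1)])
  have contact: "contact_form (f u0) (frechet_derivative f (at u0) v) = 0" for v
    using leg f unfolding legendre_submanifold_def by blast
  define Dp where "Dp v = mom_of (frechet_derivative f (at u0) v)" for v
  have "bounded_linear Dp"
    unfolding Dp_def[abs_def]
    by (intro bounded_linear_compose[OF bounded_linear_fst] bounded_linear_compose[OF bounded_linear_snd]
        has_derivative_bounded_linear[OF smooth_on_has_derivative[OF smf f(2)]])
  then have linD: "linear Dp" by (rule bounded_linear.linear)
  then interpret Dp: linear Dp .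
  have "frechet_derivative pi_m (at pbar) ` tangent_space L pbar = (\<lambda>b. (b, b \<bullet> pos_of pbar)) ` range Dp"
    unfolding f(3)[symmetric] tangent_space_eq[OF f(1,2)] image_image
    by (simp add: fd_pi_m_contact[OF contact] Dp_def)
  moreover have "dim ((\<lambda>b. (b, b \<bullet> pos_of pbar)) ` range Dp) = dim (range Dp)"
  proof (rule dim_image_eq)
    show "linear (\<lambda>b. (b, b \<bullet> pos_of pbar))"
      by (intro bounded_linear.linear bounded_linear_Pair bounded_linear_inner_left bounded_linear_ident)
    show "inj_on (\<lambda>b. (b, b \<bullet> pos_of pbar)) (span (range Dp))" by (rule inj_onI) simp
  qed
  ultimately have dimD: "dim (range Dp) = CARD('n) - 1" using rank by simp
  have card_pos: "CARD('n) > 0" by simp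
  have subD: "subspace (range Dp)" by (rule linear_subspace_image[OF linD subspace_UNIV])
  have "\<exists>i. axis i 1 \<notin> range Dp"
  proof (rule ccontr)
    assume "\<not> (\<exists>i. axis i 1 \<notin> range Dp)"
    then have "Basis \<subseteq> range Dp" by (auto simp: Basis_vec_def)
    then have "range Dp = UNIV" using span_minimal[of Basis "range Dp"] subD by auto
    then have "dim (range Dp) = CARD('n)" by simp
    then show False using dimD card_pos by arith
  qed
  then obtain i where i: "axis i 1 \<notin> range Dp" by blast
  have "\<not> inj Dp"
  proof
    assume "inj Dp"
    then have "dim (range Dp) = CARD('n)" using dim_image_eq[OF linD, of UNIV] by simp
    then show False using dimD card_pos by arith
  qed
  then obtain \<xi> where \<xi>: "Dp \<xi> = 0" "\<xi> \<noteq> 0" using linear_injective_0[OF linD] by blast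
  \<comment> \<open>The functional given by the inner product with the kernel vector
    \<open>\<xi>\<close> restores the lost dimension: \<open>\<xi>\<close> is sent to a multiple of
    the missing axis. Surjectivity is then a dimension count.\<close>
  define M where "M v = Dp v + (\<xi> \<bullet> v) *\<^sub>R axis i 1" for v
  have linM: "linear M"
    by (rule linearI) (simp_all add: M_def Dp.add Dp.scaleR algebra_simps)
  have "surj M"
  proof -
    have "axis i 1 = M ((1 / (\<xi> \<bullet> \<xi>)) *\<^sub>R \<xi>)" using \<xi> by (simp add: M_def Dp.scaleR)
    then have 1: "axis i 1 \<in> range M" by blast
    have 2: "Dp v \<in> range M" for v
    proof -
      have "Dp v = M (v - ((\<xi> \<bullet> v) / (\<xi> \<bullet> \<xi>)) *\<^sub>R \<xi>)"
        using \<xi> by (simp add: M_def Dp.diff Dp.scaleR inner_diff_right)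
      then show ?thesis by blast
    qed
    have "dim (insert (axis i 1) (range Dp)) = CARD('n)"
    proof -
      have "span (range Dp) = range Dp" using subD by (simp only: span_eq_iff)
      then have "dim (insert (axis i 1) (range Dp)) = dim (range Dp) + 1"
        using i by (simp only: dim_insert if_False)
      then show ?thesis using dimD card_pos by arith
    qed
    moreover have "dim (insert (axis i 1) (range Dp)) \<le> dim (range M)"
      using 1 2 by (intro dim_subset) auto
    ultimately have "dim (UNIV :: (real^'n) set) \<le> dim (range M)" by simp
    then show ?thesis
      by (intro subspace_dim_equal linear_subspace_image[OF linM] subspace_UNIV) auto
  qed
  then have injM: "inj M" using linear_surjective_imp_injective[OF linM _ refl] by blast
  define h where "h u = upd i (\<xi> \<bullet> u) (mom_of (f u))" for u
  have h: "smooth_on W h"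
    unfolding h_def
    by (intro smooth_on_upd smooth_on_inner smooth_on_const smooth_on_id smooth_on_components smf smooth_on_open[OF smf])
  have dh: "frechet_derivative h (at u0) = (\<lambda>v. upd i (\<xi> \<bullet> v) (Dp v))"
  proof -
    have p: "((\<lambda>u. mom_of (f u)) has_derivative Dp) (at u0)"
      unfolding Dp_def[abs_def]
      by (intro has_derivative_fst has_derivative_snd smooth_on_has_derivative[OF smf f(2)])
    have "((\<lambda>u. \<xi> \<bullet> u) has_derivative (\<lambda>v. \<xi> \<bullet> v)) (at u0)"
      by (rule bounded_linear_imp_has_derivative[OF bounded_linear_inner_right])
    from has_derivative_upd[OF this p] show ?thesis
      unfolding h_def by (rule frechet_derivative_at[symmetric])
  qed
  \<comment> \<open>A value of \<open>Dp\<close> supported in slot i is a multiple of axis i; were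
    it not 0, rescaling would put that axis into the range.\<close>
  have DpI: "Dp v = 0" if "\<And>j. j \<noteq> i \<Longrightarrow> Dp v $ j = 0" for v
  proof -
    have eq: "Dp v = (Dp v $ i) *\<^sub>R axis i 1" using that by (auto simp: vec_eq_iff axis_def)
    have "Dp v $ i = 0"
    proof (rule ccontr)
      assume nz: "Dp v $ i \<noteq> 0"
      have "Dp ((1 / (Dp v $ i)) *\<^sub>R v) = axis i 1"
        unfolding Dp.scaleR by (subst (2) eq) (use nz in simp)
      then show False using i by (metis rangeI)
    qed
    then show ?thesis using eq by simp
  qed
  have inj: "v = 0" if "frechet_derivative h (at u0) v = 0" for v
  proof -
    have v: "\<xi> \<bullet> v = 0" "\<And>j. j \<noteq> i \<Longrightarrow> Dp v $ j = 0"
      using that by (auto simp: dh vec_eq_iff upd_nth split: if_splits)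
    have "M v = M 0" using v(1) DpI[OF v(2)] by (simp add: M_def Dp.zero)
    then show ?thesis by (rule injD[OF injM])
  qed
  obtain U V g where UV: "open U" "u0 \<in> U" "U \<subseteq> W" "open V" "h ` U = V" "smooth_on V g" "g ` V = U"
    "\<And>x. x \<in> U \<Longrightarrow> g (h x) = x" "\<And>y. y \<in> V \<Longrightarrow> h (g y) = y"
    using smooth_inverse_function[OF h f(2) inj] by blast
  have hU: "smooth_on U h" by (rule smooth_on_subset[OF h UV(1,3)])
  have v0: "h u0 \<in> V" "g (h u0) = u0" using UV by auto
  have ch: "sub_chart L V (\<lambda>y. f (g y))"
    by (rule sub_chart_reparam[OF f(1) UV(6) hU UV(7,3,9)])
  show ?thesis
  proof (rule that[OF ch v0(1)])
    show "f (g (h u0)) = pbar" using v0 f(3) by simp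
    show "mom_of (f (g v)) $ j = v $ j" if "v \<in> V" "j \<noteq> i" for v j
      using arg_cong[OF UV(9)[OF that(1)], of "\<lambda>x. x $ j"] that(2) by (simp add: h_def upd_other)
    let ?n = "frechet_derivative g (at (h u0)) (axis i 1)"
    have "frechet_derivative h (at u0) ?n = axis i 1"
      using smooth_left_inverse_fd[OF UV(6) v0(1) hU _ UV(9)] v0(2) UV(2) by simp
    then have eq: "upd i (\<xi> \<bullet> ?n) (Dp ?n) = axis i 1" by (simp only: dh)
    have "Dp ?n $ j = 0" if "j \<noteq> i" for j
      using arg_cong[OF eq, of "\<lambda>x. x $ j"] that by (simp add: upd_other axis_def)
    then have "Dp ?n = 0" by (rule DpI)
    moreover have "frechet_derivative (\<lambda>y. f (g y)) (at (h u0)) (axis i 1) = frechet_derivative f (at u0) ?n"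
      using smooth_on_fd_chain[OF UV(6) v0(1) smf] v0(2) f(2) by simp
    ultimately show "mom_of (frechet_derivative (\<lambda>y. f (g y)) (at (h u0)) (axis i 1)) = 0"
      by (simp add: Dp_def)
  qed
qed

text \<open>The contact form and z' = p . x - z are both unchanged when x and p reverse sign
  together, whereas a fold of p_i that opens downwards now opens upwards.\<close>

definition flip_pt :: "'n::finite pt \<Rightarrow> 'n pt" where
  "flip_pt q = (- pos_of q, - mom_of q, snd (snd q))"

lemma flip_flip [simp]: "flip_pt (flip_pt q) = q"
  by (simp add: flip_pt_def)

lemma flip_image_flip [simp]: "flip_pt ` flip_pt ` L = L"
  by (simp add: image_image)

lemma bounded_linear_flip: "bounded_linear flip_pt"
  unfolding flip_pt_def[abs_def]
  by (intro bounded_linear_Pair bounded_linear_minus bounded_linear_fst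
      bounded_linear_compose[OF bounded_linear_fst bounded_linear_snd]
      bounded_linear_compose[OF bounded_linear_snd bounded_linear_snd])

lemma pi_m_flip: "pi_m (flip_pt q) = (- fst (pi_m q), snd (pi_m q))"
  by (simp add: pi_m_def flip_pt_def)

lemma contact_form_flip: "contact_form (flip_pt q) (flip_pt w) = contact_form q w"
  by (simp add: contact_form_def flip_pt_def)

text \<open>The flip is linear and its own inverse, so open sets and the inverse chart are
  transported by the same continuous map.\<close>

lemma sub_chart_flip:
  assumes f: "sub_chart L W f"
  shows "sub_chart (flip_pt ` L) W (\<lambda>u. flip_pt (f u))"
  unfolding sub_chart_def
proof (intro conjI ballI)
  have fW: "open W" "smooth_on W f" "inj_on f W" "continuous_on (f ` W) (inv_into W f)"
    "\<And>u. u \<in> W \<Longrightarrow> inj (frechet_derivative f (at u))"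
    using f by (auto simp: sub_chart_def)
  obtain Ob where Ob: "open Ob" "f ` W = L \<inter> Ob" using f by (auto simp: sub_chart_def)
  have contF: "continuous_on S flip_pt" for S :: "'a pt set"
    by (intro linear_continuous_on bounded_linear_flip)
  have inj: "inj_on flip_pt S" for S :: "'a pt set" by (metis flip_flip inj_onI)
  show "open W" by fact
  show "smooth_on W (\<lambda>u. flip_pt (f u))" by (rule smooth_on_bounded_linear_comp[OF bounded_linear_flip fW(2)])
  show injf: "inj_on (\<lambda>u. flip_pt (f u)) W" using fW(3) by (auto simp: inj_on_def) (metis flip_flip)
  have "flip_pt ` Ob = flip_pt -` Ob"
  proof (intro equalityI subsetI)
    fix q assume "q \<in> flip_pt -` Ob"
    then have "flip_pt (flip_pt q) \<in> flip_pt ` Ob" by blast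
    then show "q \<in> flip_pt ` Ob" by simp
  qed auto
  then have "open (flip_pt ` Ob)" using open_vimage[OF Ob(1) contF] by simp
  moreover have "(\<lambda>u. flip_pt (f u)) ` W = flip_pt ` L \<inter> flip_pt ` Ob"
    using Ob(2) inj_on_image_Int[OF inj[of UNIV], of L Ob] by (simp add: image_image[symmetric])
  ultimately show "\<exists>O'. open O' \<and> (\<lambda>u. flip_pt (f u)) ` W = flip_pt ` L \<inter> O'" by blast
  have "continuous_on (flip_pt ` f ` W) (\<lambda>q. inv_into W f (flip_pt q))"
    by (rule continuous_on_compose2[OF fW(4) contF]) auto
  moreover have "inv_into W f (flip_pt q) = inv_into W (\<lambda>u. flip_pt (f u)) q" if "q \<in> flip_pt ` f ` W" for q
    using that by (auto simp: inv_into_f_f[OF fW(3)] inv_into_f_f[OF injf])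
  ultimately show "continuous_on ((\<lambda>u. flip_pt (f u)) ` W) (inv_into W (\<lambda>u. flip_pt (f u)))"
    by (simp add: image_image[symmetric] cong: continuous_on_cong)
  fix u assume u: "u \<in> W"
  have "inj (flip_pt \<circ> frechet_derivative f (at u))" by (intro inj_compose fW u inj)
  then show "inj (frechet_derivative (\<lambda>u. flip_pt (f u)) (at u))"
    by (simp add: smooth_on_fd_linear[OF bounded_linear_flip fW(2) u] o_def)
qed

text \<open>\<open>matrix_inv\<close> is a choice, so its value is determined only through the
  defining equations; \<open>mat 1\<close> witnesses that they can be satisfied.\<close>

lemma affine_legendre_id: "affine_legendre (mat 1) 0 0 0 q = (q :: 'n::finite pt)"
proof -
  have "matrix_inv (mat 1) *v x = x" for x :: "real^'n"
  proof -
    have "(mat 1 :: real^'n^'n) ** matrix_inv (mat 1) = mat 1"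
      unfolding matrix_inv_def by (rule someI2[of _ "mat 1"]) simp_all
    then show ?thesis by simp
  qed
  then show ?thesis by (simp add: affine_legendre_def transpose_mat)
qed

lemma neg_mat_1_vector: "(- mat 1 :: real^'n^'n) *v x = - x"
  using matrix_vector_mult_diff_rdistrib[of 0 "mat 1" x] by simp

lemma neg_mat_1_square: "(- mat 1 :: real^'n^'n) ** - mat 1 = mat 1"
  by (simp add: matrix_eq matrix_vector_mul_assoc[symmetric] neg_mat_1_vector)

lemma affine_legendre_flip: "affine_legendre (- mat 1) 0 0 0 q = flip_pt (q :: 'n::finite pt)"
proof -
  have t: "transpose (- mat 1 :: real^'n^'n) = - mat 1"
    by (simp add: transpose_def vec_eq_iff mat_def)
  have "matrix_inv (- mat 1) *v x = - x" for x :: "real^'n"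
  proof -
    have "(- mat 1 :: real^'n^'n) ** matrix_inv (- mat 1) = mat 1"
      unfolding matrix_inv_def
      by (rule someI2[of _ "- mat 1"]) (simp_all add: neg_mat_1_square)
    then have "(- mat 1 :: real^'n^'n) *v (matrix_inv (- mat 1) *v x) = x"
      by (simp add: matrix_vector_mul_assoc)
    then show ?thesis by (simp only: neg_mat_1_vector) (metis minus_minus)
  qed
  then show ?thesis by (simp add: affine_legendre_def t neg_mat_1_vector flip_pt_def)
qed

text \<open>The contact condition is assumed for all charts because it is applied to the fold chart
  constructed here, not to f. Stated this way it also fits the flipped manifold.\<close>

lemma fold_of_adapted_chart:
  fixes f :: "real^'n::finite \<Rightarrow> 'n pt"
  assumes ch: "sub_chart L W f" and v0: "v0 \<in> W"
    and contact: "\<And>W f u v. sub_chart L W f \<Longrightarrow> u \<in> W \<Longrightarrow> contact_form (f u) (frechet_derivative f (at u) v) = 0"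
    and coords: "\<And>u j. u \<in> W \<Longrightarrow> j \<noteq> i \<Longrightarrow> mom_of (f u) $ j = u $ j"
    and P1: "mom_of (frechet_derivative f (at v0) (axis i 1)) $ i = 0"
    and P2: "frechet_derivative (\<lambda>u. mom_of (frechet_derivative f (at u) (axis i 1)) $ i) (at v0) (axis i 1) > 0"
    and X1: "pos_of (frechet_derivative f (at v0) (axis i 1)) $ i \<noteq> 0"
  obtains w0 e F k1 k2 \<phi> where "sub_chart L (cube w0 e) F" "F w0 = f v0"
    "fold_normal_form i w0 e k1 k2 \<phi> (\<lambda>w. pi_m (F w))"
proof -
  obtain w0 e F k1 where F: "fold_chart L i w0 e F k1" "F w0 = f v0"
    "pos_of (frechet_derivative F (at w0) (axis i 1)) $ i \<noteq> 0"
    using fold_chart_exists[OF ch v0 coords P1 P2 X1] by metis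
  have chF: "sub_chart L (cube w0 e) F" using F(1) by (simp add: fold_chart_def)
  obtain d k2 \<phi> where d: "d \<le> e" "fold_normal_form i w0 d k1 k2 \<phi> (\<lambda>w. pi_m (F w))"
    using fold_potential[OF F(1) contact[OF chF] F(3)] by metis
  have "sub_chart L (cube w0 d) F" by (rule sub_chart_restrict[OF chF open_cube cube_mono[OF d(1)]])
  then show ?thesis using F(2) d(2) by (rule that)
qed

text \<open>The conclusion is the existential part of the theorem for a manifold already in good
  position, so that both signs of the fold share it. The interval (-e, e) and the cylinder of the
  normal form serve as U1 and U2.\<close>

lemma bivalued_potential:
  fixes F :: "real^'n::finite \<Rightarrow> 'n pt"
  assumes ch: "sub_chart L (cube w0 e) F" and q: "F w0 = q"
    and nf: "fold_normal_form i w0 e k1 k2 \<phi> (\<lambda>w. pi_m (F w))"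
  shows "\<exists>i Ob U1 U2 \<phi> k1 k2.
            open Ob \<and> q \<in> Ob \<and>
            open U1 \<and> (0::real) \<in> U1 \<and>
            open U2 \<and> (\<forall>v. v \<in> U2 \<longleftrightarrow> drop_coord i v \<in> U2) \<and> fst (snd q) \<in> U2 \<and>
            smooth_on U2 k1 \<and> smooth_on U2 k2 \<and>
            (\<forall>v. k1 v = k1 (drop_coord i v)) \<and> (\<forall>v. k2 v = k2 (drop_coord i v)) \<and>
            smooth_on (U1 \<times> U2) \<phi> \<and> (\<forall>s v. \<phi> (s, v) = \<phi> (s, drop_coord i v)) \<and>
            (\<forall>s\<in>U1. \<forall>v\<in>U2. frechet_derivative \<phi> (at (s, v)) (1, 0) \<noteq> 0) \<and>
            pi_m ` (L \<inter> Ob) =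
              {(p, k2 p + (p $ i - k1 p) * \<phi> (sg * sqrt (p $ i - k1 p), p)) | p sg.
                 sg \<in> {1, -1} \<and> p \<in> U2 \<and> k1 p \<le> p $ i \<and> sg * sqrt (p $ i - k1 p) \<in> U1}"
proof -
  obtain Ob where Ob: "open Ob" "F ` cube w0 e = L \<inter> Ob" using ch by (auto simp: sub_chart_def)
  have e: "e > 0" using nf by (simp add: fold_normal_form_def)
  have w0: "w0 \<in> cube w0 e" by (rule cube_center[OF e])
  have "mom_of q = fst (pi_m (F w0))" using q by (simp add: pi_m_def)
  also have "\<dots> = upd i (k1 w0 + (w0 $ i)\<^sup>2) w0" using nf w0 by (simp add: fold_normal_form_def)
  finally have "mom_of q \<in> cyl i w0 e" using cyl_center[OF e, of w0 i] by simp
  moreover have "q \<in> Ob" using Ob(2) w0 q by auto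
  moreover have "pi_m ` (L \<inter> Ob) = (\<lambda>w. pi_m (F w)) ` cube w0 e"
    unfolding Ob(2)[symmetric] by (simp add: image_image)
  ultimately show ?thesis
    using nf Ob(1) e unfolding fold_image[OF nf]
    by (intro exI[of _ i] exI[of _ Ob] exI[of _ "{-e<..<e}"] exI[of _ "cyl i w0 e"] exI[of _ \<phi>] exI[of _ k1] exI[of _ k2])
      (simp add: fold_normal_form_def drop_coord_eq_upd open_cyl)
qed

text \<open>The reflection of the target is absorbed into the target diffeomorphism. It returns the
  germ from the flipped manifold to the original one.\<close>

lemma cuspidal_edge_germ_reflect:
  fixes g :: "real^'n::finite \<Rightarrow> (real^'n) \<times> real"
  assumes g: "cuspidal_edge_germ (\<lambda>u. (- fst (g u), snd (g u))) u0"
  shows "cuspidal_edge_germ g u0"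
proof -
  let ?r = "\<lambda>z :: (real^'n) \<times> real. (- fst z, snd z)"
  have rr: "?r (?r z) = z" for z by simp
  have bl: "bounded_linear ?r"
    by (intro bounded_linear_Pair bounded_linear_minus bounded_linear_fst bounded_linear_snd)
  obtain i :: 'n and S h T k where "u0 \<in> S \<and> diffeo_on S h \<and> h u0 = 0 \<and> ?r (g u0) \<in> T \<and> (\<lambda>u. ?r (g u)) ` S \<subseteq> T \<and>
    diffeo_on T k \<and> k (?r (g u0)) = 0 \<and> (\<forall>u\<in>S. k (?r (g u)) = cusp_edge_model i (h u))"
    using g unfolding cuspidal_edge_germ_def by (elim exE) (rule that)
  then have *: "u0 \<in> S" "diffeo_on S h" "h u0 = 0" "?r (g u0) \<in> T" "(\<lambda>u. ?r (g u)) ` S \<subseteq> T"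
    "diffeo_on T k" "k (?r (g u0)) = 0" "\<forall>u\<in>S. k (?r (g u)) = cusp_edge_model i (h u)"
    by blast+
  obtain T' k' where k: "smooth_on T k" "smooth_on T' k'" "k ` T = T'" "k' ` T' = T"
    "\<And>x. x \<in> T \<Longrightarrow> k' (k x) = x" "\<And>y. y \<in> T' \<Longrightarrow> k (k' y) = y" by (rule diffeo_onE[OF *(6) that])
  have oT: "open (?r -` T)"
    by (rule open_vimage[OF smooth_on_open[OF k(1)] linear_continuous_on[OF bl]])
  have "diffeo_on (?r -` T) (\<lambda>z. k (?r z))"
  proof (rule diffeo_onI)
    show "smooth_on (?r -` T) (\<lambda>z. k (?r z))"
      by (rule smooth_on_compose[OF smooth_on_bounded_linear[OF bl oT] k(1)]) auto
    show "smooth_on T' (\<lambda>y. ?r (k' y))"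
      by (rule smooth_on_bounded_linear_comp[OF bl k(2)])
  qed (use k in auto)
  then have body: "u0 \<in> S \<and> diffeo_on S h \<and> h u0 = 0 \<and> g u0 \<in> ?r -` T \<and> g ` S \<subseteq> ?r -` T \<and>
      diffeo_on (?r -` T) (\<lambda>z. k (?r z)) \<and> k (?r (g u0)) = 0 \<and> (\<forall>u\<in>S. k (?r (g u)) = cusp_edge_model i (h u))"
    using * by auto
  show ?thesis
    unfolding cuspidal_edge_germ_def
    by (rule exI[of _ i], rule exI[of _ S], rule exI[of _ h], rule exI[of _ "?r -` T"],
        rule exI[of _ "\<lambda>z. k (?r z)"], rule body)
qed

section \<open>The tau condition in an adapted chart and the two signs of the fold\<close>

theorem theorem3p3:
  fixes L :: "'n::finite pt set" and pbar :: "'n pt"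
  assumes leg: "legendre_submanifold L"
    and pL: "pbar \<in> L"
    and rank: "dim (frechet_derivative pi_m (at pbar) ` tangent_space L pbar) = CARD('n) - 1"
    and nondeg: "\<And>W f u0 \<xi>. sub_chart L W f \<Longrightarrow> u0 \<in> W \<Longrightarrow> f u0 = pbar \<Longrightarrow>
        smooth_on W \<xi> \<Longrightarrow> \<xi> u0 \<noteq> 0 \<Longrightarrow>
        frechet_derivative pi_m (at pbar) (frechet_derivative f (at u0) (\<xi> u0)) = 0 \<Longrightarrow>
        tau_EE' (frechet_derivative pi_e (at pbar) (frechet_derivative f (at u0) (\<xi> u0)))
                (proj_E' pbar
                   (frechet_derivative
                      (\<lambda>u. frechet_derivative pi_m (at (f u)) (frechet_derivative f (at u) (\<xi> u)))
                      (at u0) (\<xi> u0))) \<noteq> 0"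
  shows "(\<exists>W f u0. sub_chart L W f \<and> u0 \<in> W \<and> f u0 = pbar \<and> cuspidal_edge_germ (pi_m \<circ> f) u0)
    \<and> (\<exists>A b c d. invertible A \<and>
         (let \<Psi> = affine_legendre A b c d; L' = \<Psi> ` L; q = \<Psi> pbar in
          \<exists>i Ob U1 U2 \<phi> k1 k2.
            open Ob \<and> q \<in> Ob \<and>
            open U1 \<and> (0::real) \<in> U1 \<and>
            open U2 \<and> (\<forall>v. v \<in> U2 \<longleftrightarrow> drop_coord i v \<in> U2) \<and> fst (snd q) \<in> U2 \<and>
            smooth_on U2 k1 \<and> smooth_on U2 k2 \<and>
            (\<forall>v. k1 v = k1 (drop_coord i v)) \<and> (\<forall>v. k2 v = k2 (drop_coord i v)) \<and>
            smooth_on (U1 \<times> U2) \<phi> \<and> (\<forall>s v. \<phi> (s, v) = \<phi> (s, drop_coord i v)) \<and>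
            (\<forall>s\<in>U1. \<forall>v\<in>U2. frechet_derivative \<phi> (at (s, v)) (1, 0) \<noteq> 0) \<and>
            pi_m ` (L' \<inter> Ob) =
              {(p, k2 p + (p $ i - k1 p) * \<phi> (sg * sqrt (p $ i - k1 p), p)) | p sg.
                 sg \<in> {1, -1} \<and> p \<in> U2 \<and> k1 p \<le> p $ i \<and> sg * sqrt (p $ i - k1 p) \<in> U1}))"
proof -
  obtain V f v0 i where f: "sub_chart L V f" "v0 \<in> V" "f v0 = pbar"
    and coords: "\<And>v j. v \<in> V \<Longrightarrow> j \<noteq> i \<Longrightarrow> mom_of (f v) $ j = v $ j"
    and P1: "mom_of (frechet_derivative f (at v0) (axis i 1)) = 0"
    using adapted_chart_exists[OF leg pL rank] by metis
  have smf: "smooth_on V f" by (rule sub_chart_smooth[OF f(1)])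
  have V: "open V" by (rule smooth_on_open[OF smf])
  have contact: "contact_form (g u) (frechet_derivative g (at u) v) = 0" if "sub_chart L W g" "u \<in> W" for W g u v
    using leg that unfolding legendre_submanifold_def by blast
  define e where "e = (axis i 1 :: real^'n)"
  define D where "D u = frechet_derivative f (at u) e" for u
  have D: "smooth_on V D" unfolding D_def by (rule smooth_on_deriv[OF smf])
  define Q where "Q u = mom_of (D u) $ i" for u
  have Q: "smooth_on V Q" unfolding Q_def by (intro smooth_on_components D)
  \<comment> \<open>The hypothesis is applied to the constant field along axis i, which is in the
    kernel at \<open>v0\<close> by \<open>P1\<close>. The form tau pairs x-entries with p-entries,
    and the second argument has only its i-th p-entry possibly non-zero, so its value is half of
    this product.\<close>
  have nz: "pos_of (D v0) $ i * frechet_derivative Q (at v0) e \<noteq> 0"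
  proof -
    let ?H = "\<lambda>u. frechet_derivative pi_m (at (f u)) (D u)"
    have H: "smooth_on V ?H"
      unfolding fd_pi_m
      by (intro smooth_on_Pair smooth_on_diff smooth_on_add smooth_on_inner smooth_on_components D smf)
    have "frechet_derivative pi_m (at pbar) (D v0) = 0"
      using fd_pi_m_contact[OF contact[OF f(1,2)], of e] P1 f(3) by (simp add: D_def e_def zero_prod_def)
    then have "tau_EE' (frechet_derivative pi_e (at pbar) (D v0)) (proj_E' pbar (frechet_derivative ?H (at v0) e)) \<noteq> 0"
      using nondeg[OF f smooth_on_const[OF V], of e] by (simp add: D_def e_def axis_eq_0_iff)
    moreover have "fst (frechet_derivative ?H (at v0) e) $ j = (if j = i then frechet_derivative Q (at v0) e else 0)" for j
    proof -
      have "fst (frechet_derivative ?H (at v0) e) $ j = frechet_derivative (\<lambda>u. fst (?H u) $ j) (at v0) e"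
        using smooth_on_fd_linear[OF bounded_linear_compose[OF bounded_linear_vec_nth bounded_linear_fst] H f(2)]
        by simp
      also have "\<dots> = frechet_derivative (\<lambda>u. mom_of (D u) $ j) (at v0) e" by (simp add: fd_pi_m)
      also have "\<dots> = (if j = i then frechet_derivative Q (at v0) e else 0)"
      proof (cases "j = i")
        case False
        \<comment> \<open>This holds on the whole chart and not only at \<open>v0\<close>, so the
          derivative in question vanishes as well.\<close>
        have "mom_of (D u) $ j = 0" if u: "u \<in> V" for u
        proof -
          have "mom_of (D u) $ j = frechet_derivative (\<lambda>u. mom_of (f u) $ j) (at u) e"
            by (simp add: fd_components[OF smf u] D_def)
          also have "\<dots> = frechet_derivative (\<lambda>u. u $ j) (at u) e"
            using frechet_derivative_cong_open[OF V u, of "\<lambda>u. mom_of (f u) $ j" "\<lambda>u. u $ j"] coords False by simp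
          also have "frechet_derivative (\<lambda>u :: real^'n. u $ j) (at u) = (\<lambda>v. v $ j)"
            by (rule frechet_derivative_at[symmetric, OF bounded_linear_imp_has_derivative[OF bounded_linear_vec_nth]])
          finally show ?thesis using False by (simp add: e_def axis_def)
        qed
        then have "frechet_derivative (\<lambda>u. mom_of (D u) $ j) (at v0) = frechet_derivative (\<lambda>u. 0) (at v0)"
          by (intro frechet_derivative_cong_open[OF V f(2)])
        then show ?thesis using False by simp
      qed (simp add: Q_def[abs_def])
      finally show ?thesis .
    qed
    ultimately show ?thesis
      by (simp add: tau_EE'_def tau_def proj_E'_def fd_pi_e if_distrib[of "\<lambda>x. _ * x"] cong: if_cong)
  qed
  show ?thesis
  proof (cases "frechet_derivative Q (at v0) e > 0")
    case True
    obtain w0 r F k1 k2 \<phi> where F: "sub_chart L (cube w0 r) F" "F w0 = f v0"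
      "fold_normal_form i w0 r k1 k2 \<phi> (\<lambda>w. pi_m (F w))"
    proof (rule fold_of_adapted_chart[OF f(1,2) contact coords])
      show "0 < frechet_derivative (\<lambda>u. mom_of (frechet_derivative f (at u) (axis i 1)) $ i) (at v0) (axis i 1)"
        using True by (simp add: Q_def[abs_def] D_def e_def)
    qed (use P1 nz in \<open>simp_all add: D_def e_def\<close>)
    have "r > 0" using F(3) by (simp add: fold_normal_form_def)
    then have w0: "w0 \<in> cube w0 r" by (rule cube_center)
    show ?thesis
    proof (intro conjI, goal_cases)
      case 1
      show ?case
        using F w0 f(3) fold_cuspidal_edge[OF F(3)] by (auto simp: o_def)
    next
      case 2
      have id: "affine_legendre (mat 1) 0 0 0 = (\<lambda>q :: 'n pt. q)" by (simp add: fun_eq_iff affine_legendre_id)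
      have inv: "invertible (mat 1 :: real^'n^'n)" by (simp add: invertible_det_nz)
      show ?case
        using bivalued_potential[OF F(1,2,3)] inv
        by (intro exI[of _ "mat 1"] exI[of _ 0] conjI) (simp_all only: id image_ident Let_def f(3))
    qed
  next
    case False
    then have neg: "frechet_derivative Q (at v0) e < 0" using nz by auto
    let ?V = "uminus ` V"
    let ?L = "flip_pt ` L"
    \<comment> \<open>The parameters are reversed together with the momenta, which preserves p_j =
      u_j for j <> i. The new p_i is -p_i(-u), whose second derivative has the opposite
      sign.\<close>
    define f2 where "f2 u = flip_pt (f (- u))" for u
    have V': "open ?V" by (rule open_negations[OF V])
    have sm_neg: "smooth_on S uminus" if "open S" for S :: "(real^'n) set"
      by (rule smooth_on_minus[OF smooth_on_id[OF that]])
    have chneg: "sub_chart L ?V (\<lambda>u. f (- u))"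
      by (rule sub_chart_reparam[OF f(1) sm_neg[OF V'] sm_neg[OF V]]) (auto simp: image_image)
    have ch2: "sub_chart ?L ?V f2" unfolding f2_def by (rule sub_chart_flip[OF chneg])
    have contact2: "contact_form (g u) (frechet_derivative g (at u) v) = 0" if g: "sub_chart ?L W g" "u \<in> W" for W g u v
    proof -
      have "sub_chart L W (\<lambda>u. flip_pt (g u))" using sub_chart_flip[OF g(1)] by simp
      from contact[OF this g(2), of v] show ?thesis
        by (simp add: smooth_on_fd_linear[OF bounded_linear_flip sub_chart_smooth[OF g(1)] g(2)] contact_form_flip)
    qed
    have fd_neg: "frechet_derivative (\<lambda>u. h (- u)) (at u) v = - frechet_derivative h (at (- u)) v"
      if h: "smooth_on V h" and u: "u \<in> ?V" for h :: "real^'n \<Rightarrow> 'c::real_normed_vector" and u v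
    proof -
      have mu: "- u \<in> V" using u by auto
      have "((\<lambda>u. h (- u)) has_derivative (\<lambda>v. frechet_derivative h (at (- u)) (- v))) (at u)"
        by (rule has_derivative_compose[OF has_derivative_minus[OF has_derivative_ident] smooth_on_has_derivative[OF h mu]])
      from fun_cong[OF frechet_derivative_at[OF this], of v] show ?thesis
        using smooth_on_fd_scale[OF h mu, of "- 1" v] by simp
    qed
    have fd2: "frechet_derivative f2 (at u) e = flip_pt (- D (- u))" if u: "u \<in> ?V" for u
      unfolding f2_def
      using smooth_on_fd_linear[OF bounded_linear_flip sub_chart_smooth[OF chneg] u] fd_neg[OF smf u]
      by (simp add: D_def)
    have v0': "- v0 \<in> ?V" using f(2) by simp
    obtain w0 r F k1 k2 \<phi> where F: "sub_chart ?L (cube w0 r) F" "F w0 = f2 (- v0)"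
      "fold_normal_form i w0 r k1 k2 \<phi> (\<lambda>w. pi_m (F w))"
    proof (rule fold_of_adapted_chart[OF ch2 v0' contact2])
      show "mom_of (f2 u) $ j = u $ j" if "u \<in> ?V" "j \<noteq> i" for u j
        using coords[of "- u" j] that by (auto simp: f2_def flip_pt_def)
      show "mom_of (frechet_derivative f2 (at (- v0)) (axis i 1)) $ i = 0"
        "pos_of (frechet_derivative f2 (at (- v0)) (axis i 1)) $ i \<noteq> 0"
        using fd2[OF v0'] P1 nz by (simp_all add: e_def D_def flip_pt_def)
      have "frechet_derivative (\<lambda>u. mom_of (frechet_derivative f2 (at u) e) $ i) (at (- v0)) e =
          frechet_derivative (\<lambda>u. Q (- u)) (at (- v0)) e"
        using frechet_derivative_cong_open[OF V' v0', of "\<lambda>u. mom_of (frechet_derivative f2 (at u) e) $ i" "\<lambda>u. Q (- u)"]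
        by (simp add: fd2 Q_def flip_pt_def)
      also have "\<dots> = - frechet_derivative Q (at v0) e" using fd_neg[OF Q v0'] by simp
      finally show "0 < frechet_derivative (\<lambda>u. mom_of (frechet_derivative f2 (at u) (axis i 1)) $ i) (at (- v0)) (axis i 1)"
        using neg by (simp add: e_def)
    qed
    have F_w0: "F w0 = flip_pt pbar" using F(2) f(3) by (simp add: f2_def)
    have "r > 0" using F(3) by (simp add: fold_normal_form_def)
    then have w0: "w0 \<in> cube w0 r" by (rule cube_center)
    show ?thesis
    proof (intro conjI, goal_cases)
      case 1
      \<comment> \<open>The germ is asserted for L itself, so the chart is flipped back; the
        potential is asserted for the image of L under the affine map and is taken as it
        stands.\<close>
      have "sub_chart L (cube w0 r) (\<lambda>w. flip_pt (F w))" using sub_chart_flip[OF F(1)] by simp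
      moreover have "cuspidal_edge_germ (pi_m \<circ> (\<lambda>w. flip_pt (F w))) w0"
        by (rule cuspidal_edge_germ_reflect) (use fold_cuspidal_edge[OF F(3)] in \<open>simp add: pi_m_flip\<close>)
      ultimately show ?case
        using w0 F_w0 by (intro exI[of _ "cube w0 r"] exI[of _ "\<lambda>w. flip_pt (F w)"] exI[of _ w0]) simp
    next
      case 2
      have id: "affine_legendre (- mat 1) 0 0 0 = (flip_pt :: 'n pt \<Rightarrow> 'n pt)"
        by (simp add: fun_eq_iff affine_legendre_flip)
      have inv: "invertible (- mat 1 :: real^'n^'n)"
        unfolding invertible_def using neg_mat_1_square by blast
      show ?case
        using bivalued_potential[OF F(1) F_w0 F(3)] inv
        by (intro exI[of _ "- mat 1"] exI[of _ 0] conjI) (simp_all only: id Let_def)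
    qed
  qed
qed

end
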